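(* Let $P\subset\mathbb{R}^3$ be a weakly convex polyhedron which is star-shaped with respect to one of its vertices $v_0$. Let $P=S_1\cup\cdots\cup S_N$ be a triangulation of $P$ as a union of non-degenerate simplices, all containing $v_0$ as a vertex and having disjoint interiors, let $e_1,\dots,e_m$ be its interior edges, $l_i$ the length of $e_i$, and $\theta_i$ the total angle around $e_i$. Then the matrix $$\Lambda_P=\left(\frac{\partial\theta_i}{\partial l_j}\right)_{1\le i,j\le m}$$ (evaluated at the lengths realized in $P$) is positive definite.
   Context: A polyhedron $P$ is a compact region of $\mathbb{R}^3$ bounded by a closed embedded polyhedral surface (not necessarily convex); its vertices, edges and faces are those of its boundary surface. Weakly convex: the vertices of $P$ are the vertices of a convex polyhedron (i.e. every vertex of $P$ is an extreme point of the convex hull of $P$). Star-shaped with respect to a vertex $v_0$: the interior of $P$ has a decomposition as the union of finitely many non-degenerate simplices (tetrahedra), whose vertices are vertices of $P$, all having $v_0$ as one of their vertices, with pairwise disjoint interiors, which meet each other along common faces and meet the boundary of $P$ along faces (of the simplices and of the triangulated boundary), i.e. they form a triangulation of $P$ compatible with the triangulation of the boundary of $P$. The triangulation $S_1\cup\cdots\cup S_N$ in the claim is of this kind. Triangulated boundary: all polyhedra are taken to be triangulated: non-triangular faces are subdivided into triangles by adding "flat" edges (diagonals), without adding vertices. For $P$ star-shaped with respect to $v_0$, the non-triangular faces containing $v_0$ are subdivided using only diagonals containing $v_0$, so that the triangulation of the boundary is compatible with the triangulation of the interior of $P$. Interior edges: the edges of the $S_j$ which are not contained in faces of $P$. Definition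 of $\theta_i$ as a function of $(l_1,\dots,l_m)$: consider small variations of the lengths $l_i$ of the interior edges, while the lengths of all the edges of the (triangulated) boundary of $P$ remain constant. Such a variation determines a unique deformation of the Euclidean metric on each simplex $S_j$ (each stays a Euclidean simplex with the prescribed edge lengths), and the deformed simplices can still be glued isometrically along their common faces. The angle $\theta_i$ around $e_i$ is the sum of the dihedral angles at $e_i$ of the deformed simplices containing $e_i$; it equals $2\pi$ for the undeformed $P$ but may vary, so cone singularities may appear along the $e_i$. *)

theory Defs
  imports "HOL-Analysis.Analysis"
begin

section \<open>Triangulated polyhedra\<close>

definition verts :: "(real^3) set set \<Rightarrow> (real^3) set"
  where "verts \<K> = {v. \<exists>C\<in>\<K>. v extreme_point_of C}"

text \<open>
  A closed polyhedral surface is given by its (solid) triangles: they form a triangulation and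
  their union is a connected topological surface without boundary, embedded in space.
\<close>

definition closed_polyhedral_surface :: "(real^3) set set \<Rightarrow> bool"
  where "closed_polyhedral_surface \<K> \<longleftrightarrow>
    triangulation \<K> \<and> (\<forall>F\<in>\<K>. 2 simplex F) \<and> connected (\<Union>\<K>) \<and>
    (\<forall>x\<in>\<Union>\<K>. \<exists>U. openin (top_of_set (\<Union>\<K>)) U \<and> x \<in> U \<and> U homeomorphic (UNIV :: (real^2) set))"

text \<open>
  A polyhedron \<open>P\<close> comes with the triangulation \<open>\<K>\<close> of its boundary; the vertices of \<open>P\<close> are
  the elements of \<open>verts \<K>\<close>. Edges of \<open>\<K>\<close> may be flat. For a weakly convex \<open>P\<close> no vertex can
  be flat or lie inside an edge, because an extreme point of the convex hull of \<open>P\<close> lies in no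
  open segment contained in \<open>P\<close>; so \<open>\<K>\<close> then subdivides the faces without adding vertices.
\<close>

definition triangulated_polyhedron :: "(real^3) set \<Rightarrow> (real^3) set set \<Rightarrow> bool"
  where "triangulated_polyhedron P \<K> \<longleftrightarrow>
    compact P \<and> closure (interior P) = P \<and> connected (interior P) \<and>
    closed_polyhedral_surface \<K> \<and> frontier P = \<Union>\<K>"

definition weakly_convex :: "(real^3) set \<Rightarrow> (real^3) set set \<Rightarrow> bool"
  where "weakly_convex P \<K> \<longleftrightarrow> (\<forall>v\<in>verts \<K>. v extreme_point_of (convex hull P))"

text \<open>
  Triangulations of \<open>P\<close> into tetrahedra with common vertex \<open>v\<^sub>0\<close> and no new vertices. That
  \<open>\<T> \<union> \<K>\<close> is a triangulation says that tetrahedra meet each other, and meet the triangles of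
  the boundary, along common faces. Hence every triangle of \<open>\<K>\<close> is a face of some tetrahedron;
  in particular a triangle coplanar with \<open>v\<^sub>0\<close> contains \<open>v\<^sub>0\<close>, so the faces through \<open>v\<^sub>0\<close>
  are subdivided by diagonals from \<open>v\<^sub>0\<close> only.
\<close>

definition star_triangulation ::
    "(real^3) set \<Rightarrow> (real^3) set set \<Rightarrow> real^3 \<Rightarrow> (real^3) set set \<Rightarrow> bool"
  where "star_triangulation P \<K> v\<^sub>0 \<T> \<longleftrightarrow>
    finite \<T> \<and> \<Union>\<T> = P \<and>
    (\<forall>S\<in>\<T>. 3 simplex S \<and> v\<^sub>0 extreme_point_of S) \<and>
    verts \<T> \<subseteq> verts \<K> \<and>
    (\<forall>S\<in>\<T>. \<forall>S'\<in>\<T>. S \<noteq> S' \<longrightarrow> interior S \<inter> interior S' = {}) \<and>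
    triangulation (\<T> \<union> \<K>)"

definition star_shaped_wrt :: "(real^3) set \<Rightarrow> (real^3) set set \<Rightarrow> real^3 \<Rightarrow> bool"
  where "star_shaped_wrt P \<K> v\<^sub>0 \<longleftrightarrow> (\<exists>\<T>. star_triangulation P \<K> v\<^sub>0 \<T>)"

text \<open>
  An edge contained in a nontriangular face of \<open>P\<close> is, since \<open>\<T> \<union> \<K>\<close> is a triangulation,
  contained in one of the triangles of \<open>\<K>\<close> subdividing that face.
\<close>

definition interior_edges :: "(real^3) set set \<Rightarrow> (real^3) set set \<Rightarrow> (real^3) set set"
  where "interior_edges \<K> \<T> = {e. (\<exists>S\<in>\<T>. e edge_of S) \<and> \<not> (\<exists>F\<in>\<K>. e \<subseteq> F)}"

lemma finite_interior_edges:
  assumes "star_triangulation P \<K> v\<^sub>0 \<T>"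
  shows "finite (interior_edges \<K> \<T>)"
proof -
  have "finite {e. e edge_of S}" if "S \<in> \<T>" for S
  proof -
    have "polytope S"
      using assms that by (auto simp: star_triangulation_def intro: simplex_imp_polytope)
    then have "finite {e. e face_of S}"
      by (rule finite_polytope_faces)
    then show ?thesis
      by (rule rev_finite_subset) (auto simp: edge_of_def)
  qed
  then have "finite (\<Union>S\<in>\<T>. {e. e edge_of S})"
    using assms by (auto simp: star_triangulation_def)
  then show ?thesis
    by (rule rev_finite_subset) (auto simp: interior_edges_def)
qed

section \<open>Angles as functions of the edge lengths\<close>

definition vector_angle :: "real^3 \<Rightarrow> real^3 \<Rightarrow> real"
  where "vector_angle u w = arccos (u \<bullet> w / (norm u * norm w))"

definition orth_component :: "real^3 \<Rightarrow> real^3 \<Rightarrow> real^3"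
  where "orth_component u w = w - (w \<bullet> u / (u \<bullet> u)) *\<^sub>R u"

text \<open>The dihedral angle of the tetrahedron with vertices \<open>a, b, c, d\<close> at the edge \<open>ab\<close>.\<close>

definition dihedral_angle :: "real^3 \<Rightarrow> real^3 \<Rightarrow> real^3 \<Rightarrow> real^3 \<Rightarrow> real"
  where "dihedral_angle a b c d =
    vector_angle (orth_component (b - a) (c - a)) (orth_component (b - a) (d - a))"

text \<open>
  Edges are segments as point sets, and \<open>L\<close> assigns a length to each. The map \<open>\<phi>\<close> sends the
  vertices of the tetrahedron \<open>S\<close> to those of a Euclidean tetrahedron with edge lengths \<open>L\<close>.
\<close>

definition realizes_lengths :: "((real^3) set \<Rightarrow> real) \<Rightarrow> (real^3) set \<Rightarrow> (real^3 \<Rightarrow> real^3) \<Rightarrow> bool"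
  where "realizes_lengths L S \<phi> \<longleftrightarrow>
    (\<forall>x y. x extreme_point_of S \<and> y extreme_point_of S \<and> x \<noteq> y \<longrightarrow>
       dist (\<phi> x) (\<phi> y) = L (closed_segment x y))"

text \<open>
  The dihedral angle at (the edge corresponding to) \<open>e\<close> of the tetrahedron \<open>S\<close> deformed to
  have edge lengths \<open>L\<close>. It depends neither on the numbering of the vertices nor on \<open>\<phi>\<close>, which
  is unique up to congruence; \<open>\<phi>\<close> exists for all \<open>L\<close> close to the edge lengths of \<open>S\<close>.
\<close>

definition deformed_dihedral_angle ::
    "((real^3) set \<Rightarrow> real) \<Rightarrow> (real^3) set \<Rightarrow> (real^3) set \<Rightarrow> real"
  where "deformed_dihedral_angle L S e =
    (THE \<alpha>. \<exists>\<phi> a b c d. realizes_lengths L S \<phi> \<and>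
       {x. x extreme_point_of e} = {a, b} \<and> {x. x extreme_point_of S} = {a, b, c, d} \<and>
       \<alpha> = dihedral_angle (\<phi> a) (\<phi> b) (\<phi> c) (\<phi> d))"

text \<open>
  The length of an edge (a segment) is its diameter. Only the lengths \<open>l\<close> of interior edges
  vary; all other edges keep their lengths.
\<close>

definition edge_lengths ::
    "(real^3) set set \<Rightarrow> (real^3) set set \<Rightarrow> ((real^3) set \<Rightarrow> real) \<Rightarrow> (real^3) set \<Rightarrow> real"
  where "edge_lengths \<K> \<T> l e = (if e \<in> interior_edges \<K> \<T> then l e else diameter e)"

definition total_angle ::
    "(real^3) set set \<Rightarrow> (real^3) set set \<Rightarrow> (real^3) set \<Rightarrow> ((real^3) set \<Rightarrow> real) \<Rightarrow> real"
  where "total_angle \<K> \<T> e l =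
    (\<Sum>S | S \<in> \<T> \<and> e edge_of S. deformed_dihedral_angle (edge_lengths \<K> \<T> l) S e)"

section \<open>Partial derivatives and positive definite matrices\<close>

definition has_partial_deriv_at :: "(('i \<Rightarrow> real) \<Rightarrow> real) \<Rightarrow> 'i \<Rightarrow> ('i \<Rightarrow> real) \<Rightarrow> bool"
  where "has_partial_deriv_at f j l \<longleftrightarrow> (\<lambda>t. f (l(j := t))) differentiable (at (l j))"

definition partial_deriv :: "(('i \<Rightarrow> real) \<Rightarrow> real) \<Rightarrow> 'i \<Rightarrow> ('i \<Rightarrow> real) \<Rightarrow> real"
  where "partial_deriv f j l = deriv (\<lambda>t. f (l(j := t))) (l j)"

text \<open>
  Matrices have rows and columns indexed by a finite set \<open>I\<close>; positive definiteness includes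
  symmetry.
\<close>

definition positive_definite_on :: "'i set \<Rightarrow> ('i \<Rightarrow> 'i \<Rightarrow> real) \<Rightarrow> bool"
  where "positive_definite_on I M \<longleftrightarrow>
    (\<forall>i\<in>I. \<forall>j\<in>I. M i j = M j i) \<and>
    (\<forall>x. (\<exists>i\<in>I. x i \<noteq> 0) \<longrightarrow> (\<Sum>i\<in>I. \<Sum>j\<in>I. x i * M i j * x j) > 0)"

text \<open>The matrix of partial derivatives at the lengths realized in \<open>P\<close>.\<close>

definition Lambda_matrix ::
    "(real^3) set set \<Rightarrow> (real^3) set set \<Rightarrow> (real^3) set \<Rightarrow> (real^3) set \<Rightarrow> real"
  where "Lambda_matrix \<K> \<T> e f = partial_deriv (total_angle \<K> \<T> e) f diameter"

end

theory Submission
  imports Defs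
begin

text \<open>
  Every interior edge contains \<open>v\<^sub>0\<close>, because a facet opposite to \<open>v\<^sub>0\<close> determines its
  tetrahedron and so lies in the boundary. Put \<open>v\<^sub>0\<close> at the origin, let \<open>f\<close> be the function that is
  linear on the cone over each boundary triangle \<open>abc\<close> opposite to \<open>v\<^sub>0\<close> and equal to 1 on that triangle,
  and let \<open>y\<^sub>i = l\<^sub>i x\<^sub>i\<close>. The quadratic form of \<open>\<Lambda>\<close> is
  \<open>\<Sum> w\<^sub>a\<^sub>b s\<^sub>a s\<^sub>b (y\<^sub>a / s\<^sub>a - y\<^sub>b / s\<^sub>b)\<^sup>2\<close> over the edges \<open>ab\<close> of these triangles, where \<open>s\<close> is a
  linear functional that is positive on the vertices and \<open>w\<^sub>a\<^sub>b (a \<times> b)\<close> is the jump of the gradient of \<open>f\<close>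
  across \<open>ab\<close>; linear functions drop out because \<open>w\<close> is an equilibrium stress.

  If all edges are convex then all weights are nonnegative. Otherwise a reflex edge can be flipped, since the
  vertices are in convex position. A flip enlarges the polyhedron and decreases the form by a nonnegative
  multiple of the square of a linear form, so after finitely many flips the convex case is reached. There,
  if the form vanishes at \<open>y\<close> then \<open>y / s\<close> is constant along edges of positive weight. Among the vertices
  where it takes a given nonzero value choose one whose central projection to the plane \<open>s = 1\<close> is farthest
  from the origin: by equilibrium all weights at it vanish, so the surface is flat there, which contradicts
  convex position.
\<close>

text \<open>Differentiating the angles gives diagonal coefficients
  \<open>(a \<bullet> b) / (a \<bullet> a)\<close>, which are negative when the angle between
  \<open>a\<close> and \<open>b\<close> at the apex is obtuse, so positivity cannot be read off edge
  by edge. At a vertex in \<open>I\<close> the weighted neighbours add up to a multiple of that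
  vertex, so all linear functionals give the same diagonal sum. A functional positive on all
  vertices may thus be used; it exists because the apex is in convex position too. Outside
  \<open>I\<close> the test function vanishes.

  A flip changes the weights of the six edges of one tetrahedron by products of coefficients of the
  linear dependence of its four vertices. Such a stress has rank one, which is why the form changes
  by a single square, with the sign of the added volume.

  Flipped surfaces are kept only as multisets of triangles. This avoids following embeddedness
  through the flips: the argument runs on positive orientation, edge balance at \<open>I\<close> and
  convex position of the vertices, and flips of reflex edges preserve all three.\<close>

unbundle cross3_syntax

section \<open>Weights of a spherical triangle\<close>

definition trip :: "real^3 \<Rightarrow> real^3 \<Rightarrow> real^3 \<Rightarrow> real"
  where "trip a b c = a \<bullet> (b \<times> c)"

definition area_vector :: "real^3 \<Rightarrow> real^3 \<Rightarrow> real^3 \<Rightarrow> real^3"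
  where "area_vector a b c = a \<times> b + b \<times> c + c \<times> a"

text \<open>For positively oriented \<open>a\<close>, \<open>b\<close>, \<open>c\<close> this is
  \<open>cot \<beta> * norm (a - b) / (norm (a \<times> b))^2\<close>, where \<beta> is the dihedral
  angle at \<open>ab\<close> of the tetrahedron with vertices 0, \<open>a\<close>, \<open>b\<close>,
  \<open>c\<close>.\<close>

definition wt :: "real^3 \<Rightarrow> real^3 \<Rightarrow> real^3 \<Rightarrow> real"
  where "wt a b c = (a \<times> b) \<bullet> area_vector a b c / (trip a b c * ((a \<times> b) \<bullet> (a \<times> b)))"

text \<open>The determinant of \<open>b - a\<close>, \<open>c - a\<close>, \<open>d - a\<close>,
  that is, six times the signed volume of the tetrahedron \<open>abcd\<close>. It is also the sum of
  the coefficients in \<open>trip_expansion\<close>.\<close>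

definition trip_defect :: "real^3 \<Rightarrow> real^3 \<Rightarrow> real^3 \<Rightarrow> real^3 \<Rightarrow> real"
  where "trip_defect a b c d = trip b c d - trip a c d + trip a b d - trip a b c"

lemma trip_rotate: "trip b c a = trip a b c" and trip_rotate': "trip c a b = trip a b c"
  by (simp_all add: trip_def cross3_simps)

lemma trip_swap: "trip b a c = - trip a b c"
  by (simp add: trip_def cross3_simps)

lemma trip_swap': "trip a c b = - trip a b c"
  by (simp add: trip_def cross3_simps)

lemma trip_eq_0 [simp]: "trip a a c = 0" "trip a c c = 0" "trip a c a = 0" "trip 0 a c = 0" "trip a 0 c = 0" "trip a c 0 = 0"
  by (simp_all add: trip_def dot_cross_self)

lemma cross_dot_trip: "(a \<times> b) \<bullet> c = trip a b c"
  by (simp add: trip_def cross3_simps)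

lemma trip_neq_0_imp_cross_neq_0:
  assumes "trip a b c \<noteq> 0" shows "a \<times> b \<noteq> 0" "b \<times> c \<noteq> 0" "c \<times> a \<noteq> 0" "a \<times> c \<noteq> 0"
proof -
  show "a \<times> b \<noteq> 0" using assms by (auto simp flip: cross_dot_trip)
  show "b \<times> c \<noteq> 0" using assms by (auto simp: trip_def)
  show *: "c \<times> a \<noteq> 0" using assms by (metis cross_dot_trip inner_zero_left trip_rotate')
  then show "a \<times> c \<noteq> 0" by (metis cross_skew neg_equal_0_iff_equal)
qed

text \<open>Cramer's rule: the signed minors are the coefficients of a linear dependence of four
  vectors in space.\<close>

lemma trip_expansion:
  "trip b c d *\<^sub>R a - trip a c d *\<^sub>R b + trip a b d *\<^sub>R c - trip a b c *\<^sub>R d = 0"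
  by (simp add: trip_def vec_eq_iff forall_3 cross3_def inner_vec_def sum_3 vector_def algebra_simps)

lemma area_vector_inner:
  "area_vector a b c \<bullet> a = trip a b c" "area_vector a b c \<bullet> b = trip a b c"
  "area_vector a b c \<bullet> c = trip a b c"
  by (simp_all add: area_vector_def trip_def cross3_simps)

lemma area_vector_rotate: "area_vector b c a = area_vector a b c"
  by (simp add: area_vector_def)

lemma area_vector_inner': "area_vector a b d \<bullet> c = trip a b c + trip b d c + trip d a c"
  by (simp add: area_vector_def inner_add_left cross_dot_trip)

lemma orthogonal_imp_multiple_cross:
  assumes "w \<bullet> a = 0" "w \<bullet> b = 0"
  shows "((a \<times> b) \<bullet> (a \<times> b)) *\<^sub>R w = (w \<bullet> (a \<times> b)) *\<^sub>R (a \<times> b)"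
proof -
  have "w \<times> (a \<times> b) = 0" using assms by (simp add: Lagrange)
  then have "(a \<times> b) \<times> (w \<times> (a \<times> b)) = 0" by simp
  then show ?thesis
    using Lagrange[of "a \<times> b" w "a \<times> b"] by (simp add: inner_commute[of w])
qed

lemma wt_swap: "wt b a c = - wt a b c"
proof -
  have "area_vector b a c = - area_vector a b c"
    using cross_skew[of a b] cross_skew[of b c] cross_skew[of c a] by (simp add: area_vector_def)
  moreover have "b \<times> a = - (a \<times> b)" by (rule cross_skew)
  ultimately show ?thesis by (simp add: wt_def trip_swap[of b a])
qed

text \<open>The normal \<open>area_vector a b c / trip a b c\<close> of the face \<open>abc\<close> has inner product 1 with \<open>a\<close>,
  \<open>b\<close> and \<open>c\<close>; its component along \<open>a \<times> b\<close> is the weight, the rest depends on the edge only.\<close>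
lemma normal_decomposition:
  assumes "trip a b c \<noteq> 0"
  defines "Y \<equiv> (a \<times> b) \<bullet> (a \<times> b)"
  shows "area_vector a b c /\<^sub>R trip a b c =
    wt a b c *\<^sub>R (a \<times> b) + ((b \<bullet> b - a \<bullet> b) / Y) *\<^sub>R a + ((a \<bullet> a - a \<bullet> b) / Y) *\<^sub>R b"
proof -
  have Y: "Y \<noteq> 0" using trip_neq_0_imp_cross_neq_0[OF assms(1)] by (simp add: Y_def)
  have Yeq: "Y = (a \<bullet> a) * (b \<bullet> b) - (a \<bullet> b)^2"
    by (simp add: Y_def dot_cross power2_eq_square inner_commute)
  define w where "w = area_vector a b c /\<^sub>R trip a b c - wt a b c *\<^sub>R (a \<times> b)
     - ((b \<bullet> b - a \<bullet> b) / Y) *\<^sub>R a - ((a \<bullet> a - a \<bullet> b) / Y) *\<^sub>R b"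
  have "w \<bullet> a = 1 - ((b \<bullet> b - a \<bullet> b) * (a \<bullet> a) + (a \<bullet> a - a \<bullet> b) * (a \<bullet> b)) / Y"
    using assms(1) by (simp add: w_def inner_diff_left cross_dot_trip area_vector_inner
      inner_commute[of b a] add_divide_distrib)
  also have "(b \<bullet> b - a \<bullet> b) * (a \<bullet> a) + (a \<bullet> a - a \<bullet> b) * (a \<bullet> b) = Y"
    by (simp add: Yeq algebra_simps power2_eq_square)
  finally have 1: "w \<bullet> a = 0" using Y by simp
  have "w \<bullet> b = 1 - ((b \<bullet> b - a \<bullet> b) * (a \<bullet> b) + (a \<bullet> a - a \<bullet> b) * (b \<bullet> b)) / Y"
    using assms(1) by (simp add: w_def inner_diff_left cross_dot_trip area_vector_inner
      inner_commute[of b a] add_divide_distrib)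
  also have "(b \<bullet> b - a \<bullet> b) * (a \<bullet> b) + (a \<bullet> a - a \<bullet> b) * (b \<bullet> b) = Y"
    by (simp add: Yeq algebra_simps power2_eq_square)
  finally have 2: "w \<bullet> b = 0" using Y by simp
  have 3: "w \<bullet> (a \<times> b) = 0"
    using assms(1) Y
    by (simp add: w_def inner_diff_left dot_cross_self wt_def flip: Y_def)
       (simp add: Y_def inner_commute field_simps)
  have "Y *\<^sub>R w = 0" using orthogonal_imp_multiple_cross[OF 1 2] 3 by (simp add: Y_def)
  then have "w = 0" using Y by simp
  then show ?thesis by (simp add: w_def algebra_simps)
qed

text \<open>By \<open>normal_decomposition\<close> the normals of the two faces at \<open>ab\<close>
  differ only along \<open>a \<times> b\<close>. Pairing their difference with \<open>c\<close>
  evaluates the coefficient.\<close>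

lemma wt_jump:
  assumes "trip a b c \<noteq> 0" "trip a b d \<noteq> 0"
  shows "wt a b c - wt a b d = trip_defect a b c d / (trip a b d * trip a b c)"
proof -
  let ?n = "\<lambda>c. area_vector a b c /\<^sub>R trip a b c"
  have "?n c - ?n d = (wt a b c - wt a b d) *\<^sub>R (a \<times> b)"
    unfolding normal_decomposition[OF assms(1)] normal_decomposition[OF assms(2)]
    by (simp add: algebra_simps)
  then have "(?n c - ?n d) \<bullet> c = (wt a b c - wt a b d) * trip a b c"
    by (simp add: cross_dot_trip)
  then have "1 - (trip a b c + trip b d c + trip d a c) / trip a b d = (wt a b c - wt a b d) * trip a b c"
    using assms by (simp add: inner_diff_left area_vector_inner area_vector_inner' divide_inverse_commute)
  moreover have "trip b d c = - trip b c d" "trip d a c = trip a c d"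
    by (rule trip_swap', rule trip_rotate')
  ultimately have "1 - (trip a b c - trip b c d + trip a c d) / trip a b d = (wt a b c - wt a b d) * trip a b c"
    by simp
  then have "trip a b d - (trip a b c - trip b c d + trip a c d) = (wt a b c - wt a b d) * trip a b c * trip a b d"
    using assms(2) by (simp add: field_simps)
  then have "trip_defect a b c d = (wt a b c - wt a b d) * (trip a b d * trip a b c)"
    by (simp add: trip_defect_def mult_ac)
  then show ?thesis using assms by simp
qed

text \<open>Each term on the right depends on one edge at \<open>a\<close> only, so summation over the triangles around \<open>a\<close>
  telescopes.\<close>
lemma star_identity:
  assumes "trip a b c \<noteq> 0"
  shows "(wt a b c * (a \<bullet> b) + wt c a b * (a \<bullet> c)) *\<^sub>R a - (a \<bullet> a) *\<^sub>R (wt a b c *\<^sub>R b + wt c a b *\<^sub>R c)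
    = ((a \<bullet> a - a \<bullet> c) / ((a \<times> c) \<bullet> (a \<times> c))) *\<^sub>R (a \<times> c)
      - ((a \<bullet> a - a \<bullet> b) / ((a \<times> b) \<bullet> (a \<times> b))) *\<^sub>R (a \<times> b)"
proof -
  have t: "trip c a b \<noteq> 0" using assms by (simp add: trip_rotate')
  \<comment> \<open>The same normal is decomposed along the edge \<open>ab\<close> and along the
    edge \<open>ca\<close>. Crossing with \<open>a\<close> removes the component along
    \<open>a\<close>, and the double cross products expand by Lagrange's identity.\<close>
  define n where "n = area_vector a b c /\<^sub>R trip a b c"
  have n': "n = area_vector c a b /\<^sub>R trip c a b"
    by (simp only: n_def trip_rotate' area_vector_rotate[of a b c])
  have "a \<times> n = wt a b c *\<^sub>R (a \<times> (a \<times> b)) + ((a \<bullet> a - a \<bullet> b) / ((a \<times> b) \<bullet> (a \<times> b))) *\<^sub>R (a \<times> b)"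
    unfolding n_def normal_decomposition[OF assms] by (simp add: cross_add_right cross_mult_right)
  moreover have "a \<times> n = wt c a b *\<^sub>R (a \<times> (c \<times> a)) + ((a \<bullet> a - c \<bullet> a) / ((c \<times> a) \<bullet> (c \<times> a))) *\<^sub>R (a \<times> c)"
    unfolding n' normal_decomposition[OF t] by (simp add: cross_add_right cross_mult_right)
  moreover have "(c \<times> a) \<bullet> (c \<times> a) = (a \<times> c) \<bullet> (a \<times> c)"
    using cross_skew[of c a] by simp
  ultimately show ?thesis by (simp add: Lagrange inner_commute algebra_simps)
qed

section \<open>The quadratic form of an oriented triangle and its change under a flip\<close>

text \<open>In expanded form the mixed term is free of \<open>s\<close>, so a change of
  \<open>s\<close> affects only the diagonal of the quadratic form.\<close>

definition edge_form :: "(real^3 \<Rightarrow> real) \<Rightarrow> (real^3 \<Rightarrow> real) \<Rightarrow> real^3 \<Rightarrow> real^3 \<Rightarrow> real"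
  where "edge_form s y a b = s b / s a * (y a)\<^sup>2 + s a / s b * (y b)\<^sup>2 - 2 * y a * y b"

lemma edge_form_commute: "edge_form s y b a = edge_form s y a b"
  by (simp add: edge_form_def algebra_simps)

lemma edge_form_square:
  assumes "s a \<noteq> 0" "s b \<noteq> 0"
  shows "edge_form s y a b = s a * s b * (y a / s a - y b / s b)\<^sup>2"
  using assms by (simp add: edge_form_def power2_eq_square field_simps)

definition triangle_form :: "(real^3 \<Rightarrow> real) \<Rightarrow> (real^3 \<Rightarrow> real) \<Rightarrow> real^3 \<Rightarrow> real^3 \<Rightarrow> real^3 \<Rightarrow> real"
  where "triangle_form s y a b c =
    wt a b c * edge_form s y a b + wt b c a * edge_form s y b c + wt c a b * edge_form s y c a"

text \<open>The weight of each edge is the product of the coefficients of its ends. By the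
  dependence, the coefficients other than \<open>p\<close> contribute \<open>- p * sa\<close> in
  total, and similarly for the others; the diagonal then completes the mixed terms to a
  square.\<close>

lemma rank_one_stress:
  fixes sa sb sc sd :: real
  assumes s: "sa \<noteq> 0" "sb \<noteq> 0" "sc \<noteq> 0" "sd \<noteq> 0" and dep: "p * sa + q * sb + r * sc + t * sd = 0"
  shows "p * q * (sb/sa * ya\<^sup>2 + sa/sb * yb\<^sup>2 - 2*ya*yb) + p * r * (sc/sa * ya\<^sup>2 + sa/sc * yc\<^sup>2 - 2*ya*yc)
    + p * t * (sd/sa * ya\<^sup>2 + sa/sd * yd\<^sup>2 - 2*ya*yd) + q * r * (sc/sb * yb\<^sup>2 + sb/sc * yc\<^sup>2 - 2*yb*yc)
    + q * t * (sd/sb * yb\<^sup>2 + sb/sd * yd\<^sup>2 - 2*yb*yd) + r * t * (sd/sc * yc\<^sup>2 + sc/sd * yd\<^sup>2 - 2*yc*yd)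
    = - (p * ya + q * yb + r * yc + t * yd)\<^sup>2" (is "?L = _")
proof -
  have e: "q * sb + r * sc + t * sd = - p * sa" "p * sa + r * sc + t * sd = - q * sb"
     "p * sa + q * sb + t * sd = - r * sc" "p * sa + q * sb + r * sc = - t * sd" using dep by auto
  have "?L = p * ya\<^sup>2 * (q * sb + r * sc + t * sd) / sa + q * yb\<^sup>2 * (p * sa + r * sc + t * sd) / sb
     + r * yc\<^sup>2 * (p * sa + q * sb + t * sd) / sc + t * yd\<^sup>2 * (p * sa + q * sb + r * sc) / sd
     - 2 * (p*q*ya*yb + p*r*ya*yc + p*t*ya*yd + q*r*yb*yc + q*t*yb*yd + r*t*yc*yd)"
    by (simp add: algebra_simps add_divide_distrib)
  also have "\<dots> = - (p^2) * ya\<^sup>2 - q^2 * yb\<^sup>2 - r^2 * yc\<^sup>2 - t^2 * yd\<^sup>2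
     - 2 * (p*q*ya*yb + p*r*ya*yc + p*t*ya*yd + q*r*yb*yc + q*t*yb*yd + r*t*yc*yd)"
    unfolding e using s by (simp add: power2_eq_square)
  also have "\<dots> = - (p * ya + q * yb + r * yc + t * yd)\<^sup>2"
    by algebra
  finally show ?thesis .
qed

text \<open>The two old and the two new triangles are the faces of the tetrahedron
  \<open>abcd\<close>. By \<open>wt_jump\<close> the weight of each of its six edges changes by the
  product of the two dependence coefficients at its ends, up to the common factor
  \<open>- \<sigma> / (p * q * r * t)\<close>, so \<open>rank_one_stress\<close> applies.\<close>

lemma flip_identity:
  assumes pos: "trip a b c > 0" "trip b a d > 0" "trip a d c > 0" "trip d b c > 0"
    and s: "s a \<noteq> 0" "s b \<noteq> 0" "s c \<noteq> 0" "s d \<noteq> 0"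
    and lin: "trip b c d * s a - trip a c d * s b + trip a b d * s c - trip a b c * s d = 0"
  shows "triangle_form s y a b c + triangle_form s y b a d
      - triangle_form s y a d c - triangle_form s y d b c
    = trip_defect a b c d / (trip d b c * trip a d c * trip b a d * trip a b c) *
      (trip b c d * y a - trip a c d * y b + trip a b d * y c - trip a b c * y d)\<^sup>2"
proof -
  define p q r t where "p = trip b c d" and "q = - trip a c d" and "r = trip a b d" and "t = - trip a b c"
  define \<sigma> where "\<sigma> = p + q + r + t"
  note tr = p_def q_def r_def t_def
  have perm: "trip d b c = p" "trip a d c = q" "trip b a d = - r"
     "trip b c a = -t" "trip c a b = -t" "trip a c b = t" "trip c a d = q" "trip c d a = -q"
     "trip a d b = -r" "trip d b a = -r" "trip d a b = r" "trip c b d = -p" "trip b d c = -p" "trip d c b = -p"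
     "trip d c a = q" "trip c d b = p" "trip a b c = -t" "trip b d a = r" "trip b c d = p" "trip a b d = r" "trip a c d = -q"
    "trip c b a = t" "trip b a c = t" "trip d a c = -q"
    by (simp_all add: tr trip_def cross3_simps)
  have nz: "p > 0" "q > 0" "r < 0" "t < 0" using pos by (simp_all add: perm)
  have defect: "trip_defect a b c d = \<sigma>" "trip_defect b c a d = \<sigma>" "trip_defect c a b d = \<sigma>"
    "trip_defect a d b c = \<sigma>" "trip_defect d b a c = \<sigma>" "trip_defect d c a b = - \<sigma>"
    by (simp_all add: perm trip_defect_def \<sigma>_def)
  have W: "wt a b c + wt b a d = - \<sigma> / (r * t)" "wt b c a - wt b c d = - \<sigma> / (p * t)"
    "wt c a b - wt c a d = - \<sigma> / (q * t)" "wt a d b - wt a d c = - \<sigma> / (q * r)"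
    "wt d b a - wt d b c = - \<sigma> / (p * r)" "wt d c a + wt c d b = \<sigma> / (p * q)"
  proof -
    have "wt a b c + wt b a d = wt a b c - wt a b d" "wt d c a + wt c d b = wt d c a - wt d c b"
      by (simp_all add: wt_swap[of a b d] wt_swap[of d c b])
    then show "wt a b c + wt b a d = - \<sigma> / (r * t)" "wt d c a + wt c d b = \<sigma> / (p * q)"
      using nz by (simp_all add: wt_jump perm defect)
    show "wt b c a - wt b c d = - \<sigma> / (p * t)" "wt c a b - wt c a d = - \<sigma> / (q * t)"
      "wt a d b - wt a d c = - \<sigma> / (q * r)" "wt d b a - wt d b c = - \<sigma> / (p * r)"
      using nz by (simp_all add: wt_jump perm defect)
  qed
  have "triangle_form s y a b c + triangle_form s y b a d - triangle_form s y a d c - triangle_form s y d b c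
    = (wt a b c + wt b a d) * edge_form s y a b + (wt b c a - wt b c d) * edge_form s y b c
     + (wt c a b - wt c a d) * edge_form s y a c + (wt a d b - wt a d c) * edge_form s y a d
     + (wt d b a - wt d b c) * edge_form s y b d - (wt d c a + wt c d b) * edge_form s y c d"
    by (simp add: triangle_form_def edge_form_commute[of s y b a] edge_form_commute[of s y c a]
        edge_form_commute[of s y d b] edge_form_commute[of s y d c] algebra_simps)
  also have "\<dots> = - \<sigma> / (p * q * r * t) * (p * q * edge_form s y a b + p * r * edge_form s y a c + p * t * edge_form s y a d
     + q * r * edge_form s y b c + q * t * edge_form s y b d + r * t * edge_form s y c d)"
    unfolding W using nz by (simp add: field_simps)
  also have "p * q * edge_form s y a b + p * r * edge_form s y a c + p * t * edge_form s y a d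
     + q * r * edge_form s y b c + q * t * edge_form s y b d + r * t * edge_form s y c d
    = - (p * y a + q * y b + r * y c + t * y d)\<^sup>2"
    unfolding edge_form_def using s lin by (intro rank_one_stress) (simp_all add: perm)
  finally show ?thesis by (simp add: perm defect mult.assoc)
qed

section \<open>Closed fans of triangles\<close>

type_synonym tri = "(real^3) \<times> (real^3) \<times> (real^3)"

text \<open>Storing all three rotations makes every directed edge of the triangle the first two
  entries of exactly one triple.\<close>

definition rotations :: "real^3 \<Rightarrow> real^3 \<Rightarrow> real^3 \<Rightarrow> tri multiset"
  where "rotations a b c = {#(a, b, c), (b, c, a), (c, a, b)#}"

definition edge_mset :: "tri multiset \<Rightarrow> ((real^3) \<times> (real^3)) multiset"
  where "edge_mset M = image_mset (\<lambda>(a, b, c). (a, b)) M"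

text \<open>A multiset permits repeated triangles, so a flip need not check whether the new ones are
  already present. Edge balance says that the triangles close up around a vertex; this is asked only
  at \<open>I\<close>, since at other vertices the fan may have a boundary.\<close>

definition fan :: "(real^3) set \<Rightarrow> (real^3) set \<Rightarrow> tri multiset \<Rightarrow> bool"
  where "fan V I M \<longleftrightarrow>
    (\<forall>a b c. (a, b, c) \<in># M \<longrightarrow> a \<in> V \<and> b \<in> V \<and> c \<in> V \<and> trip a b c > 0) \<and>
    (\<forall>a b c. count M (b, c, a) = count M (a, b, c)) \<and>
    (\<forall>i\<in>I. \<forall>b. count (edge_mset M) (i, b) = count (edge_mset M) (b, i)) \<and>
    (\<forall>i\<in>I. \<exists>b c. (i, b, c) \<in># M)"

definition fan_form :: "(real^3 \<Rightarrow> real) \<Rightarrow> (real^3 \<Rightarrow> real) \<Rightarrow> tri multiset \<Rightarrow> real"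
  where "fan_form s y M = (\<Sum>(a, b, c)\<in>#M. wt a b c * edge_form s y a b)"

text \<open>Up to the factor 18 the volume of the cones over the triangles, with multiplicity:
  \<open>trip\<close> is six times a volume and each triangle occurs in three rotations.\<close>

definition fan_volume :: "tri multiset \<Rightarrow> real"
  where "fan_volume M = (\<Sum>(a, b, c)\<in>#M. trip a b c)"

lemma count_rotations_rotate: "count (rotations a b c) (y, z, x) = count (rotations a b c) (x, y, z)"
proof -
  have e: "(y, z, x) = (a, b, c) \<longleftrightarrow> (x, y, z) = (c, a, b)" "(y, z, x) = (b, c, a) \<longleftrightarrow> (x, y, z) = (a, b, c)"
    "(y, z, x) = (c, a, b) \<longleftrightarrow> (x, y, z) = (b, c, a)"
    by auto
  have "(if P then Suc (if Q then Suc (if R then Suc 0 else 0) else (if R then Suc 0 else 0))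
      else (if Q then Suc (if R then Suc 0 else 0) else (if R then Suc 0 else 0))) =
     of_bool P + of_bool Q + (of_bool R :: nat)" for P Q R by simp
  then have "count (rotations p q r) t = of_bool (t = (p, q, r)) + of_bool (t = (q, r, p)) + of_bool (t = (r, p, q))"
    for p q r t unfolding rotations_def count_add_mset count_empty eq_commute[of _ t] by blast
  then show ?thesis by (simp only: e add_ac)
qed

lemma count_swap_pair: "count {#(a, b), (b, a)#} (x, y) = count {#(a, b), (b, a)#} (y, x)"
proof -
  have e: "(x, y) = (a, b) \<longleftrightarrow> (y, x) = (b, a)" "(x, y) = (b, a) \<longleftrightarrow> (y, x) = (a, b)" by auto
  have "count {#p, q#} t = of_bool (t = p) + of_bool (t = q)" for p q t :: "'a \<times> 'a" by auto
  then show ?thesis by (simp only: e add.commute)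
qed

lemma fan_form_rotations: "fan_form s y (rotations a b c) = triangle_form s y a b c"
  by (simp add: fan_form_def rotations_def triangle_form_def)

lemma fan_form_plus: "fan_form s y (M + N) = fan_form s y M + fan_form s y N"
  by (simp add: fan_form_def)

lemma fan_volume_rotations: "fan_volume (rotations a b c) = 3 * trip a b c"
  by (simp add: fan_volume_def rotations_def trip_rotate trip_rotate')

lemma fan_volume_plus: "fan_volume (M + N) = fan_volume M + fan_volume N"
  by (simp add: fan_volume_def)

lemma edge_mset_plus: "edge_mset (M + N) = edge_mset M + edge_mset N"
  by (simp add: edge_mset_def)

lemma edge_mset_rotations: "edge_mset (rotations a b c) = {#(a, b), (b, c), (c, a)#}"
  by (simp add: edge_mset_def rotations_def)

lemma edge_mset_count: "count (edge_mset M) (a, b) > 0 \<longleftrightarrow> (\<exists>c. (a, b, c) \<in># M)"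
proof -
  have "count (edge_mset M) (a, b) > 0 \<longleftrightarrow> (a, b) \<in># edge_mset M"
    by (meson count_greater_zero_iff)
  then show ?thesis by (force simp: edge_mset_def)
qed

text \<open>The four outer directed edges stay, and the pair \<open>(a, b)\<close>,
  \<open>(b, a)\<close> gives way to \<open>(c, d)\<close>, \<open>(d, c)\<close>. Both pairs are
  symmetric, so the balance is unaffected. All four vertices still occur as first entries.\<close>

lemma fan_flip:
  assumes M: "fan V I (M + rotations a b c + rotations b a d)"
    and pos: "trip a d c > 0" "trip d b c > 0"
  shows "fan V I (M + rotations a d c + rotations d b c)"
proof -
  have inM: "x \<in> V \<and> y \<in> V \<and> z \<in> V \<and> trip x y z > 0" if "(x, y, z) \<in># M + rotations a b c + rotations b a d" for x y z
    using M that unfolding fan_def by blast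
  have V: "a \<in> V" "b \<in> V" "c \<in> V" "d \<in> V"
    using inM[of a b c] inM[of b a d] by (auto simp: rotations_def)
  have E: "edge_mset (M + rotations a b c + rotations b a d) =
     edge_mset M + {#(b, c), (c, a), (a, d), (d, b)#} + {#(a, b), (b, a)#}"
    "edge_mset (M + rotations a d c + rotations d b c) =
     edge_mset M + {#(b, c), (c, a), (a, d), (d, b)#} + {#(c, d), (d, c)#}"
    by (simp_all add: edge_mset_plus edge_mset_rotations add_mset_commute)
  show ?thesis unfolding fan_def
  proof (intro conjI allI ballI impI)
    fix x y z assume "(x, y, z) \<in># M + rotations a d c + rotations d b c"
    then have "x \<in> V \<and> y \<in> V \<and> z \<in> V \<and> trip x y z > 0"
      using inM[of x y z] V pos by (auto simp: rotations_def trip_rotate trip_rotate')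
    then show "x \<in> V" "y \<in> V" "z \<in> V" "trip x y z > 0" by auto
  next
    fix x y z
    have "count (M + rotations a b c + rotations b a d) (y, z, x) =
      count (M + rotations a b c + rotations b a d) (x, y, z)"
      using M unfolding fan_def by blast
    then show "count (M + rotations a d c + rotations d b c) (y, z, x) =
      count (M + rotations a d c + rotations d b c) (x, y, z)"
      by (simp add: count_rotations_rotate)
  next
    fix i x assume "i \<in> I"
    then have "count (edge_mset (M + rotations a b c + rotations b a d)) (i, x) =
      count (edge_mset (M + rotations a b c + rotations b a d)) (x, i)"
      using M unfolding fan_def by blast
    moreover have "count {#(a, b), (b, a)#} (i, x) = count {#(a, b), (b, a)#} (x, i)"
      "count {#(c, d), (d, c)#} (i, x) = count {#(c, d), (d, c)#} (x, i)" by (rule count_swap_pair)+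
    ultimately show "count (edge_mset (M + rotations a d c + rotations d b c)) (i, x) =
      count (edge_mset (M + rotations a d c + rotations d b c)) (x, i)"
      unfolding E count_union by linarith
  next
    fix i assume "i \<in> I"
    then obtain x z where "(i, x, z) \<in># M + rotations a b c + rotations b a d"
      using M unfolding fan_def by blast
    then show "\<exists>x z. (i, x, z) \<in># M + rotations a d c + rotations d b c"
      by (auto simp: rotations_def)
  qed
qed

section \<open>Reflex edges and convex position\<close>

lemma mem_convex_hull_with_0:
  fixes a c d :: "'a::real_vector"
  assumes "a \<in> C" "c \<in> C" "d \<in> C" "0 \<in> C" "p \<ge> 0" "q \<ge> 0" "r \<ge> 0" "p + q + r \<le> 1"
  shows "p *\<^sub>R a + q *\<^sub>R c + r *\<^sub>R d \<in> convex hull C"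
proof -
  let ?u = "\<lambda>i::nat. if i = 0 then p else if i = 1 then q else if i = 2 then r else 1 - (p + q + r)"
  let ?x = "\<lambda>i::nat. if i = 0 then a else if i = 1 then c else if i = 2 then d else 0"
  have "(\<Sum>i\<in>{0,1,2,3}. ?u i *\<^sub>R ?x i) \<in> convex hull C"
    by (rule convex_sum) (use assms in \<open>auto intro: hull_inc\<close>)
  then show ?thesis by (simp add: add.assoc)
qed

text \<open>A reflex edge between \<open>abc\<close> and \<open>bad\<close> can be flipped: otherwise \<open>b\<close> would lie in the
  tetrahedron \<open>0acd\<close>.\<close>
lemma reflex_edge_quadrilateral:
  assumes "trip a b c > 0" "trip b a d > 0" "wt a b c + wt b a d < 0"
    and b: "b \<notin> convex hull {0, a, c, d}"
  shows "trip d b c > 0" "trip_defect a b c d > 0"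
proof -
  have neg: "trip a b d < 0" using assms(2) trip_swap[of a b d] by simp
  have "wt a b c - wt a b d < 0" using assms(3) wt_swap[of a b d] by simp
  then have "trip_defect a b c d / (trip a b d * trip a b c) < 0"
    using wt_jump[of a b c d] assms(1) neg by simp
  moreover have "trip a b d * trip a b c < 0" using assms(1) neg by (simp add: mult_neg_pos)
  ultimately show def: "trip_defect a b c d > 0" by (simp add: divide_less_0_iff)
  show "trip d b c > 0"
  proof (rule ccontr)
    assume "\<not> trip d b c > 0"
    then have n: "trip b c d \<le> 0" using trip_rotate'[of d b c] by simp
    define q where "q = - trip a c d"
    \<comment> \<open>Positivity of the defect is exactly the statement that the coefficients of
      \<open>a\<close>, \<open>c\<close>, \<open>d\<close> below, divided by \<open>q\<close>, add
      up to less than 1.\<close>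
    have q: "q > - trip b c d + - trip a b d + trip a b c" "q > 0"
      using def n neg assms(1) by (auto simp: trip_defect_def q_def)
    have qb: "q *\<^sub>R b = (- trip b c d) *\<^sub>R a + (- trip a b d) *\<^sub>R c + trip a b c *\<^sub>R d"
      using trip_expansion[of b c d a] by (simp add: q_def algebra_simps)
    have "b = (1/q) *\<^sub>R (q *\<^sub>R b)" using q by simp
    also have "\<dots> = (1/q) *\<^sub>R ((- trip b c d) *\<^sub>R a + (- trip a b d) *\<^sub>R c + trip a b c *\<^sub>R d)"
      unfolding qb ..
    also have "\<dots> = (- trip b c d / q) *\<^sub>R a + (- trip a b d / q) *\<^sub>R c + (trip a b c / q) *\<^sub>R d"
      by (simp add: scaleR_add_right scaleR_diff_right divide_inverse mult.commute)
    also have "\<dots> \<in> convex hull {0, a, c, d}"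
      using n neg assms(1) q by (intro mem_convex_hull_with_0) (simp_all add: divide_simps)
    finally show False using b by simp
  qed
qed

lemma sum_mset_eq_sum_count:
  fixes F :: "'a \<Rightarrow> real"
  assumes "finite T" "set_mset M \<subseteq> T"
  shows "(\<Sum>t\<in>#M. F t) = (\<Sum>t\<in>T. real (count M t) * F t)"
  using assms(2)
proof (induction M)
  case (add x M)
  then have x: "x \<in> T" by simp
  have "(\<Sum>t\<in>T. real (count (add_mset x M) t) * F t)
    = (\<Sum>t\<in>T. (if t = x then F t else 0) + real (count M t) * F t)"
    by (rule sum.cong) (auto simp: algebra_simps)
  then show ?case using add x assms(1) by (simp add: sum.distrib sum.delta)
qed simp

lemma double_sum_nonneg_eq_0:
  fixes f :: "'a \<Rightarrow> 'b \<Rightarrow> real"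
  assumes "(\<Sum>a\<in>A. \<Sum>b\<in>B. f a b) = 0" "finite A" "finite B"
    and nn: "\<And>a b. a \<in> A \<Longrightarrow> b \<in> B \<Longrightarrow> f a b \<ge> 0" and "a \<in> A" "b \<in> B"
  shows "f a b = 0"
proof -
  have "(\<Sum>b\<in>B. f x b) \<ge> 0" if "x \<in> A" for x using that by (intro sum_nonneg nn)
  then have "\<forall>x\<in>A. (\<Sum>b\<in>B. f x b) = 0"
    using sum_nonneg_eq_0_iff[of A "\<lambda>a. \<Sum>b\<in>B. f a b"] assms(1,2) by blast
  then have "\<forall>x\<in>B. f a x = 0"
    using sum_nonneg_eq_0_iff[of B "f a"] nn[OF assms(5)] assms(3,5) by blast
  then show ?thesis using assms(6) by blast
qed

lemma count_image_mset_eq_sum_mset: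
  "real (count (image_mset f M) e) = (\<Sum>t\<in>#M. if f t = e then 1 else 0)"
  by (induction M) auto

section \<open>Weights of the edges of a fan\<close>

locale closed_fan =
  fixes V I :: "(real^3) set" and M :: "tri multiset"
  assumes finV: "finite V" and fan: "fan V I M" and IV: "I \<subseteq> V"
begin

lemma mem: "(a, b, c) \<in># M \<Longrightarrow> a \<in> V \<and> b \<in> V \<and> c \<in> V \<and> trip a b c > 0"
  using fan unfolding fan_def by blast

lemma count_rotate: "count M (b, c, a) = count M (a, b, c)"
  using fan unfolding fan_def by blast

lemma mem_rotate: "(b, c, a) \<in># M \<longleftrightarrow> (a, b, c) \<in># M"
  by (simp only: count_greater_zero_iff[symmetric] count_rotate)

lemma balanced: "i \<in> I \<Longrightarrow> count (edge_mset M) (i, b) = count (edge_mset M) (b, i)"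
  using fan unfolding fan_def by blast

lemma mem_opposite:
  assumes "i \<in> I" "(b, i, c) \<in># M"
  obtains d where "(i, b, d) \<in># M"
  using balanced[OF assms(1), of b] assms(2) edge_mset_count[of M] by (metis)

definition N :: "real^3 \<Rightarrow> real^3 \<Rightarrow> real^3 \<Rightarrow> real"
  where "N a b c = real (count M (a, b, c))"

definition W :: "real^3 \<Rightarrow> real^3 \<Rightarrow> real"
  where "W a b = (\<Sum>c\<in>V. N a b c * wt a b c)"

text \<open>By \<open>wt_swap\<close> this is the total jump of the normals across the undirected
  edge, in units of \<open>a \<times> b\<close>, when equally many triangles lie on both
  sides.\<close>

definition U :: "real^3 \<Rightarrow> real^3 \<Rightarrow> real"
  where "U a b = W a b + W b a"

lemma N_nonneg: "N a b c \<ge> 0" by (simp add: N_def)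

lemma N_rotate: "N b c a = N a b c"
  by (simp add: N_def count_rotate)

lemma N_neq_0_iff: "N a b c \<noteq> 0 \<longleftrightarrow> (a, b, c) \<in># M"
  by (simp add: N_def)

lemma U_commute: "U b a = U a b" by (simp add: U_def)

lemma sum_mset_fan:
  fixes F :: "tri \<Rightarrow> real"
  shows "(\<Sum>t\<in>#M. F t) = (\<Sum>a\<in>V. \<Sum>b\<in>V. \<Sum>c\<in>V. N a b c * F (a, b, c))"
proof -
  let ?T = "Sigma V (\<lambda>_. Sigma V (\<lambda>_. V))"
  have "set_mset M \<subseteq> ?T" using mem by auto
  then have "(\<Sum>t\<in>#M. F t) = (\<Sum>t\<in>?T. real (count M t) * F t)"
    using finV by (intro sum_mset_eq_sum_count) auto
  also have "\<dots> = (\<Sum>a\<in>V. \<Sum>b\<in>V. \<Sum>c\<in>V. N a b c * F (a, b, c))"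
    by (simp add: sum.cartesian_product N_def case_prod_unfold)
  finally show ?thesis .
qed

lemma count_edge:
  assumes "a \<in> V" "b \<in> V"
  shows "real (count (edge_mset M) (a, b)) = (\<Sum>c\<in>V. N a b c)"
proof -
  have "real (count (edge_mset M) (a, b)) = (\<Sum>x\<in>V. \<Sum>y\<in>V. \<Sum>z\<in>V. N x y z * (if (x, y) = (a, b) then 1 else 0))"
    unfolding edge_mset_def count_image_mset_eq_sum_mset sum_mset_fan by simp
  also have "\<dots> = (\<Sum>x\<in>V. if x = a then (\<Sum>y\<in>V. if y = b then (\<Sum>z\<in>V. N a b z) else 0) else 0)"
    by (intro sum.cong refl) (auto intro!: sum.cong sum.neutral)
  finally show ?thesis using assms finV by (simp add: sum.delta)
qed

lemma sum_N_balanced: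
  assumes "a \<in> V" "b \<in> V" "a \<in> I \<or> b \<in> I"
  shows "(\<Sum>c\<in>V. N a b c) = (\<Sum>c\<in>V. N b a c)"
  using count_edge[OF assms(1,2)] count_edge[OF assms(2,1)] balanced[of a b] balanced[of b a] assms(3) by metis

text \<open>\<open>star_identity\<close> is summed over the triangles at \<open>j\<close>; each
  neighbour is as often a second as a third entry, so the right-hand sides cancel. The resultant is
  a multiple of \<open>j\<close> rather than zero: this is equilibrium modulo the line through
  \<open>j\<close>.\<close>

lemma star_equilibrium:
  assumes j: "j \<in> I"
  shows "(j \<bullet> j) *\<^sub>R (\<Sum>b\<in>V. U j b *\<^sub>R b) = (\<Sum>b\<in>V. U j b * (j \<bullet> b)) *\<^sub>R j"
proof -
  have jV: "j \<in> V" using j IV by auto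
  define g where "g = (\<lambda>b. ((j \<bullet> j - j \<bullet> b) / ((j \<times> b) \<bullet> (j \<times> b))) *\<^sub>R (j \<times> b))"
  have rot: "N j b c = N c j b" for b c by (rule N_rotate)
  \<comment> \<open>Rotation turns third entries into ends of edges directed towards
    \<open>j\<close>, which joins both directed weights to \<open>U\<close>. The general
    \<open>f\<close> covers the vector-valued and the real-valued sum.\<close>
  have sumU: "(\<Sum>b\<in>V. \<Sum>c\<in>V. (N j b c * wt j b c) *\<^sub>R f b) + (\<Sum>b\<in>V. \<Sum>c\<in>V. (N j b c * wt c j b) *\<^sub>R f c)
     = (\<Sum>b\<in>V. U j b *\<^sub>R f b)" for f :: "real^3 \<Rightarrow> 'v::real_vector"
  proof -
    have "(\<Sum>b\<in>V. \<Sum>c\<in>V. (N j b c * wt c j b) *\<^sub>R f c) = (\<Sum>c\<in>V. W c j *\<^sub>R f c)"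
      by (subst sum.swap) (simp add: W_def scaleR_sum_left rot)
    moreover have "(\<Sum>b\<in>V. \<Sum>c\<in>V. (N j b c * wt j b c) *\<^sub>R f b) = (\<Sum>b\<in>V. W j b *\<^sub>R f b)"
      by (simp add: W_def scaleR_sum_left)
    ultimately show ?thesis by (simp add: U_def scaleR_add_left sum.distrib)
  qed
  have "(\<Sum>b\<in>V. \<Sum>c\<in>V. N j b c *\<^sub>R ((wt j b c * (j \<bullet> b) + wt c j b * (j \<bullet> c)) *\<^sub>R j
       - (j \<bullet> j) *\<^sub>R (wt j b c *\<^sub>R b + wt c j b *\<^sub>R c))) = (\<Sum>b\<in>V. \<Sum>c\<in>V. N j b c *\<^sub>R (g c - g b))"
  proof (intro sum.cong refl)
    fix b c
    show "N j b c *\<^sub>R ((wt j b c * (j \<bullet> b) + wt c j b * (j \<bullet> c)) *\<^sub>R j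
       - (j \<bullet> j) *\<^sub>R (wt j b c *\<^sub>R b + wt c j b *\<^sub>R c)) = N j b c *\<^sub>R (g c - g b)"
    proof (cases "(j, b, c) \<in># M")
      case True
      then have "trip j b c \<noteq> 0" using mem by fastforce
      from star_identity[OF this] show ?thesis by (simp add: g_def)
    qed (metis N_neq_0_iff scale_zero_left)
  qed
  also have "\<dots> = (\<Sum>c\<in>V. (\<Sum>b\<in>V. N c j b) *\<^sub>R g c) - (\<Sum>b\<in>V. (\<Sum>c\<in>V. N j b c) *\<^sub>R g b)"
  proof -
    have "(\<Sum>b\<in>V. \<Sum>c\<in>V. N j b c *\<^sub>R g c) = (\<Sum>c\<in>V. (\<Sum>b\<in>V. N c j b) *\<^sub>R g c)"
      by (subst sum.swap) (simp only: scaleR_sum_left rot)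
    then show ?thesis by (simp add: scaleR_diff_right sum_subtractf scaleR_sum_left)
  qed
  also have "\<dots> = 0"
    using sum_N_balanced[of _ j] j jV by (simp)
  finally have "(\<Sum>b\<in>V. \<Sum>c\<in>V. N j b c *\<^sub>R ((wt j b c * (j \<bullet> b) + wt c j b * (j \<bullet> c)) *\<^sub>R j)) =
     (j \<bullet> j) *\<^sub>R ((\<Sum>b\<in>V. \<Sum>c\<in>V. (N j b c * wt j b c) *\<^sub>R b) + (\<Sum>b\<in>V. \<Sum>c\<in>V. (N j b c * wt c j b) *\<^sub>R c))"
    by (simp add: scaleR_diff_right sum_subtractf scaleR_sum_right scaleR_add_right sum.distrib
        mult.left_commute mult.commute)
  also have "(\<Sum>b\<in>V. \<Sum>c\<in>V. N j b c *\<^sub>R ((wt j b c * (j \<bullet> b) + wt c j b * (j \<bullet> c)) *\<^sub>R j)) =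
     ((\<Sum>b\<in>V. \<Sum>c\<in>V. (N j b c * wt j b c) *\<^sub>R (j \<bullet> b)) + (\<Sum>b\<in>V. \<Sum>c\<in>V. (N j b c * wt c j b) *\<^sub>R (j \<bullet> c))) *\<^sub>R j"
    by (simp add: scaleR_sum_left sum.distrib scaleR_add_left scaleR_add_right distrib_left mult.assoc)
  finally show ?thesis unfolding sumU by simp
qed

lemma sum_form_eq:
  assumes comm: "\<And>a b. E b a = E a b"
  shows "2 * (\<Sum>(a, b, c)\<in>#M. wt a b c * E a b) = (\<Sum>a\<in>V. \<Sum>b\<in>V. U a b * E a b)"
proof -
  have "(\<Sum>(a, b, c)\<in>#M. wt a b c * E a b) = (\<Sum>a\<in>V. \<Sum>b\<in>V. W a b * E a b)"
    unfolding sum_mset_fan by (simp add: W_def sum_distrib_right mult.assoc)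
  moreover have "(\<Sum>a\<in>V. \<Sum>b\<in>V. W a b * E a b) = (\<Sum>a\<in>V. \<Sum>b\<in>V. W b a * E a b)"
    by (subst sum.swap) (simp add: comm)
  ultimately show ?thesis by (simp add: U_def distrib_right sum.distrib)
qed

text \<open>Only the diagonals differ. At \<open>a\<close> in \<open>I\<close> the vector with
  summands \<open>U a b *\<^sub>R b\<close> is parallel to \<open>a\<close>, so applying
  \<open>s\<close> and dividing by \<open>s a\<close> gives the same as pairing with
  \<open>a\<close> and dividing by \<open>a \<bullet> a\<close>. Off \<open>I\<close> the diagonal
  terms vanish with \<open>y\<close>.\<close>

lemma fan_form_eq_metric_form:
  fixes \<alpha> :: "real^3" and y :: "real^3 \<Rightarrow> real"
  defines "s \<equiv> (\<bullet>) \<alpha>"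
  assumes s: "\<And>v. v \<in> V \<Longrightarrow> s v > 0" and y: "\<And>v. v \<notin> I \<Longrightarrow> y v = 0"
  shows "fan_form s y M = (\<Sum>(a, b, c)\<in>#M. wt a b c *
    ((a \<bullet> b) / (a \<bullet> a) * (y a)\<^sup>2 + (a \<bullet> b) / (b \<bullet> b) * (y b)\<^sup>2 - 2 * y a * y b))"
proof -
  define E where "E = (\<lambda>a b. (a \<bullet> b) / (a \<bullet> a) * (y a)\<^sup>2 + (a \<bullet> b) / (b \<bullet> b) * (y b)\<^sup>2 - 2 * y a * y b)"
  define h where "h = (\<lambda>a b. U a b * (s b / s a - (a \<bullet> b) / (a \<bullet> a)) * (y a)\<^sup>2)"
  have h0: "(\<Sum>b\<in>V. h a b) = 0" if a: "a \<in> V" for a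
  proof (cases "a \<in> I")
    case True
    have nz: "s a \<noteq> 0" "a \<bullet> a \<noteq> 0" using s[OF a] by (auto simp: s_def)
    have "(a \<bullet> a) * (\<Sum>b\<in>V. U a b * s b) = (\<Sum>b\<in>V. U a b * (a \<bullet> b)) * s a"
      using arg_cong[OF star_equilibrium[OF True], of s] by (simp add: s_def inner_sum_right)
    then have "(\<Sum>b\<in>V. U a b * s b) / s a = (\<Sum>b\<in>V. U a b * (a \<bullet> b)) / (a \<bullet> a)"
      using nz by (simp add: field_simps)
    then have "(\<Sum>b\<in>V. U a b * (s b / s a - (a \<bullet> b) / (a \<bullet> a))) = 0"
      by (simp add: right_diff_distrib sum_subtractf sum_divide_distrib)
    then show ?thesis by (simp add: h_def flip: sum_distrib_right)
  qed (simp add: h_def y)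
  have "(\<Sum>a\<in>V. \<Sum>b\<in>V. U a b * edge_form s y a b) - (\<Sum>a\<in>V. \<Sum>b\<in>V. U a b * E a b)
    = (\<Sum>a\<in>V. \<Sum>b\<in>V. h a b + h b a)"
    by (simp add: E_def edge_form_def h_def U_commute inner_commute algebra_simps flip: sum_subtractf)
  also have "\<dots> = (\<Sum>a\<in>V. \<Sum>b\<in>V. h a b) + (\<Sum>b\<in>V. \<Sum>a\<in>V. h b a)"
    by (simp add: sum.distrib) (rule sum.swap)
  also have "\<dots> = 0" using h0 by simp
  finally have "2 * (\<Sum>(a, b, c)\<in>#M. wt a b c * edge_form s y a b) = 2 * (\<Sum>(a, b, c)\<in>#M. wt a b c * E a b)"
    by (subst (1 2) sum_form_eq) (simp_all add: edge_form_commute E_def inner_commute algebra_simps)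
  then show ?thesis by (simp add: fan_form_def E_def)
qed

text \<open>With multiplicities there is no canonical matching of the triangles on the two sides of
  an edge, so each one is paired with each one opposite. With \<open>k\<close> triangles per side
  the sum of the pairwise jumps is \<open>k * U a b\<close>; it inherits their sign, and vanishes
  only if they all do.\<close>

lemma U_nonneg:
  assumes ab: "a \<in> V" "b \<in> V" "a \<in> I \<or> b \<in> I"
    and convex: "\<And>c d. (a, b, c) \<in># M \<Longrightarrow> (b, a, d) \<in># M \<Longrightarrow> wt a b c + wt b a d \<ge> 0"
  shows "U a b \<ge> 0"
    and "U a b = 0 \<Longrightarrow> (a, b, c) \<in># M \<Longrightarrow> (b, a, d) \<in># M \<Longrightarrow> wt a b c + wt b a d = 0"
proof -
  define k where "k = (\<Sum>c\<in>V. N a b c)"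
  have k': "k = (\<Sum>c\<in>V. N b a c)" using sum_N_balanced[OF ab] by (simp add: k_def)
  have terms: "N a b c * N b a d * (wt a b c + wt b a d) \<ge> 0" for c d
    using convex[of c d] N_nonneg[of a b c] N_nonneg[of b a d] N_neq_0_iff[of a b c] N_neq_0_iff[of b a d]
    by (metis mult_nonneg_nonneg mult_zero_left mult_zero_right order_refl)
  have "(\<Sum>c\<in>V. \<Sum>d\<in>V. N a b c * N b a d * (wt a b c + wt b a d))
    = (\<Sum>c\<in>V. \<Sum>d\<in>V. (N a b c * wt a b c) * N b a d) + (\<Sum>c\<in>V. \<Sum>d\<in>V. N a b c * (N b a d * wt b a d))"
    by (simp add: algebra_simps flip: sum.distrib)
  also have "\<dots> = k * U a b"
    unfolding sum_product[symmetric] by (simp add: U_def W_def distrib_left k_def[symmetric] k'[symmetric])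
  finally have eq: "k * U a b = (\<Sum>c\<in>V. \<Sum>d\<in>V. N a b c * N b a d * (wt a b c + wt b a d))" by simp
  then have ge: "k * U a b \<ge> 0" using terms by (simp add: sum_nonneg)
  show "U a b \<ge> 0"
  proof (cases "k = 0")
    case True
    then have "(\<Sum>c\<in>V. N a b c) = 0" "(\<Sum>c\<in>V. N b a c) = 0" using k_def k' by auto
    then have "\<forall>c\<in>V. N a b c = 0" "\<forall>c\<in>V. N b a c = 0"
      using sum_nonneg_eq_0_iff[of V "N a b"] sum_nonneg_eq_0_iff[of V "N b a"] finV N_nonneg by simp_all
    then show ?thesis by (simp add: U_def W_def)
  next
    case False
    then have "k > 0" using N_nonneg by (simp add: k_def less_le sum_nonneg)
    then show ?thesis using ge by (simp add: zero_le_mult_iff)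
  qed
  assume "U a b = 0" and in1: "(a, b, c) \<in># M" and in2: "(b, a, d) \<in># M"
  then have "(\<Sum>c\<in>V. \<Sum>d\<in>V. N a b c * N b a d * (wt a b c + wt b a d)) = 0" using eq by simp
  then have "N a b c * N b a d * (wt a b c + wt b a d) = 0"
    by (rule double_sum_nonneg_eq_0) (use mem[OF in1] mem[OF in2] terms finV in auto)
  then show "wt a b c + wt b a d = 0" using in1 in2 N_neq_0_iff[of a b c] N_neq_0_iff[of b a d] by simp
qed

end

section \<open>Locally convex fans\<close>

text \<open>The triangles around \<open>j\<close> turn in one direction, so they cannot all lie on one side of a line
  through \<open>j\<close> in their common plane: the slope along that line would increase forever.\<close>
lemma coplanar_star:
  fixes j n :: "real^3"
  assumes "finite S" "S \<noteq> {}"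
    and step: "\<And>b c. (b, c) \<in> S \<Longrightarrow> \<exists>d. (c, d) \<in> S"
    and turn: "\<And>b c. (b, c) \<in> S \<Longrightarrow> trip j b c > 0"
    and plane: "n \<bullet> j = 1" "\<And>b c. (b, c) \<in> S \<Longrightarrow> n \<bullet> b = 1"
  shows "j \<in> convex hull (fst ` S)"
proof (rule ccontr)
  assume "j \<notin> convex hull (fst ` S)"
  moreover have "closed (convex hull (fst ` S))"
    using assms(1) by (simp add: compact_convex_hull compact_imp_closed finite_imp_compact)
  ultimately obtain \<beta> e where \<beta>: "\<beta> \<bullet> j < e" "\<And>x. x \<in> convex hull (fst ` S) \<Longrightarrow> e < \<beta> \<bullet> x"
    using separating_hyperplane_closed_point[of "convex hull (fst ` S)" j] by auto
  have pos: "\<beta> \<bullet> (b - j) > 0" if "(b, c) \<in> S" for b c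
  proof -
    have "b \<in> convex hull (fst ` S)" using that by (force intro: hull_inc)
    then show ?thesis using \<beta> by (fastforce simp: inner_diff_right)
  qed
  \<comment> \<open>In the plane orthogonal to \<open>n\<close>, \<gamma> is the direction along
    which \<beta> is constant; \<tau> is the slope of \<open>b - j\<close> with respect to these two
    coordinates.\<close>
  define \<gamma> where "\<gamma> = n \<times> \<beta>"
  define \<tau> where "\<tau> = (\<lambda>b. \<gamma> \<bullet> (b - j) / (\<beta> \<bullet> (b - j)))"
  have less: "\<tau> b < \<tau> c" if bc: "(b, c) \<in> S" for b c
  proof -
    define u w where "u = b - j" and "w = c - j"
    obtain d where cd: "(c, d) \<in> S" using step[OF bc] by blast
    have nu: "n \<bullet> u = 0" and nw: "n \<bullet> w = 0"
      using plane bc cd by (simp_all add: u_def w_def inner_diff_right)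
    have uw: "\<beta> \<bullet> u > 0" "\<beta> \<bullet> w > 0" using pos bc cd by (auto simp: u_def w_def)
    have trip: "trip j u w = trip j b c" by (simp add: u_def w_def trip_def cross3_simps)
    have "n \<times> (u \<times> w) = 0" using nu nw by (simp add: Lagrange)
    then have "n \<times> (n \<times> (u \<times> w)) = 0" by simp
    then have par: "(n \<bullet> n) *\<^sub>R (u \<times> w) = (n \<bullet> (u \<times> w)) *\<^sub>R n"
      unfolding Lagrange[of n n "u \<times> w"] by simp
    have "j \<bullet> ((n \<bullet> n) *\<^sub>R (u \<times> w)) = j \<bullet> ((n \<bullet> (u \<times> w)) *\<^sub>R n)" by (simp only: par)
    then have "(n \<bullet> n) * trip j u w = n \<bullet> (u \<times> w)"
      by (simp only: inner_scaleR_right trip_def inner_commute[of j n] plane(1) mult_1_right)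
    then have "(n \<bullet> n) *\<^sub>R (u \<times> w) = (n \<bullet> n) *\<^sub>R (trip j u w *\<^sub>R n)" using par by simp
    moreover have n0: "n \<bullet> n \<noteq> 0" using plane(1) by auto
    ultimately have cr: "u \<times> w = trip j u w *\<^sub>R n" using scaleR_left_imp_eq by blast
    have "(\<gamma> \<bullet> u) * (\<beta> \<bullet> w) - (\<gamma> \<bullet> w) * (\<beta> \<bullet> u) = (\<gamma> \<times> \<beta>) \<bullet> (u \<times> w)"
      by (simp add: dot_cross)
    also have "\<dots> = trip j u w * ((\<gamma> \<times> \<beta>) \<bullet> n)" by (simp add: cr)
    also have "(\<gamma> \<times> \<beta>) \<bullet> n = - (\<gamma> \<bullet> \<gamma>)"
      by (simp add: \<gamma>_def cross3_simps)
    finally have id: "(\<gamma> \<bullet> u) * (\<beta> \<bullet> w) - (\<gamma> \<bullet> w) * (\<beta> \<bullet> u) = - trip j u w * (\<gamma> \<bullet> \<gamma>)" by simp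
    \<comment> \<open>Otherwise \<beta> would be parallel to \<open>n\<close> and could not be
      positive on \<open>u\<close>, which is orthogonal to \<open>n\<close>.\<close>
    have "\<gamma> \<noteq> 0"
    proof
      assume "\<gamma> = 0"
      then have "n \<times> (n \<times> \<beta>) = 0" by (simp add: \<gamma>_def)
      then have "(n \<bullet> n) *\<^sub>R \<beta> = (n \<bullet> \<beta>) *\<^sub>R n" by (simp add: Lagrange)
      from arg_cong[OF this, of "\<lambda>x. x \<bullet> u"] have "(n \<bullet> n) * (\<beta> \<bullet> u) = 0" by (simp add: nu)
      then show False using n0 uw by simp
    qed
    then have "(\<gamma> \<bullet> u) * (\<beta> \<bullet> w) < (\<gamma> \<bullet> w) * (\<beta> \<bullet> u)"
      using id turn[OF bc] trip by (smt (verit) inner_gt_zero_iff mult_minus_left mult_pos_pos)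
    then show ?thesis using uw by (simp add: \<tau>_def divide_simps mult.commute flip: u_def w_def)
  qed
  have fin: "finite (\<tau> ` fst ` S)" "\<tau> ` fst ` S \<noteq> {}" using assms(1,2) by auto
  then obtain b c where bc: "(b, c) \<in> S" "\<tau> b = Max (\<tau> ` fst ` S)"
    using Max_in[OF fin] by force
  obtain d where "(c, d) \<in> S" using step[OF bc(1)] by blast
  then have "\<tau> c \<le> Max (\<tau> ` fst ` S)" using fin by (force intro: Max_ge)
  then show False using less[OF bc(1)] bc(2) by simp
qed

context closed_fan
begin

text \<open>Without jumps, passing to the next triangle around \<open>j\<close> does not change the
  normal. The triangles reached this way lie in one plane, and \<open>coplanar_star\<close> puts
  \<open>j\<close> into the hull of its neighbours.\<close>

lemma convex_star_not_flat:
  assumes j: "j \<in> I" and hull: "j \<notin> convex hull (V - {j})"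
    and flat: "\<And>b c d. (j, b, c) \<in># M \<Longrightarrow> (b, j, d) \<in># M \<Longrightarrow> wt j b c + wt b j d = 0"
  shows False
proof -
  let ?n = "\<lambda>a b c. area_vector a b c /\<^sub>R trip a b c"
  obtain b0 c0 where start: "(j, b0, c0) \<in># M" using j fan unfolding fan_def by blast
  define n where "n = ?n j b0 c0"
  \<comment> \<open>The triangles at \<open>j\<close> might form several cycles with different
    normals; those sharing the normal of the first triangle are closed under taking
    successors.\<close>
  define S where "S = {(b, c). (j, b, c) \<in># M \<and> ?n j b c = n}"
  have inner: "n \<bullet> j = 1 \<and> n \<bullet> b = 1" if "(b, c) \<in> S" for b c
  proof -
    have "trip j b c \<noteq> 0" "n = ?n j b c" using that mem unfolding S_def by fastforce+
    then show ?thesis by (simp add: area_vector_inner)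
  qed
  have "S \<subseteq> Sigma V (\<lambda>_. V)" using mem by (auto simp: S_def)
  then have "finite S" using finV by (auto intro: finite_subset)
  moreover have s0: "(b0, c0) \<in> S" using start by (simp add: S_def n_def)
  moreover have "\<exists>d. (c, d) \<in> S" if bc: "(b, c) \<in> S" for b c
  proof -
    have jbc: "(j, b, c) \<in># M" and nbc: "?n j b c = n" using bc by (auto simp: S_def)
    then have cjb: "(c, j, b) \<in># M" using mem_rotate by blast
    then obtain d where jcd: "(j, c, d) \<in># M" using mem_opposite[OF j] by blast
    have t: "trip j c d \<noteq> 0" "trip c j b \<noteq> 0" using mem jcd cjb by fastforce+
    have "?n j c d = wt j c d *\<^sub>R (j \<times> c) + ((c \<bullet> c - j \<bullet> c) / ((j \<times> c) \<bullet> (j \<times> c))) *\<^sub>R j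
         + ((j \<bullet> j - j \<bullet> c) / ((j \<times> c) \<bullet> (j \<times> c))) *\<^sub>R c"
      using normal_decomposition[OF t(1)] .
    moreover have "?n c j b = wt c j b *\<^sub>R (c \<times> j) + ((j \<bullet> j - c \<bullet> j) / ((c \<times> j) \<bullet> (c \<times> j))) *\<^sub>R c
         + ((c \<bullet> c - c \<bullet> j) / ((c \<times> j) \<bullet> (c \<times> j))) *\<^sub>R j"
      using normal_decomposition[OF t(2)] .
    moreover have "wt c j b = - wt j c d" using flat[OF jcd cjb] by simp
    moreover have "c \<times> j = - (j \<times> c)" by (rule cross_skew)
    ultimately have "?n j c d = ?n c j b" by (simp add: inner_commute algebra_simps)
    also have "\<dots> = ?n j b c" by (simp only: area_vector_rotate[of j b c, symmetric] trip_rotate[of j b c, symmetric])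
    finally show ?thesis using jcd nbc by (auto simp: S_def)
  qed
  moreover have "trip j b c > 0" if "(b, c) \<in> S" for b c using that mem by (auto simp: S_def)
  ultimately have "j \<in> convex hull (fst ` S)"
    using inner by (intro coplanar_star[of S j n]) auto
  moreover have "fst ` S \<subseteq> V - {j}"
    using mem by (fastforce simp: S_def)
  ultimately show False using hull by (meson hull_mono subsetD)
qed

lemma convex_fan_form_pos:
  fixes \<alpha> :: "real^3" and y :: "real^3 \<Rightarrow> real"
  defines "s \<equiv> (\<bullet>) \<alpha>"
  assumes s: "\<And>v. v \<in> V \<Longrightarrow> s v > 0" and y: "\<And>v. v \<notin> I \<Longrightarrow> y v = 0" and i: "y i \<noteq> 0"
    and hull: "\<And>j. j \<in> I \<Longrightarrow> j \<notin> convex hull (V - {j})"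
    and convex: "\<And>a b c d. a \<in> I \<or> b \<in> I \<Longrightarrow> (a, b, c) \<in># M \<Longrightarrow> (b, a, d) \<in># M \<Longrightarrow> wt a b c + wt b a d \<ge> 0"
  shows "fan_form s y M > 0"
proof (rule ccontr)
  assume neg: "\<not> fan_form s y M > 0"
  have terms: "U a b * edge_form s y a b \<ge> 0" if "a \<in> V" "b \<in> V" for a b
  proof (cases "a \<in> I \<or> b \<in> I")
    case True
    have "edge_form s y a b \<ge> 0"
      using s[OF that(1)] s[OF that(2)] by (subst edge_form_square) auto
    moreover have "U a b \<ge> 0" using U_nonneg(1)[OF that True convex[OF True]] .
    ultimately show ?thesis by simp
  qed (simp add: y edge_form_def)
  have eq: "2 * fan_form s y M = (\<Sum>a\<in>V. \<Sum>b\<in>V. U a b * edge_form s y a b)"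
    unfolding fan_form_def by (rule sum_form_eq) (rule edge_form_commute)
  then have "(\<Sum>a\<in>V. \<Sum>b\<in>V. U a b * edge_form s y a b) = 0"
    using neg terms by (smt (verit) sum_nonneg)
  then have zero: "U a b * edge_form s y a b = 0" if "a \<in> V" "b \<in> V" for a b
    by (rule double_sum_nonneg_eq_0) (use that terms finV in auto)
  have iI: "i \<in> I" using i y by blast
  define p where "p = (\<lambda>v. v /\<^sub>R s v)"
  define Z where "Z = {v \<in> I. y v / s v = y i / s i}"
  have ZV: "Z \<subseteq> V" using IV by (auto simp: Z_def)
  have "finite Z" "i \<in> Z" using iI IV finV by (auto simp: Z_def intro: finite_subset)
  then have "finite (norm ` p ` Z)" "norm ` p ` Z \<noteq> {}" by auto
  then have "Max (norm ` p ` Z) \<in> norm ` p ` Z" by (rule Max_in)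
  then obtain j where j: "j \<in> Z" and "Max (norm ` p ` Z) = norm (p j)" by blast
  then have jmax: "norm (p k) \<le> norm (p j)" if "k \<in> Z" for k
    using Max_ge[OF \<open>finite (norm ` p ` Z)\<close>, of "norm (p k)"] that by simp
  have jI: "j \<in> I" "j \<in> V" using j ZV by (auto simp: Z_def)
  have sj: "s j > 0" using s jI by blast
  have Unn: "U j k \<ge> 0" if "k \<in> V" for k using U_nonneg(1)[of j k] that jI convex by blast
  \<comment> \<open>The common value of \<open>y / s\<close> is nonzero, so a neighbour across
    nonzero weight cannot lie outside \<open>I\<close>, where \<open>y\<close> vanishes; it
    therefore stays in \<open>Z\<close>.\<close>
  have Zk: "k \<in> Z" if k: "k \<in> V" "U j k \<noteq> 0" for k
  proof -
    have sk: "s k > 0" using s k by blast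
    have "edge_form s y j k = 0" using zero[OF jI(2) k(1)] k(2) by simp
    then have "y k / s k = y j / s j" using sj sk by (simp add: edge_form_square)
    then have e: "y k / s k = y i / s i" using j by (simp add: Z_def)
    moreover have "y i / s i \<noteq> 0" using i s iI IV by (metis divide_eq_0_iff less_irrefl subsetD)
    ultimately have "k \<in> I" using y by force
    then show ?thesis using e by (simp add: Z_def)
  qed
  have pk: "k = s k *\<^sub>R p k" if "k \<in> V" for k using s[OF that] by (simp add: p_def)
  have eqj: "(j \<bullet> j) *\<^sub>R (\<Sum>b\<in>V. U j b *\<^sub>R b) = (\<Sum>b\<in>V. U j b * (j \<bullet> b)) *\<^sub>R j"
    by (rule star_equilibrium) (rule jI)
  define \<kappa> where "\<kappa> = (\<Sum>b\<in>V. U j b * (j \<bullet> b)) / (j \<bullet> j)"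
  have j0: "j \<bullet> j \<noteq> 0" using sj by (auto simp: s_def)
  have "(j \<bullet> j) *\<^sub>R (\<Sum>b\<in>V. U j b *\<^sub>R b) = (j \<bullet> j) *\<^sub>R (\<kappa> *\<^sub>R j)" using eqj j0 by (simp add: \<kappa>_def)
  then have eqk: "(\<Sum>b\<in>V. U j b *\<^sub>R b) = \<kappa> *\<^sub>R j" using j0 scaleR_left_imp_eq by blast
  have "(\<Sum>b\<in>V. U j b * s b) = \<kappa> * s j"
    using arg_cong[OF eqk, of s] by (simp add: s_def inner_sum_right)
  moreover have "(\<Sum>b\<in>V. U j b * s b * (p b \<bullet> p j)) = \<kappa> * s j * (p j \<bullet> p j)"
  proof -
    have "(\<Sum>b\<in>V. U j b * s b * (p b \<bullet> p j)) = (\<Sum>b\<in>V. U j b *\<^sub>R b) \<bullet> p j"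
      unfolding inner_sum_left by (intro sum.cong refl) (metis inner_scaleR_left mult.assoc pk)
    also have "\<dots> = \<kappa> * (j \<bullet> p j)" by (simp add: eqk)
    also have "j \<bullet> p j = s j * (p j \<bullet> p j)" using pk[OF jI(2)] by (metis inner_scaleR_left)
    finally show ?thesis by simp
  qed
  \<comment> \<open>Equilibrium is evaluated once with \<open>s\<close> and once by pairing with
    \<open>p j\<close>. By Cauchy-Schwarz and the maximality of \<open>norm (p j)\<close> no summand
    is negative, so each one vanishes.\<close>
  ultimately have "(\<Sum>b\<in>V. U j b * s b * (p j \<bullet> p j - p b \<bullet> p j)) = 0"
    by (simp add: right_diff_distrib sum_subtractf flip: sum_distrib_right)
  moreover have tn: "U j b * s b * (p j \<bullet> p j - p b \<bullet> p j) \<ge> 0" if "b \<in> V" for b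
  proof (cases "U j b = 0")
    case False
    have "p b \<bullet> p j \<le> norm (p b) * norm (p j)" by (rule norm_cauchy_schwarz)
    also have "\<dots> \<le> norm (p j) * norm (p j)" using jmax[OF Zk[OF that False]] by (simp add: mult_right_mono)
    finally have "p b \<bullet> p j \<le> p j \<bullet> p j" by (simp add: dot_square_norm power2_eq_square)
    then show ?thesis using Unn[OF that] s[OF that] by simp
  qed simp
  ultimately have tz: "U j b * s b * (p j \<bullet> p j - p b \<bullet> p j) = 0" if "b \<in> V" for b
    using that finV by (simp add: sum_nonneg_eq_0_iff)
  \<comment> \<open>Equality forces \<open>p b = p j\<close>, hence \<open>b\<close> parallel to
    \<open>j\<close>, which is impossible for two vertices of a nondegenerate triangle.\<close>
  have U0: "U j b = 0" if b: "b \<in> V" and jb: "j \<times> b \<noteq> 0" for b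
  proof (rule ccontr)
    assume ne: "U j b \<noteq> 0"
    then have e: "p b \<bullet> p j = p j \<bullet> p j" using tz[OF b] s[OF b] by simp
    have "(norm (p j - p b))\<^sup>2 = (norm (p b))\<^sup>2 - (norm (p j))\<^sup>2"
      using e by (simp add: power2_norm_eq_inner inner_diff_left inner_diff_right inner_commute)
    also have "\<dots> \<le> 0" using jmax[OF Zk[OF b ne]] by (simp add: power_mono)
    finally have "p j = p b" by simp
    then have "j \<times> b = 0" using pk[OF b] pk[OF jI(2)]
      by (metis cross_mult_left cross_mult_right cross_refl scaleR_zero_right)
    then show False using jb by simp
  qed
  show False
  proof (rule convex_star_not_flat[OF jI(1) hull[OF jI(1)]])
    fix b c d assume in1: "(j, b, c) \<in># M" and in2: "(b, j, d) \<in># M"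
    have "trip j b c \<noteq> 0" "b \<in> V" using mem[OF in1] by auto
    then have "U j b = 0" using U0 trip_neq_0_imp_cross_neq_0(1) by blast
    then show "wt j b c + wt b j d = 0"
      using U_nonneg(2)[of j b c d] convex jI \<open>b \<in> V\<close> in1 in2 by blast
  qed
qed

end

section \<open>Positivity of the form of a fan with vertices in convex position\<close>

text \<open>Positive orientation makes the six rotations pairwise distinct; in particular
  \<open>c\<close> and \<open>d\<close> differ, since exchanging \<open>a\<close> and
  \<open>b\<close> reverses the sign. Hence they can be split off together even if each has
  multiplicity 1.\<close>

lemma fan_decompose:
  assumes fan: "fan V I M" and in1: "(a, b, c) \<in># M" and in2: "(b, a, d) \<in># M"
  obtains M0 where "M = M0 + rotations a b c + rotations b a d"
proof -
  have rot: "count M (y, z, x) = count M (x, y, z)" for x y z using fan unfolding fan_def by blast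
  then have c: "count M (a, b, c) > 0" "count M (b, c, a) > 0" "count M (c, a, b) > 0"
    "count M (b, a, d) > 0" "count M (a, d, b) > 0" "count M (d, b, a) > 0"
    using in1 in2 by (metis count_greater_zero_iff)+
  have "trip a b c > 0" "trip b a d > 0" using in1 in2 fan unfolding fan_def by blast+
  then have ne: "a \<noteq> b" "b \<noteq> c" "a \<noteq> c" "b \<noteq> d" "a \<noteq> d" by auto
  then have "c \<noteq> d" using \<open>trip a b c > 0\<close> \<open>trip b a d > 0\<close> trip_swap[of b a c] by auto
  have "mset_set {(a, b, c), (b, c, a), (c, a, b), (b, a, d), (a, d, b), (d, b, a)} \<subseteq># M"
    using c by (auto simp: subseteq_mset_def count_mset_set' Suc_le_eq)
  moreover have "mset_set {(a, b, c), (b, c, a), (c, a, b), (b, a, d), (a, d, b), (d, b, a)}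
    = rotations a b c + rotations b a d"
    using ne \<open>c \<noteq> d\<close> by (simp add: rotations_def)
  ultimately show ?thesis
    using that by (metis add.commute add.assoc subset_mset.add_diff_inverse)
qed

lemma finite_multisets_bounded: "finite A \<Longrightarrow> finite {M. set_mset M \<subseteq> A \<and> size M = n}"
  using finite_multisets_of_size[of A n] by (simp add: multisets_of_size_def)

text \<open>Induction over the finitely many fans of the same size: flipping a reflex edge
  increases the volume and decreases the form.\<close>
lemma fan_form_pos:
  fixes \<alpha> :: "real^3" and y :: "real^3 \<Rightarrow> real"
  defines "s \<equiv> (\<bullet>) \<alpha>"
  assumes finV: "finite V" and IV: "I \<subseteq> V" and "fan V I M"
    and s: "\<And>v. v \<in> V \<Longrightarrow> s v > 0" and y: "\<And>v. v \<notin> I \<Longrightarrow> y v = 0" and i: "y i \<noteq> 0"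
    and hull: "\<And>v. v \<in> V \<Longrightarrow> v \<notin> convex hull (insert 0 (V - {v}))"
  shows "fan_form s y M > 0"
proof -
  define T where "T = Sigma V (\<lambda>_. Sigma V (\<lambda>_. V))"
  \<comment> \<open>The measure counts all multisets of triples of the given size and larger volume,
    whether fans or not; this set is finite and shrinks strictly with each flip.\<close>
  define larger where "larger = (\<lambda>M. {M'. set_mset M' \<subseteq> T \<and> size M' = size M \<and> fan_volume M' > fan_volume M})"
  have fin: "finite (larger M)" for M
  proof -
    have "finite T" using finV by (auto simp: T_def)
    then show ?thesis
      unfolding larger_def by (rule finite_subset[OF _ finite_multisets_bounded[of T "size M"], rotated]) auto
  qed
  show ?thesis using \<open>fan V I M\<close>
  proof (induction "card (larger M)" arbitrary: M rule: less_induct)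
    case less
    interpret closed_fan V I M using finV IV less.prems by unfold_locales
    show ?case
    proof (cases "\<exists>a b c d. (a, b, c) \<in># M \<and> (b, a, d) \<in># M \<and> wt a b c + wt b a d < 0")
      case False
      have "j \<notin> convex hull (V - {j})" if "j \<in> I" for j
        using hull[of j] that IV hull_mono[of "V - {j}" "insert 0 (V - {j})"] by auto
      then show ?thesis unfolding s_def
        using s y i False by (intro convex_fan_form_pos) (auto simp: s_def not_less)
    next
      case True
      then obtain a b c d where in1: "(a, b, c) \<in># M" and in2: "(b, a, d) \<in># M"
        and w: "wt a b c + wt b a d < 0" by blast
      have t: "trip a b c > 0" "trip b a d > 0" and V: "a \<in> V" "b \<in> V" "c \<in> V" "d \<in> V"
        using mem in1 in2 by blast+
      have ne: "a \<noteq> b" "b \<noteq> c" "a \<noteq> c" "b \<noteq> d" "a \<noteq> d" using t by auto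
      have "{0, a, c, d} \<subseteq> insert 0 (V - {b})" "{0, b, d, c} \<subseteq> insert 0 (V - {a})"
        using V ne by auto
      from this[THEN hull_mono[of _ _ convex]] have "b \<notin> convex hull {0, a, c, d}" "a \<notin> convex hull {0, b, d, c}"
        using hull[OF V(1)] hull[OF V(2)] by auto
      \<comment> \<open>The reflex criterion is used for both directions of the edge, once for each
        new triangle.\<close>
      then have t': "trip d b c > 0" "trip c a d > 0" and def: "trip_defect a b c d > 0"
        using reflex_edge_quadrilateral[OF t w]
          reflex_edge_quadrilateral[OF t(2,1) w[unfolded add.commute[of "wt a b c"]]] by blast+
      have t'': "trip a d c > 0" using t'(2) trip_rotate'[of c a d] by simp
      obtain M0 where M0: "M = M0 + rotations a b c + rotations b a d"
        using fan_decompose[OF less.prems in1 in2] .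
      define M' where "M' = M0 + rotations a d c + rotations d b c"
      have fan': "fan V I M'" unfolding M'_def by (rule fan_flip) (use less.prems M0 t' t'' in auto)
      \<comment> \<open>The factor 3 counts the rotations; the defect is the signed volume between
        the old and the new triangles.\<close>
      have vol: "fan_volume M' = fan_volume M + 3 * trip_defect a b c d"
        using trip_swap[of b a d] trip_rotate'[of d b c] trip_swap'[of a d c]
        by (simp add: M'_def M0 fan_volume_plus fan_volume_rotations trip_defect_def)
      have size: "size M' = size M" by (simp add: M'_def M0 rotations_def)
      have sub: "set_mset M' \<subseteq> T"
        using fan' unfolding fan_def T_def by (auto)
      have "larger M' \<subseteq> larger M" "M' \<in> larger M" "M' \<notin> larger M'"
        using vol def size sub by (auto simp: larger_def)
      then have "larger M' \<subset> larger M" by blast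
      then have "card (larger M') < card (larger M)" using fin by (simp add: psubset_card_mono)
      then have pos: "fan_form s y M' > 0" using less.hyps fan' by blast
      have "fan_form s y M - fan_form s y M' = triangle_form s y a b c + triangle_form s y b a d
         - triangle_form s y a d c - triangle_form s y d b c"
        by (simp add: M0 M'_def fan_form_plus fan_form_rotations)
      also have "\<dots> = trip_defect a b c d / (trip d b c * trip a d c * trip b a d * trip a b c) *
         (trip b c d * y a - trip a c d * y b + trip a b d * y c - trip a b c * y d)\<^sup>2"
      proof (rule flip_identity)
        show "trip b c d * s a - trip a c d * s b + trip a b d * s c - trip a b c * s d = 0"
          using arg_cong[OF trip_expansion[of b c d a], of s] by (simp add: s_def inner_diff_right inner_add_right)
        show "s a \<noteq> 0" "s b \<noteq> 0" "s c \<noteq> 0" "s d \<noteq> 0" using s V by fastforce+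
      qed (use t t' t'' in auto)
      also have "\<dots> \<ge> 0" using t t' t'' def by simp
      finally show ?thesis using pos by simp
    qed
  qed
qed

section \<open>The fan of a star triangulation\<close>

lemma independent_imp_trip_neq_0:
  assumes ind: "independent {a, b, c :: real^3}" and d: "distinct [a, b, c]"
  shows "trip a b c \<noteq> 0"
proof
  assume t: "trip a b c = 0"
  have a: "a \<notin> span {b, c}" and b: "b \<notin> span {c}" and c: "c \<noteq> 0"
    using ind d by (auto simp: independent_insert)
  show False
  proof (cases "b \<times> c = 0")
    case True
    then have "c \<times> (b \<times> c) = 0" by simp
    then have "(c \<bullet> c) *\<^sub>R b = (c \<bullet> b) *\<^sub>R c" unfolding Lagrange[of c b c] by simp
    moreover have "b = (1 / (c \<bullet> c)) *\<^sub>R ((c \<bullet> c) *\<^sub>R b)" using c by simp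
    ultimately have "b = (1 / (c \<bullet> c)) *\<^sub>R ((c \<bullet> b) *\<^sub>R c)" by simp
    also have "\<dots> \<in> span {c}" by (intro span_scale span_base) simp
    finally show False using b by blast
  next
    case False
    let ?d = "b \<times> c"
    have n: "trip b c ?d \<noteq> 0" using False by (simp add: cross_dot_trip[symmetric])
    have "trip b c ?d *\<^sub>R a = trip a c ?d *\<^sub>R b - trip a b ?d *\<^sub>R c"
      using trip_expansion[of b c ?d a] t by (simp add: algebra_simps)
    moreover have "a = (1 / trip b c ?d) *\<^sub>R (trip b c ?d *\<^sub>R a)" using n by simp
    ultimately have "a = (1 / trip b c ?d) *\<^sub>R (trip a c ?d *\<^sub>R b - trip a b ?d *\<^sub>R c)" by simp
    also have "\<dots> \<in> span {b, c}" by (intro span_scale span_diff span_base) simp_all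
    finally show False using a by blast
  qed
qed

text \<open>Edge vectors from the apex replace vertices, so the apex becomes the origin of the fan.
  The sign condition determines the triple up to rotation.\<close>

definition tetra :: "real^3 \<Rightarrow> (real^3) set \<Rightarrow> real^3 \<Rightarrow> real^3 \<Rightarrow> real^3 \<Rightarrow> bool"
  where "tetra p S a b c \<longleftrightarrow> trip a b c > 0 \<and> \<not> affine_dependent {p, p + a, p + b, p + c} \<and>
    S = convex hull {p, p + a, p + b, p + c}"

lemma tetra_rotate: "tetra p S a b c \<Longrightarrow> tetra p S b c a"
  unfolding tetra_def using trip_rotate[of b c a] by (simp add: insert_commute)

lemma tetra_extreme_points:
  "tetra p S a b c \<Longrightarrow> {x. x extreme_point_of S} = {p, p + a, p + b, p + c}"
  unfolding tetra_def using extreme_point_of_convex_hull_affine_independent by blast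

lemma tetra_trip_neq_0: "tetra p S a b c \<Longrightarrow> trip a b c \<noteq> 0"
  by (simp add: tetra_def)

lemma tetra_distinct: "tetra p S a b c \<Longrightarrow> distinct [0, a, b, c]"
  using tetra_trip_neq_0[of p S a b c] by auto

lemma simplex_tetra:
  assumes S: "3 simplex S" and p: "p extreme_point_of S"
    and sub: "distinct [p, p + a, p + b, p + c]" "p + a extreme_point_of S" "p + b extreme_point_of S" "p + c extreme_point_of S"
  shows "tetra p S a b c \<or> tetra p S b a c"
proof -
  obtain C where C: "\<not> affine_dependent C" "int (card C) = 4" "S = convex hull C"
    using S unfolding simplex_def by auto
  have "{p, p + a, p + b, p + c} \<subseteq> C"
    using p sub C extreme_point_of_convex_hull_affine_independent by blast
  moreover have "card {p, p + a, p + b, p + c} = 4" using sub(1) by simp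
  moreover have "finite C" "card C = 4" using C(2) card_ge_0_finite[of C] by auto
  ultimately have Ceq: "C = {p, p + a, p + b, p + c}" by (metis card_subset_eq)
  have "p \<notin> {p + a, p + b, p + c}" using sub(1) by auto
  then have "independent ((\<lambda>x. - p + x) ` {p + a, p + b, p + c})"
    using C(1) affine_dependent_iff_dependent[of p "{p + a, p + b, p + c}"] unfolding Ceq by simp
  then have "independent {a, b, c}" by simp
  then have "trip a b c \<noteq> 0" using sub(1) by (intro independent_imp_trip_neq_0) auto
  then show ?thesis
    using C trip_swap[of b a c] unfolding tetra_def Ceq
    by (cases "trip a b c > 0") (auto simp: insert_commute)
qed

lemma simplex_obtain_tetra:
  assumes S: "3 simplex S" and p: "p extreme_point_of S"
  obtains a b c where "tetra p S a b c"
proof -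
  obtain C where C: "\<not> affine_dependent C" "int (card C) = 4" "S = convex hull C"
    using S unfolding simplex_def by auto
  have ext: "x extreme_point_of S \<longleftrightarrow> x \<in> C" for x using C extreme_point_of_convex_hull_affine_independent by blast
  have "card (C - {p}) = 3" using C(2) p ext by (simp add: card_Diff_singleton)
  then obtain x y z where xyz: "C - {p} = {x, y, z}" "distinct [x, y, z]"
    by (auto simp: card_3_iff)
  then have "x \<in> C" "y \<in> C" "z \<in> C" "p \<notin> {x, y, z}" by blast+
  then have "tetra p S (x - p) (y - p) (z - p) \<or> tetra p S (y - p) (x - p) (z - p)"
    using xyz(2) ext by (intro simplex_tetra[OF S p]) auto
  then show ?thesis using that by blast
qed

lemma tetra_interior:
  assumes t: "tetra p S a b c" and pos: "q > 0" "r > 0" "s > 0" "q + r + s < 1"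
  shows "p + q *\<^sub>R a + r *\<^sub>R b + s *\<^sub>R c \<in> interior S"
proof -
  let ?C = "{p, p + a, p + b, p + c}"
  have d: "distinct [p, p + a, p + b, p + c]" using tetra_distinct[OF t] by auto
  define u where "u = (\<lambda>x. if x = p + a then q else if x = p + b then r else if x = p + c then s else 1 - (q + r + s))"
  have card: "card ?C = 4" using d by simp
  have ux: "u (p + a) = q" "u (p + b) = r" "u (p + c) = s" "u p = 1 - (q + r + s)"
    using d by (auto simp: u_def)
  have "\<forall>x\<in>?C. 0 < u x" using pos by (auto simp: u_def)
  moreover have "sum u ?C = 1" using d ux by simp
  moreover have "(\<Sum>x\<in>?C. u x *\<^sub>R x) = p + q *\<^sub>R a + r *\<^sub>R b + s *\<^sub>R c"
  proof -
    have "(\<Sum>x\<in>?C. u x *\<^sub>R x) = u p *\<^sub>R p + u (p + a) *\<^sub>R (p + a) + u (p + b) *\<^sub>R (p + b) + u (p + c) *\<^sub>R (p + c)"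
      using d by (simp add: add.assoc)
    then show ?thesis unfolding ux by (simp add: algebra_simps)
  qed
  moreover have "interior S = {y. \<exists>u. (\<forall>x\<in>?C. 0 < u x) \<and> sum u ?C = 1 \<and> (\<Sum>x\<in>?C. u x *\<^sub>R x) = y}"
    using t interior_convex_hull_explicit_minimal[of ?C] unfolding tetra_def card by simp
  ultimately show ?thesis by blast
qed

text \<open>Equal orientation puts \<open>c\<close> and \<open>d\<close> on the same side of the
  plane of the common facet, so an inner point of that facet, pushed slightly towards
  \<open>d\<close>, lies in both interiors.\<close>

lemma tetra_same_side_interiors_meet:
  assumes t: "tetra p S a b c" and t': "tetra p S' a b d"
  shows "interior S \<inter> interior S' \<noteq> {}"
proof -
  have tr: "trip a b c > 0" "trip a b d > 0" using t t' by (auto simp: tetra_def)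
  define \<alpha> \<beta> \<gamma> where "\<alpha> = trip b c d / trip a b c" and "\<beta> = - trip a c d / trip a b c" and "\<gamma> = trip a b d / trip a b c"
  have "trip a b c *\<^sub>R d = trip b c d *\<^sub>R a - trip a c d *\<^sub>R b + trip a b d *\<^sub>R c"
    using trip_expansion[of b c d a] by (simp add: algebra_simps)
  moreover have "d = (1 / trip a b c) *\<^sub>R (trip a b c *\<^sub>R d)" using tr by simp
  ultimately have "d = (1 / trip a b c) *\<^sub>R (trip b c d *\<^sub>R a - trip a c d *\<^sub>R b + trip a b d *\<^sub>R c)" by simp
  then have d: "d = \<alpha> *\<^sub>R a + \<beta> *\<^sub>R b + \<gamma> *\<^sub>R c"
    by (simp add: \<alpha>_def \<beta>_def \<gamma>_def scaleR_add_right scaleR_diff_right)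
  have \<gamma>: "\<gamma> > 0" using tr by (simp add: \<gamma>_def)
  \<comment> \<open>Small enough that \<open>a + b + \<eta> *\<^sub>R d\<close>, expanded in
    \<open>a\<close>, \<open>b\<close>, \<open>c\<close>, has positive coefficients. The factor
    \<delta> then makes the coefficient sums of both expansions less than 1.\<close>
  define \<eta> where "\<eta> = 1 / (1 + \<bar>\<alpha>\<bar> + \<bar>\<beta>\<bar>)"
  have "1 + \<bar>\<alpha>\<bar> + \<bar>\<beta>\<bar> > 0" by linarith
  then have \<eta>: "\<eta> > 0" "\<eta> * \<bar>\<alpha>\<bar> < 1" "\<eta> * \<bar>\<beta>\<bar> < 1" by (auto simp: \<eta>_def pos_divide_less_eq)
  have "\<eta> * \<alpha> \<ge> - (\<eta> * \<bar>\<alpha>\<bar>)" "\<eta> * \<beta> \<ge> - (\<eta> * \<bar>\<beta>\<bar>)" using \<eta>(1) by (auto simp: abs_if mult_le_0_iff)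
  then have pos: "1 + \<eta> * \<alpha> > 0" "1 + \<eta> * \<beta> > 0" "\<eta> * \<gamma> > 0" using \<eta> \<gamma> by auto
  define \<delta> where "\<delta> = 1 / (3 + \<eta> + (1 + \<eta> * \<alpha>) + (1 + \<eta> * \<beta>) + \<eta> * \<gamma>)"
  have \<delta>: "\<delta> > 0" using pos \<eta> by (simp add: \<delta>_def)
  have s: "\<delta> * (1 + 1 + \<eta>) < 1" "\<delta> * ((1 + \<eta> * \<alpha>) + (1 + \<eta> * \<beta>) + \<eta> * \<gamma>) < 1"
    using pos \<eta> by (simp_all add: \<delta>_def divide_simps)
  have "p + \<delta> *\<^sub>R a + \<delta> *\<^sub>R b + (\<delta> * \<eta>) *\<^sub>R d \<in> interior S'"
    by (rule tetra_interior[OF t']) (use \<delta> \<eta> s in \<open>auto simp: algebra_simps\<close>)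
  moreover have "p + (\<delta> * (1 + \<eta> * \<alpha>)) *\<^sub>R a + (\<delta> * (1 + \<eta> * \<beta>)) *\<^sub>R b + (\<delta> * (\<eta> * \<gamma>)) *\<^sub>R c \<in> interior S"
  proof (rule tetra_interior[OF t])
    show "0 < \<delta> * (1 + \<eta> * \<alpha>)" "0 < \<delta> * (1 + \<eta> * \<beta>)" "0 < \<delta> * (\<eta> * \<gamma>)"
      using \<delta> pos by (simp_all only: mult_pos_pos)
    show "\<delta> * (1 + \<eta> * \<alpha>) + \<delta> * (1 + \<eta> * \<beta>) + \<delta> * (\<eta> * \<gamma>) < 1"
      using s(2) by (simp only: distrib_left)
  qed
  moreover have "p + \<delta> *\<^sub>R a + \<delta> *\<^sub>R b + (\<delta> * \<eta>) *\<^sub>R d =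
     p + (\<delta> * (1 + \<eta> * \<alpha>)) *\<^sub>R a + (\<delta> * (1 + \<eta> * \<beta>)) *\<^sub>R b + (\<delta> * (\<eta> * \<gamma>)) *\<^sub>R c"
    unfolding d by (simp add: algebra_simps)
  ultimately show ?thesis by auto
qed

lemma tetra_unique_up_to_rotation:
  assumes "tetra p S a b c" "tetra p S x y z"
  shows "(x, y, z) \<in> {(a, b, c), (b, c, a), (c, a, b)}"
proof -
  have tr: "trip a b c > 0" "trip x y z > 0" using assms by (auto simp: tetra_def)
  have d: "distinct [0, a, b, c]" "distinct [0, x, y, z]" using assms tetra_distinct by blast+
  have "{p, p + a, p + b, p + c} = {p, p + x, p + y, p + z}"
    using assms[THEN tetra_extreme_points] by simp
  then have "(\<lambda>v. v - p) ` {p, p + a, p + b, p + c} = (\<lambda>v. v - p) ` {p, p + x, p + y, p + z}" by simp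
  then have "{0, a, b, c} = {0, x, y, z}" by simp
  then have "{0, a, b, c} - {0} = {0, x, y, z} - {0}" by simp
  moreover have "{0, a, b, c} - {0} = {a, b, c}" "{0, x, y, z} - {0} = {x, y, z}"
    using d by (simp_all add: insert_Diff_if)
  ultimately have s: "{a, b, c} = {x, y, z}" by simp
  have "(x, y, z) \<in> {(a, b, c), (b, c, a), (c, a, b), (b, a, c), (a, c, b), (c, b, a)}"
  proof -
    have "x \<in> {a, b, c}" "y \<in> {a, b, c}" "z \<in> {a, b, c}" unfolding s by simp_all
    then show ?thesis using d(2) by (elim insertE emptyE) simp_all
  qed
  moreover have "trip b a c < 0" "trip a c b < 0" "trip c b a < 0"
    using tr(1) trip_swap[of b a c] trip_swap'[of a c b] trip_swap[of c b a] trip_rotate[of b c a] by auto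
  ultimately show ?thesis using tr(2) by auto
qed

section \<open>The triangles opposite to the apex as a fan\<close>

locale star_polyhedron =
  fixes P :: "(real^3) set" and \<K> \<T> :: "(real^3) set set" and p :: "real^3"
  assumes P: "triangulated_polyhedron P \<K>" and wc: "weakly_convex P \<K>"
    and pK: "p \<in> verts \<K>" and star: "star_triangulation P \<K> p \<T>"
begin

lemma finite_T: "finite \<T>" and union_T: "\<Union>\<T> = P"
  and simplex_T: "S \<in> \<T> \<Longrightarrow> 3 simplex S" and apex_T: "S \<in> \<T> \<Longrightarrow> p extreme_point_of S"
  and verts_T: "verts \<T> \<subseteq> verts \<K>"
  and triangulation_TK: "triangulation (\<T> \<union> \<K>)"
  using star unfolding star_triangulation_def by simp_all

lemma disjoint_T: "S \<in> \<T> \<Longrightarrow> S' \<in> \<T> \<Longrightarrow> interior S \<inter> interior S' \<noteq> {} \<Longrightarrow> S = S'"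
  using star unfolding star_triangulation_def by metis

lemma face_TK: "S \<in> \<T> \<union> \<K> \<Longrightarrow> S' \<in> \<T> \<union> \<K> \<Longrightarrow> S \<inter> S' face_of S"
  using triangulation_TK unfolding triangulation_def by blast

lemma closed_T: "S \<in> \<T> \<Longrightarrow> closed S"
  using simplex_T by (meson compact_imp_closed polytope_imp_compact simplex_imp_polytope)

lemma obtain_tetra:
  assumes "S \<in> \<T>" obtains a b c where "tetra p S a b c"
  using simplex_obtain_tetra simplex_T apex_T assms by blast

text \<open>A relative interior point \<open>z\<close> of the facet avoids the boundary, because
  members of the triangulation meet in faces and one containing \<open>z\<close> contains the whole
  facet. So \<open>z\<close> is interior to \<open>P\<close> but not to \<open>S\<close>, hence a
  limit of points of \<open>P - S\<close>; finitely many closed tetrahedra cover these, and one of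
  them contains \<open>z\<close>.\<close>

lemma interior_facet_shared:
  assumes S: "S \<in> \<T>" and t: "tetra p S a b c" and x: "x \<in> {p, p + a, p + b, p + c}"
    and int: "\<forall>F\<in>\<K>. \<not> convex hull ({p, p + a, p + b, p + c} - {x}) \<subseteq> F"
  shows "\<exists>S'\<in>\<T>. S' \<noteq> S \<and> (\<forall>v\<in>{p, p + a, p + b, p + c} - {x}. v extreme_point_of S')"
proof -
  let ?C = "{p, p + a, p + b, p + c}"
  define G where "G = convex hull (?C - {x})"
  have aff: "\<not> affine_dependent ?C" and Seq: "S = convex hull ?C" using t by (auto simp: tetra_def)
  have ext: "v extreme_point_of S \<longleftrightarrow> v \<in> ?C" for v using tetra_extreme_points[OF t] by blast
  have G: "G face_of S"
    unfolding Seq face_of_convex_hull_affine_independent[OF aff] G_def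
    by (intro exI[of _ "?C - {x}"] conjI Diff_subset refl)
  have "x \<notin> ?C - {x}" by blast
  then have "G \<noteq> S" using ext[of x] x extreme_point_of_convex_hull[of x "?C - {x}"] unfolding G_def by metis
  have "?C - {x} \<noteq> {}"
  proof
    assume "?C - {x} = {}"
    then have "card ?C \<le> card {x}" by (intro card_mono) auto
    moreover have "card ?C = 4" using tetra_distinct[OF t] by simp
    ultimately show False by simp
  qed
  then have "rel_interior G \<noteq> {}" by (simp add: G_def rel_interior_eq_empty)
  then obtain z where z: "z \<in> rel_interior G" by blast
  have zG: "z \<in> G" using z rel_interior_subset by blast
  have GS: "G \<subseteq> S" using G face_of_imp_subset by blast
  have in_other: "G \<subseteq> F" if "F \<in> \<T> \<union> \<K>" "z \<in> F" for F
  proof -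
    have "S \<inter> F face_of S" using face_TK S that by blast
    then have "G \<subseteq> S \<inter> F"
      by (rule subset_of_face_of[OF _ GS]) (use z zG GS that in blast)
    then show ?thesis by blast
  qed
  have "z \<notin> frontier P"
  proof
    assume "z \<in> frontier P"
    then obtain F where "F \<in> \<K>" "z \<in> F" using P unfolding triangulated_polyhedron_def by blast
    then show False using in_other int unfolding G_def by blast
  qed
  moreover have "z \<in> P" using zG GS S union_T by blast
  ultimately have zP: "z \<in> interior P" using closure_subset by (auto simp: frontier_def)
  have zS: "z \<notin> interior S" using face_of_disjoint_interior[OF G \<open>G \<noteq> S\<close>] zG by blast
  have "z \<in> closure (P - S)"
  proof (rule ccontr)
    assume "z \<notin> closure (P - S)"
    then have "z \<in> interior P \<inter> - closure (P - S)" using zP by blast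
    moreover have "interior P \<inter> - closure (P - S) \<subseteq> interior S"
    proof (rule interior_maximal)
      show "interior P \<inter> - closure (P - S) \<subseteq> S" using closure_subset[of "P - S"] interior_subset[of P] by blast
    qed (auto simp: open_Int open_Compl)
    ultimately show False using zS by blast
  qed
  moreover have "closure (P - S) \<subseteq> \<Union>(\<T> - {S})"
    by (rule closure_minimal) (use union_T finite_T closed_T in \<open>auto intro!: closed_Union\<close>)
  ultimately obtain S' where S': "S' \<in> \<T>" "S' \<noteq> S" "z \<in> S'" by blast
  have GS': "G \<subseteq> S'" using in_other S' by blast
  show ?thesis
  proof (rule bexI[OF _ S'(1)], intro conjI ballI S'(2))
    fix v assume v: "v \<in> ?C - {x}"
    have "v \<in> S \<inter> S'" using v GS GS' hull_inc[of v "?C - {x}" convex] by (auto simp: G_def)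
    moreover have "S \<inter> S' face_of S" "S' \<inter> S face_of S'" using face_TK S S' by blast+
    moreover have "v extreme_point_of S" using v ext by blast
    ultimately show "v extreme_point_of S'"
      by (metis Int_commute extreme_point_of_face)
  qed
qed

abbreviation seg :: "real^3 \<Rightarrow> (real^3) set"
  where "seg i \<equiv> closed_segment p (p + i)"

definition V :: "(real^3) set"
  where "V = (\<lambda>x. x - p) ` (verts \<T> - {p})"

definition I :: "(real^3) set"
  where "I = {i. seg i \<in> interior_edges \<K> \<T>}"

lemma tetra_mem_V:
  assumes "S \<in> \<T>" "tetra p S a b c" shows "a \<in> V" "b \<in> V" "c \<in> V"
proof -
  have "p + v \<in> verts \<T> - {p}" if "v \<in> {a, b, c}" for v
    using that assms tetra_extreme_points[OF assms(2)] tetra_distinct[OF assms(2)] unfolding verts_def by auto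
  then show "a \<in> V" "b \<in> V" "c \<in> V" unfolding V_def by (force intro: image_eqI[where x = "p + _"])+
qed

lemma finite_V: "finite V"
proof -
  have "finite {v. v extreme_point_of S}" if "S \<in> \<T>" for S
  proof -
    obtain a b c where "tetra p S a b c" using obtain_tetra \<open>S \<in> \<T>\<close> by blast
    from tetra_extreme_points[OF this] show ?thesis by simp
  qed
  moreover have "verts \<T> = (\<Union>S\<in>\<T>. {v. v extreme_point_of S})" by (auto simp: verts_def)
  ultimately show ?thesis using finite_T by (simp add: V_def)
qed

lemma edge_of_tetra:
  assumes "tetra p S a b c" shows "e edge_of S \<longleftrightarrow>
    (\<exists>x y. x \<in> {p, p + a, p + b, p + c} \<and> y \<in> {p, p + a, p + b, p + c} \<and> x \<noteq> y \<and> e = closed_segment x y)"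
proof -
  let ?C = "{p, p + a, p + b, p + c}"
  have aff: "\<not> affine_dependent ?C" and Seq: "S = convex hull ?C" using assms by (auto simp: tetra_def)
  have dim: "aff_dim (convex hull D) = int (card D) - 1" if "D \<subseteq> ?C" for D
    using aff_dim_affine_independent[OF affine_independent_subset[OF aff that]]
    by (simp only: aff_dim_convex_hull)
  show ?thesis
  proof
    assume "e edge_of S"
    then have "e face_of S" "aff_dim e = 1" by (auto simp: edge_of_def)
    then obtain D where D: "D \<subseteq> ?C" "e = convex hull D"
      unfolding Seq face_of_convex_hull_affine_independent[OF aff] by (elim exE conjE)
    then have "card D = 2" using dim[OF D(1)] \<open>aff_dim e = 1\<close> by simp
    then obtain x y where "D = {x, y}" "x \<noteq> y" by (meson card_2_iff)
    then show "\<exists>x y. x \<in> ?C \<and> y \<in> ?C \<and> x \<noteq> y \<and> e = closed_segment x y"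
      using D by (intro exI[of _ x] exI[of _ y]) (simp add: segment_convex_hull)
  next
    assume "\<exists>x y. x \<in> ?C \<and> y \<in> ?C \<and> x \<noteq> y \<and> e = closed_segment x y"
    then obtain x y where "x \<in> ?C" "y \<in> ?C" and ne: "x \<noteq> y" and e: "e = convex hull {x, y}"
      unfolding segment_convex_hull by (elim exE conjE)
    then have sub: "{x, y} \<subseteq> ?C" by (simp only: insert_subset empty_subsetI simp_thms)
    then have "e face_of S"
      unfolding Seq face_of_convex_hull_affine_independent[OF aff] e by (intro exI[of _ "{x, y}"] conjI refl)
    moreover have "aff_dim e = 1" using dim[OF sub] ne e by simp
    ultimately show "e edge_of S" by (simp add: edge_of_def)
  qed
qed

lemma seg_edge_of_tetra:
  assumes "tetra p S a b c" shows "seg i edge_of S \<longleftrightarrow> i \<in> {a, b, c}"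
proof -
  have d: "distinct [0, a, b, c]" using tetra_distinct[OF assms] .
  show ?thesis unfolding edge_of_tetra[OF assms]
  proof
    assume "\<exists>x y. x \<in> {p, p + a, p + b, p + c} \<and> y \<in> {p, p + a, p + b, p + c} \<and> x \<noteq> y \<and> seg i = closed_segment x y"
    then obtain x y where xy: "x \<in> {p, p + a, p + b, p + c}" "y \<in> {p, p + a, p + b, p + c}" "x \<noteq> y"
      and e: "{p, p + i} = {x, y}" by (auto simp only: closed_segment_eq)
    have "p + i \<in> {x, y}" "p + i \<noteq> p" using e xy(3) by (auto simp: doubleton_eq_iff)
    then have "p + i \<in> {p + a, p + b, p + c}" using xy(1,2) by blast
    then show "i \<in> {a, b, c}" by simp
  next
    assume "i \<in> {a, b, c}"
    then show "\<exists>x y. x \<in> {p, p + a, p + b, p + c} \<and> y \<in> {p, p + a, p + b, p + c} \<and> x \<noteq> y \<and> seg i = closed_segment x y"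
      using d by (intro exI[of _ p] exI[of _ "p + i"]) auto
  qed
qed

text \<open>The facet opposite to the apex determines its tetrahedron, so it lies in the boundary.\<close>
lemma interior_edge_contains_apex:
  assumes "e \<in> interior_edges \<K> \<T>"
  obtains i where "i \<in> I" "e = seg i"
proof -
  obtain S where S: "S \<in> \<T>" "e edge_of S" and int: "\<And>F. F \<in> \<K> \<Longrightarrow> \<not> e \<subseteq> F"
    using assms by (auto simp: interior_edges_def)
  obtain a b c where t: "tetra p S a b c" using obtain_tetra S by blast
  let ?C = "{p, p + a, p + b, p + c}"
  have d: "distinct [0, a, b, c]" using tetra_distinct[OF t] .
  obtain x y where xy: "x \<in> ?C" "y \<in> ?C" "x \<noteq> y" "e = closed_segment x y"
    using iffD1[OF edge_of_tetra[OF t] S(2)] by (elim exE conjE)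
  have "x = p \<or> y = p"
  proof (rule ccontr)
    assume "\<not> (x = p \<or> y = p)"
    then have "{x, y} \<subseteq> ?C - {p}" using xy by blast
    then have "e \<subseteq> convex hull (?C - {p})" unfolding xy(4) segment_convex_hull by (rule hull_mono)
    then have nF: "\<forall>F\<in>\<K>. \<not> convex hull (?C - {p}) \<subseteq> F" using int by (meson order_trans)
    obtain S' where S': "S' \<in> \<T>" "S' \<noteq> S" "\<forall>v\<in>?C - {p}. v extreme_point_of S'"
      using interior_facet_shared[OF S(1) t insertI1 nF] by (elim bexE conjE)
    have "tetra p S' a b c \<or> tetra p S' b a c"
      by (rule simplex_tetra[OF simplex_T[OF S'(1)] apex_T[OF S'(1)]]) (use S'(3) d in auto)
    then have "S' = S" using t unfolding tetra_def by (auto simp: insert_commute)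
    then show False using S' by blast
  qed
  then obtain v where "e = closed_segment p v"
    using xy(4) closed_segment_commute by metis
  then have e: "e = seg (v - p)" by simp
  then have "v - p \<in> I" using assms unfolding I_def by blast
  then show ?thesis using that e by blast
qed

lemma interior_edges_eq: "interior_edges \<K> \<T> = seg ` I"
  using interior_edge_contains_apex by (auto simp: I_def)

lemma I_obtain_tetra:
  assumes "i \<in> I" obtains S b c where "S \<in> \<T>" "tetra p S i b c"
proof -
  obtain S where S: "S \<in> \<T>" "seg i edge_of S" using assms by (auto simp: I_def interior_edges_def)
  obtain a b c where t: "tetra p S a b c" using obtain_tetra S by blast
  have "i \<in> {a, b, c}" using S(2) seg_edge_of_tetra[OF t] by blast
  moreover have "tetra p S b c a" using tetra_rotate[OF t] .
  moreover have "tetra p S c a b" using tetra_rotate[OF tetra_rotate[OF t]] .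
  ultimately have "\<exists>b c. tetra p S i b c" using t by auto
  then show ?thesis using that[OF S(1)] by auto
qed

lemma I_subset_V: "I \<subseteq> V"
proof
  fix i assume "i \<in> I"
  then obtain S b c where "S \<in> \<T>" "tetra p S i b c" by (rule I_obtain_tetra)
  then show "i \<in> V" by (rule tetra_mem_V(1))
qed

text \<open>The facet through the apex, \<open>a\<close> and \<open>b\<close> contains an interior
  edge, so it is shared with another tetrahedron. Equal orientation there would make the interiors
  overlap.\<close>

lemma tetra_opposite:
  assumes i: "i \<in> I" and S: "S \<in> \<T>" and t: "tetra p S a b c" and iab: "i = a \<or> i = b"
  obtains S' d where "S' \<in> \<T>" "tetra p S' b a d"
proof -
  let ?C = "{p, p + a, p + b, p + c}"
  have d: "distinct [0, a, b, c]" using tetra_distinct[OF t] .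
  have "seg i \<subseteq> convex hull (?C - {p + c})"
    unfolding segment_convex_hull by (rule hull_mono) (use iab d in auto)
  moreover have "\<not> seg i \<subseteq> F" if "F \<in> \<K>" for F using i that by (auto simp: I_def interior_edges_def)
  ultimately have nF: "\<forall>F\<in>\<K>. \<not> convex hull (?C - {p + c}) \<subseteq> F" by (meson order_trans)
  have cC: "p + c \<in> ?C" by simp
  obtain S' where S': "S' \<in> \<T>" "S' \<noteq> S" "\<forall>v\<in>?C - {p + c}. v extreme_point_of S'"
    using interior_facet_shared[OF S t cC nF] by (elim bexE conjE)
  have ext: "p + a extreme_point_of S'" "p + b extreme_point_of S'" using S'(3) d by auto
  obtain x y z where t': "tetra p S' x y z" using obtain_tetra S' by blast
  have d': "distinct [0, x, y, z]" using tetra_distinct[OF t'] .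
  have "p + a \<in> {p, p + x, p + y, p + z}" "p + b \<in> {p, p + x, p + y, p + z}"
    using ext tetra_extreme_points[OF t'] by blast+
  then have ab: "a \<in> {x, y, z}" "b \<in> {x, y, z}" using d by auto
  then obtain e where e: "e \<in> {x, y, z}" "e \<noteq> a" "e \<noteq> b" using d d' by auto
  have "p + e extreme_point_of S'" using e tetra_extreme_points[OF t'] by auto
  then have "tetra p S' a b e \<or> tetra p S' b a e"
    using ext d d' e by (intro simplex_tetra[OF simplex_T[OF S'(1)] apex_T[OF S'(1)]]) auto
  moreover have "\<not> tetra p S' a b e"
    using tetra_same_side_interiors_meet[OF t] disjoint_T[OF S S'(1)] S'(2) by blast
  ultimately show ?thesis using that S'(1) by blast
qed

definition TR :: "tri set"
  where "TR = {(a, b, c). \<exists>S\<in>\<T>. tetra p S a b c}"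

lemma finite_TR: "finite TR"
proof -
  have "TR \<subseteq> Sigma V (\<lambda>_. Sigma V (\<lambda>_. V))" using tetra_mem_V by (auto simp: TR_def)
  then show ?thesis using finite_V by (auto intro: finite_subset)
qed

lemma TR_unique: "(a, b, c) \<in> TR \<Longrightarrow> (a, b, d) \<in> TR \<Longrightarrow> c = d"
proof -
  assume "(a, b, c) \<in> TR" "(a, b, d) \<in> TR"
  then obtain S S' where S: "S \<in> \<T>" "tetra p S a b c" "S' \<in> \<T>" "tetra p S' a b d" by (auto simp: TR_def)
  then have "S = S'" using tetra_same_side_interiors_meet disjoint_T by blast
  then have "(a, b, d) \<in> {(a, b, c), (b, c, a), (c, a, b)}" using tetra_unique_up_to_rotation S by blast
  then show "c = d" using tetra_distinct[OF S(2)] by auto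
qed

text \<open>A directed edge determines its triangle, so the edge multiset is a set and the balance
  reduces to the existence of an opposite tetrahedron.\<close>

lemma fan_TR: "fan V I (mset_set TR)"
proof -
  have mem: "t \<in># mset_set TR \<longleftrightarrow> t \<in> TR" for t using finite_TR by simp
  have "tetra p S b c a \<longleftrightarrow> tetra p S a b c" for S a b c
    using tetra_rotate[of p S a b c] tetra_rotate[of p S b c a] tetra_rotate[of p S c a b] by blast
  then have rot: "(b, c, a) \<in> TR \<longleftrightarrow> (a, b, c) \<in> TR" for a b c by (simp add: TR_def)
  have "inj_on (\<lambda>(a, b, c). (a, b)) TR" using TR_unique by (auto simp: inj_on_def)
  then have E: "edge_mset (mset_set TR) = mset_set ((\<lambda>(a, b, c). (a, b)) ` TR)"
    unfolding edge_mset_def by (rule image_mset_mset_set)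
  have inE: "(a, b) \<in> (\<lambda>(a, b, c). (a, b)) ` TR \<longleftrightarrow> (\<exists>c. (a, b, c) \<in> TR)" for a b by force
  have opp: "(\<exists>c. (i, b, c) \<in> TR) \<longleftrightarrow> (\<exists>c. (b, i, c) \<in> TR)" if "i \<in> I" for i b
    using tetra_opposite[OF that] by (auto simp: TR_def) blast+
  show ?thesis unfolding fan_def mem
  proof (intro conjI allI impI ballI)
    fix a b c assume "(a, b, c) \<in> TR"
    then obtain S where "S \<in> \<T>" "tetra p S a b c" by (auto simp: TR_def)
    then show "a \<in> V" "b \<in> V" "c \<in> V" "trip a b c > 0" using tetra_mem_V by (auto simp: tetra_def)
  next
    fix a b c show "count (mset_set TR) (b, c, a) = count (mset_set TR) (a, b, c)"
      using finite_TR rot by (simp add: count_mset_set')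
  next
    fix i b assume "i \<in> I"
    from opp[OF this] show "count (edge_mset (mset_set TR)) (i, b) = count (edge_mset (mset_set TR)) (b, i)"
      unfolding E using finite_TR by (simp only: count_mset_set' inE)
  next
    fix i assume "i \<in> I"
    then obtain S b c where "S \<in> \<T>" "tetra p S i b c" by (rule I_obtain_tetra)
    then show "\<exists>b c. (i, b, c) \<in> TR" by (auto simp: TR_def)
  qed
qed

text \<open>A convex set stays convex when an extreme point is removed, and what remains contains
  the other vertices. The case \<open>v = 0\<close> concerns the apex.\<close>

lemma vertex_not_in_hull:
  assumes v: "p + v \<in> verts \<K>" and A: "A \<subseteq> insert 0 V - {v}"
  shows "v \<notin> convex hull A"
proof
  assume "v \<in> convex hull A"
  then have "p + v \<in> convex hull ((+) p ` A)" by (simp add: convex_hull_translation)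
  moreover have "(+) p ` A \<subseteq> convex hull P - {p + v}"
  proof -
    have "p + x \<in> P" if x: "x \<in> insert 0 V" for x
    proof -
      have "p + x \<in> verts \<T> \<or> x = 0" using x by (auto simp: V_def)
      moreover have "verts \<T> \<subseteq> P" using union_T by (auto simp: verts_def extreme_point_of_def)
      moreover have "p \<in> P"
      proof -
        have "p \<in> \<Union>\<K>" using pK by (auto simp: verts_def extreme_point_of_def)
        moreover have "frontier P \<subseteq> P" using P unfolding triangulated_polyhedron_def
          by (metis compact_imp_closed frontier_subset_closed)
        ultimately show ?thesis using P unfolding triangulated_polyhedron_def by auto
      qed
      ultimately show ?thesis by auto
    qed
    then show ?thesis using A hull_inc[of _ P convex] by auto
  qed
  moreover have "convex (convex hull P - {p + v})"
    using wc v unfolding weakly_convex_def by (simp add: extreme_point_of_stillconvex)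
  ultimately have "p + v \<in> convex hull P - {p + v}" by (meson hull_minimal subsetD)
  then show False by blast
qed

lemma V_convex_position:
  assumes "v \<in> V" shows "v \<notin> convex hull (insert 0 (V - {v}))"
proof (rule vertex_not_in_hull)
  show "p + v \<in> verts \<K>" using assms verts_T by (auto simp: V_def)
  show "insert 0 (V - {v}) \<subseteq> insert 0 V - {v}" using assms by (auto simp: V_def)
qed

text \<open>The apex is itself an extreme point, so it can be strictly separated from the hull of
  the other vertices.\<close>

lemma V_half_space: obtains \<alpha> where "\<And>v. v \<in> V \<Longrightarrow> \<alpha> \<bullet> v > 0"
proof -
  have "0 \<notin> convex hull V" by (rule vertex_not_in_hull) (use pK in \<open>auto simp: V_def\<close>)
  moreover have "closed (convex hull V)"
    using finite_V by (simp add: compact_convex_hull compact_imp_closed finite_imp_compact)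
  ultimately obtain \<alpha> e where "0 < e" "\<And>x. x \<in> convex hull V \<Longrightarrow> e < \<alpha> \<bullet> x"
    using separating_hyperplane_closed_0[of "convex hull V"] by auto
  then show ?thesis using that[of \<alpha>] hull_inc[of _ V convex] by fastforce
qed

end

section \<open>Dihedral angles as functions of edge lengths\<close>

lemma orth_component_inner:
  "orth_component u w \<bullet> orth_component u z = w \<bullet> z - (w \<bullet> u) * (z \<bullet> u) / (u \<bullet> u)"
  by (cases "u = 0") (simp_all add: orth_component_def inner_diff_left inner_diff_right inner_commute field_simps)

text \<open>\<open>A\<close>, \<open>B\<close>, \<open>C\<close> stand for the squared lengths of
  three vectors from one end of the edge, the first along the edge; \<open>g\<close>,
  \<open>c\<close>, \<open>e\<close> are the inner products first-second, first-third, second-third.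
  These are affine in the squared edge lengths.\<close>

definition gram_angle :: "real \<Rightarrow> real \<Rightarrow> real \<Rightarrow> real \<Rightarrow> real \<Rightarrow> real \<Rightarrow> real"
  where "gram_angle A B C g c e =
    arccos ((e - g * c / A) / (sqrt (B - g\<^sup>2 / A) * sqrt (C - c\<^sup>2 / A)))"

lemma dihedral_angle_gram:
  "dihedral_angle p x y z = gram_angle ((x - p) \<bullet> (x - p)) ((y - p) \<bullet> (y - p)) ((z - p) \<bullet> (z - p))
     ((x - p) \<bullet> (y - p)) ((x - p) \<bullet> (z - p)) ((y - p) \<bullet> (z - p))"
  by (simp add: dihedral_angle_def vector_angle_def gram_angle_def norm_eq_sqrt_inner orth_component_inner
      power2_eq_square inner_commute)

lemma inner_eq_dist: "(x - p) \<bullet> (y - p) = ((dist p x)\<^sup>2 + (dist p y)\<^sup>2 - (dist x y)\<^sup>2) / 2"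
  by (simp add: dist_norm power2_norm_eq_inner inner_diff_left inner_diff_right inner_commute)

lemma dihedral_angle_cong:
  assumes "dist p x = dist p' x'" "dist p y = dist p' y'" "dist p z = dist p' z'"
    "dist x y = dist x' y'" "dist x z = dist x' z'" "dist y z = dist y' z'"
  shows "dihedral_angle p x y z = dihedral_angle p' x' y' z'"
  unfolding dihedral_angle_gram inner_eq_dist by (simp add: assms)

lemma dihedral_angle_swap_wings: "dihedral_angle p x z y = dihedral_angle p x y z"
  by (simp add: dihedral_angle_def vector_angle_def inner_commute mult.commute)

lemma orth_component_swap: "orth_component (p - x) (y - x) = orth_component (x - p) (y - p)"
proof (cases "x = p")
  case False
  have shift: "(v - u) - ((v - u) \<bullet> u / (u \<bullet> u)) *\<^sub>R u = v - (v \<bullet> u / (u \<bullet> u)) *\<^sub>R u" if "u \<noteq> 0" for u v :: "real^3"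
    using that by (simp add: inner_diff_left diff_divide_distrib scaleR_diff_left)
  have "orth_component (- u) w = orth_component u w" for u w by (simp add: orth_component_def)
  from this[of "x - p"] have "orth_component (p - x) (y - x) = orth_component (x - p) (y - x)" by simp
  also have "\<dots> = orth_component (x - p) (y - p)"
    using shift[of "x - p" "y - p"] False by (simp add: orth_component_def)
  finally show ?thesis .
qed simp

lemma dihedral_angle_swap_edge: "dihedral_angle x p y z = dihedral_angle p x y z"
  by (simp add: dihedral_angle_def orth_component_swap)

text \<open>Any two numberings differ by exchanging the ends of the edge or the two other vertices,
  and neither changes the angle. Two realizations have equal distances, which determine the
  angle.\<close>

lemma deformed_dihedral_angle_eq:
  assumes real: "realizes_lengths L S \<phi>"
    and S: "{x. x extreme_point_of S} = {a, b, c, d}" and e: "{x. x extreme_point_of e} = {a, b}"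
    and distinct: "distinct [a, b, c, d]"
  shows "deformed_dihedral_angle L S e = dihedral_angle (\<phi> a) (\<phi> b) (\<phi> c) (\<phi> d)"
  unfolding deformed_dihedral_angle_def
proof (rule the_equality)
  show "\<exists>\<phi>' a' b' c' d'. realizes_lengths L S \<phi>' \<and> {x. x extreme_point_of e} = {a', b'} \<and>
    {x. x extreme_point_of S} = {a', b', c', d'} \<and>
    dihedral_angle (\<phi> a) (\<phi> b) (\<phi> c) (\<phi> d) = dihedral_angle (\<phi>' a') (\<phi>' b') (\<phi>' c') (\<phi>' d')"
    using real S e by blast
next
  fix \<alpha>
  assume "\<exists>\<psi> a' b' c' d'. realizes_lengths L S \<psi> \<and> {x. x extreme_point_of e} = {a', b'} \<and>
    {x. x extreme_point_of S} = {a', b', c', d'} \<and> \<alpha> = dihedral_angle (\<psi> a') (\<psi> b') (\<psi> c') (\<psi> d')"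
  then obtain \<psi> a' b' c' d' where \<psi>: "realizes_lengths L S \<psi>" and e': "{a, b} = {a', b'}"
    and S': "{a, b, c, d} = {a', b', c', d'}" and \<alpha>: "\<alpha> = dihedral_angle (\<psi> a') (\<psi> b') (\<psi> c') (\<psi> d')"
    unfolding S e by blast
  have ab: "a' = a \<and> b' = b \<or> a' = b \<and> b' = a" using e' by (auto simp: doubleton_eq_iff)
  have "{c, d} = {a, b, c, d} - {a, b}" using distinct by auto
  also have "\<dots> \<subseteq> {c', d'}" unfolding S' e' by auto
  finally have "{c', d'} = {c, d}"
    using distinct by (auto)
  then have cd: "c' = c \<and> d' = d \<or> c' = d \<and> d' = c" by (auto simp: doubleton_eq_iff)
  have "\<alpha> = dihedral_angle (\<psi> a) (\<psi> b) (\<psi> c) (\<psi> d)"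
    using ab cd \<alpha> dihedral_angle_swap_edge dihedral_angle_swap_wings by metis
  also have "\<dots> = dihedral_angle (\<phi> a) (\<phi> b) (\<phi> c) (\<phi> d)"
  proof -
    have "dist (\<psi> x) (\<psi> y) = dist (\<phi> x) (\<phi> y)" if "x \<in> {a, b, c, d}" "y \<in> {a, b, c, d}" for x y
      using that \<psi> real S unfolding realizes_lengths_def by (metis dist_self mem_Collect_eq)
    then show ?thesis by (intro dihedral_angle_cong) auto
  qed
  finally show "\<alpha> = dihedral_angle (\<phi> a) (\<phi> b) (\<phi> c) (\<phi> d)" .
qed

text \<open>The vector \<open>(a \<times> b) \<times> (a \<times> c)\<close> equals
  \<open>trip a b c *\<^sub>R a\<close>; its squared norm is computed in two ways.\<close>

lemma gram_det: "(a \<bullet> a) * ((b \<bullet> b - (a \<bullet> b)\<^sup>2 / (a \<bullet> a)) * (c \<bullet> c - (a \<bullet> c)\<^sup>2 / (a \<bullet> a))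
    - (b \<bullet> c - (a \<bullet> b) * (a \<bullet> c) / (a \<bullet> a))\<^sup>2) = (trip a b c)\<^sup>2"
  if "a \<noteq> 0"
proof -
  have nz: "a \<bullet> a \<noteq> 0" using that by simp
  have det: "(a \<bullet> a) * (trip a b c)\<^sup>2 = ((a \<bullet> a) * (b \<bullet> b) - (a \<bullet> b)\<^sup>2) * ((a \<bullet> a) * (c \<bullet> c) - (a \<bullet> c)\<^sup>2)
    - ((a \<bullet> a) * (b \<bullet> c) - (a \<bullet> b) * (a \<bullet> c))\<^sup>2"
  proof -
    have "(a \<times> b) \<times> (a \<times> c) = trip a b c *\<^sub>R a"
      by (simp add: Lagrange cross_dot_trip)
    then have "(a \<bullet> a) * (trip a b c)\<^sup>2 = ((a \<times> b) \<times> (a \<times> c)) \<bullet> ((a \<times> b) \<times> (a \<times> c))"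
      by (simp add: power2_eq_square)
    then show ?thesis by (simp add: dot_cross power2_eq_square inner_commute mult.commute)
  qed
  have e: "(a \<bullet> a) * (b \<bullet> b - (a \<bullet> b)\<^sup>2 / (a \<bullet> a)) = (a \<bullet> a) * (b \<bullet> b) - (a \<bullet> b)\<^sup>2"
    "(a \<bullet> a) * (c \<bullet> c - (a \<bullet> c)\<^sup>2 / (a \<bullet> a)) = (a \<bullet> a) * (c \<bullet> c) - (a \<bullet> c)\<^sup>2"
    "(a \<bullet> a) * (b \<bullet> c - (a \<bullet> b) * (a \<bullet> c) / (a \<bullet> a)) = (a \<bullet> a) * (b \<bullet> c) - (a \<bullet> b) * (a \<bullet> c)"
    using nz by (simp_all add: right_diff_distrib)
  have "k * (k * (y * z - h\<^sup>2)) = (k * y) * (k * z) - (k * h)\<^sup>2" for k y z h :: real by algebra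
  then have "(a \<bullet> a) * ((a \<bullet> a) * ((b \<bullet> b - (a \<bullet> b)\<^sup>2 / (a \<bullet> a)) * (c \<bullet> c - (a \<bullet> c)\<^sup>2 / (a \<bullet> a))
    - (b \<bullet> c - (a \<bullet> b) * (a \<bullet> c) / (a \<bullet> a))\<^sup>2)) = (a \<bullet> a) * (trip a b c)\<^sup>2"
    by (simp only: e det)
  then show ?thesis using nz by (metis mult_left_cancel)
qed

lemma arccos_quotient_deriv:
  fixes h Y Z :: "real \<Rightarrow> real"
  assumes "(h has_real_derivative h') (at t)" "(Y has_real_derivative Y') (at t)" "(Z has_real_derivative Z') (at t)"
    and pos: "Y t > 0" "Z t > 0" "(h t)\<^sup>2 < Y t * Z t"
  shows "((\<lambda>t. arccos (h t / (sqrt (Y t) * sqrt (Z t)))) has_real_derivative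
    - (h' - h t * (Y' / (2 * Y t) + Z' / (2 * Z t))) / sqrt (Y t * Z t - (h t)\<^sup>2)) (at t)"
proof -
  define q where "q = sqrt (Y t) * sqrt (Z t)"
  have q: "q > 0" "q\<^sup>2 = Y t * Z t" using pos by (simp_all add: q_def power_mult_distrib)
  have "\<bar>h t\<bar> < q" by (rule power2_less_imp_less) (use pos(3) q in simp_all)
  then have sq: "\<bar>h t / q\<bar> < 1" using q by (simp add: abs_divide)
  have r: "sqrt (1 - (h t / q)\<^sup>2) = sqrt (Y t * Z t - (h t)\<^sup>2) / q"
  proof -
    have "1 - (h t / q)\<^sup>2 = (Y t * Z t - (h t)\<^sup>2) / q\<^sup>2"
      using q(1) unfolding q(2)[symmetric] by (simp add: power_divide diff_divide_distrib)
    then show ?thesis using q(1) by (simp add: real_sqrt_divide)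
  qed
  define u' where "u' = (h' - h t * (Y' / (2 * Y t) + Z' / (2 * Z t))) / q"
  have "((\<lambda>t. h t / (sqrt (Y t) * sqrt (Z t))) has_real_derivative u') (at t)"
  proof -
    have "((\<lambda>t. h t / (sqrt (Y t) * sqrt (Z t))) has_real_derivative
      (h' * q - h t * (Y' * (inverse (sqrt (Y t)) / 2) * sqrt (Z t) + Z' * (inverse (sqrt (Z t)) / 2) * sqrt (Y t))) / (q * q)) (at t)"
      using assms(1-3) pos unfolding q_def
      by (auto intro!: derivative_eq_intros simp: algebra_simps)
    also have "(h' * q - h t * (Y' * (inverse (sqrt (Y t)) / 2) * sqrt (Z t) + Z' * (inverse (sqrt (Z t)) / 2) * sqrt (Y t))) / (q * q) = u'"
    proof -
      have "inverse (sqrt (Y t)) * sqrt (Z t) = q / Y t" "inverse (sqrt (Z t)) * sqrt (Y t) = q / Z t"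
        using pos by (simp_all add: q_def field_simps)
      then have "Y' * (inverse (sqrt (Y t)) / 2) * sqrt (Z t) + Z' * (inverse (sqrt (Z t)) / 2) * sqrt (Y t)
        = q * (Y' / (2 * Y t) + Z' / (2 * Z t))"
        by (simp add: algebra_simps)
      then show ?thesis using q(1) by (simp add: u'_def field_simps)
    qed
    finally show ?thesis .
  qed
  moreover have "(arccos has_real_derivative inverse (- sqrt (1 - (h t / q)\<^sup>2))) (at (h t / q))"
    using sq by (intro DERIV_arccos) linarith+
  ultimately have "((\<lambda>t. arccos (h t / (sqrt (Y t) * sqrt (Z t)))) has_real_derivative
      inverse (- sqrt (1 - (h t / q)\<^sup>2)) * u') (at t)"
    unfolding q_def by (rule DERIV_chain2[rotated])
  also have "inverse (- sqrt (1 - (h t / q)\<^sup>2)) * u' =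
     - (h' - h t * (Y' / (2 * Y t) + Z' / (2 * Z t))) / sqrt (Y t * Z t - (h t)\<^sup>2)"
  proof -
    have "inverse (- (r' / q)) * (x / q) = - x / r'" for x r' :: real using q(1) by simp
    then show ?thesis unfolding r u'_def .
  qed
  finally show ?thesis .
qed

lemma gram_angle_deriv:
  fixes a b c :: "real^3" and A B C g k e :: "real \<Rightarrow> real"
  assumes tr: "trip a b c \<noteq> 0"
    and vals: "A t = a \<bullet> a" "B t = b \<bullet> b" "C t = c \<bullet> c" "g t = a \<bullet> b" "k t = a \<bullet> c" "e t = b \<bullet> c"
    and D: "(A has_real_derivative A') (at t)" "(B has_real_derivative B') (at t)" "(C has_real_derivative C') (at t)"
      "(g has_real_derivative g') (at t)" "(k has_real_derivative k') (at t)" "(e has_real_derivative e') (at t)"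
  defines "h \<equiv> b \<bullet> c - (a \<bullet> b) * (a \<bullet> c) / (a \<bullet> a)"
    and "Y \<equiv> b \<bullet> b - (a \<bullet> b)\<^sup>2 / (a \<bullet> a)" and "Z \<equiv> c \<bullet> c - (a \<bullet> c)\<^sup>2 / (a \<bullet> a)"
  shows "((\<lambda>t. gram_angle (A t) (B t) (C t) (g t) (k t) (e t)) has_real_derivative
     - (norm a / \<bar>trip a b c\<bar>) *
      ((e' - (g' * (a \<bullet> c) + (a \<bullet> b) * k') / (a \<bullet> a) + (a \<bullet> b) * (a \<bullet> c) * A' / (a \<bullet> a)\<^sup>2)
        - h * ((B' - 2 * (a \<bullet> b) * g' / (a \<bullet> a) + (a \<bullet> b)\<^sup>2 * A' / (a \<bullet> a)\<^sup>2) / (2 * Y)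
             + (C' - 2 * (a \<bullet> c) * k' / (a \<bullet> a) + (a \<bullet> c)\<^sup>2 * A' / (a \<bullet> a)\<^sup>2) / (2 * Z)))) (at t)"
proof -
  have a0: "a \<noteq> 0" using tr by auto
  then have nz: "a \<bullet> a > 0" by simp
  have Ypos: "Y > 0"
  proof -
    have "(a \<bullet> a) * Y = (a \<times> b) \<bullet> (a \<times> b)"
      using nz by (simp add: Y_def dot_cross power2_eq_square inner_commute field_simps)
    also have "\<dots> > 0" using trip_neq_0_imp_cross_neq_0[OF tr] by simp
    finally show ?thesis using nz by (simp add: zero_less_mult_iff)
  qed
  have Zpos: "Z > 0"
  proof -
    have "(a \<bullet> a) * Z = (a \<times> c) \<bullet> (a \<times> c)"
      using nz by (simp add: Z_def dot_cross power2_eq_square inner_commute field_simps)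
    also have "\<dots> > 0" using trip_neq_0_imp_cross_neq_0[OF tr] by simp
    finally show ?thesis using nz by (simp add: zero_less_mult_iff)
  qed
  have det: "(a \<bullet> a) * (Y * Z - h\<^sup>2) = (trip a b c)\<^sup>2" unfolding Y_def Z_def h_def by (rule gram_det[OF a0])
  have "(a \<bullet> a) * (Y * Z - h\<^sup>2) > 0" unfolding det using tr by simp
  then have hYZ: "h\<^sup>2 < Y * Z" using nz by (simp add: zero_less_mult_iff)
  \<comment> \<open>This turns the root in the derivative of \<open>arccos\<close> into
    \<open>\<bar>trip a b c\<bar> / norm a\<close>, the source of the prefactor.\<close>
  have "Y * Z - h\<^sup>2 = (trip a b c)\<^sup>2 / (norm a)\<^sup>2"
    using det nz by (simp add: power2_norm_eq_inner field_simps)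
  then have root: "sqrt (Y * Z - h\<^sup>2) = \<bar>trip a b c\<bar> / norm a"
    by (simp add: real_sqrt_divide)
  have "((\<lambda>t. arccos ((e t - g t * k t / A t) / (sqrt (B t - (g t)\<^sup>2 / A t) * sqrt (C t - (k t)\<^sup>2 / A t)))) has_real_derivative
    - ((e' - (g' * (a \<bullet> c) + (a \<bullet> b) * k') / (a \<bullet> a) + (a \<bullet> b) * (a \<bullet> c) * A' / (a \<bullet> a)\<^sup>2)
       - (e t - g t * k t / A t) * ((B' - 2 * (a \<bullet> b) * g' / (a \<bullet> a) + (a \<bullet> b)\<^sup>2 * A' / (a \<bullet> a)\<^sup>2) / (2 * (B t - (g t)\<^sup>2 / A t))
             + (C' - 2 * (a \<bullet> c) * k' / (a \<bullet> a) + (a \<bullet> c)\<^sup>2 * A' / (a \<bullet> a)\<^sup>2) / (2 * (C t - (k t)\<^sup>2 / A t))))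
     / sqrt ((B t - (g t)\<^sup>2 / A t) * (C t - (k t)\<^sup>2 / A t) - (e t - g t * k t / A t)\<^sup>2)) (at t)"
  proof (rule arccos_quotient_deriv)
    have split: "(x * (a \<bullet> a) - y) / ((a \<bullet> a) * (a \<bullet> a)) = x / (a \<bullet> a) - y / (a \<bullet> a)\<^sup>2" for x y
      using nz by (simp add: diff_divide_distrib power2_eq_square)
    have "((\<lambda>t. e t - g t * k t / A t) has_real_derivative
       e' - ((g' * k t + k' * g t) * A t - g t * k t * A') / (A t * A t)) (at t)"
      by (intro DERIV_diff DERIV_divide DERIV_mult D) (use nz vals in auto)
    then show "((\<lambda>t. e t - g t * k t / A t) has_real_derivative
       e' - (g' * (a \<bullet> c) + (a \<bullet> b) * k') / (a \<bullet> a) + (a \<bullet> b) * (a \<bullet> c) * A' / (a \<bullet> a)\<^sup>2) (at t)"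
      unfolding vals split by (simp add: mult.commute diff_diff_eq2 diff_add_eq)
    have "((\<lambda>t. B t - g t * g t / A t) has_real_derivative
       B' - ((g' * g t + g' * g t) * A t - g t * g t * A') / (A t * A t)) (at t)"
      by (intro DERIV_diff DERIV_divide DERIV_mult D) (use nz vals in auto)
    then show "((\<lambda>t. B t - (g t)\<^sup>2 / A t) has_real_derivative
       B' - 2 * (a \<bullet> b) * g' / (a \<bullet> a) + (a \<bullet> b)\<^sup>2 * A' / (a \<bullet> a)\<^sup>2) (at t)"
      unfolding vals split by (simp add: power2_eq_square mult_ac diff_diff_eq2 diff_add_eq)
    have "((\<lambda>t. C t - k t * k t / A t) has_real_derivative
       C' - ((k' * k t + k' * k t) * A t - k t * k t * A') / (A t * A t)) (at t)"
      by (intro DERIV_diff DERIV_divide DERIV_mult D) (use nz vals in auto)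
    then show "((\<lambda>t. C t - (k t)\<^sup>2 / A t) has_real_derivative
       C' - 2 * (a \<bullet> c) * k' / (a \<bullet> a) + (a \<bullet> c)\<^sup>2 * A' / (a \<bullet> a)\<^sup>2) (at t)"
      unfolding vals split by (simp add: power2_eq_square mult_ac diff_diff_eq2 diff_add_eq)
    show "B t - (g t)\<^sup>2 / A t > 0" "C t - (k t)\<^sup>2 / A t > 0"
      "(e t - g t * k t / A t)\<^sup>2 < (B t - (g t)\<^sup>2 / A t) * (C t - (k t)\<^sup>2 / A t)"
      using Ypos Zpos hYZ unfolding vals Y_def Z_def h_def by auto
  qed
  moreover have quot: "- x / (T / n) = - (n / T) * x" for x T n :: real by simp
  ultimately show ?thesis
    unfolding gram_angle_def vals Y_def[symmetric] Z_def[symmetric] h_def[symmetric] root quot by -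
qed

section \<open>Changing the length of one edge of a tetrahedron\<close>

lemma diameter_closed_segment: "diameter (closed_segment a b) = dist a b" for a b :: "'a::euclidean_space"
proof (rule antisym)
  show "diameter (closed_segment a b) \<le> dist a b"
  proof (rule diameter_le)
    fix x y assume "x \<in> closed_segment a b" "y \<in> closed_segment a b"
    then obtain u v where u: "0 \<le> u" "u \<le> 1" "x = (1 - u) *\<^sub>R a + u *\<^sub>R b" and v: "0 \<le> v" "v \<le> 1" "y = (1 - v) *\<^sub>R a + v *\<^sub>R b"
      by (auto simp: in_segment)
    have "x - y = (u - v) *\<^sub>R (b - a)" unfolding u(3) v(3) by (simp add: algebra_simps)
    then have "norm (x - y) = \<bar>u - v\<bar> * dist a b" by (simp add: dist_norm norm_minus_commute)
    also have "\<dots> \<le> 1 * dist a b" using u v by (intro mult_right_mono) auto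
    finally show "norm (x - y) \<le> dist a b" by simp
  qed simp
  show "dist a b \<le> diameter (closed_segment a b)"
    by (rule diameter_bounded_bound) (simp_all add: compact_imp_bounded)
qed

text \<open>The deformed angle is a definite description, so it has to be backed by an actual
  tetrahedron for all nearby lengths. Only the end of the varied edge moves.\<close>

lemma eventually_realizable:
  assumes tr: "trip a b c \<noteq> 0"
  shows "\<forall>\<^sub>F t in nhds (norm a). t > 0 \<and> (\<exists>w. norm w = t \<and> norm (w - b) = norm (a - b) \<and> norm (w - c) = norm (a - c))"
proof -
  define k where "k = b \<times> c"
  have k0: "k \<bullet> k > 0" using trip_neq_0_imp_cross_neq_0[OF tr] by (simp add: k_def)
  \<comment> \<open>The vector in the plane of \<open>b\<close> and \<open>c\<close> with inner
    product 1 with both. Keeping the distances to \<open>b\<close> and \<open>c\<close> while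
    \<open>norm w = t\<close> raises both inner products by \<open>\<tau> t\<close>, so
    \<open>w\<close> is \<open>a + \<tau> t *\<^sub>R m\<close> up to a multiple of
    \<open>k\<close>.\<close>
  define m where "m = ((c \<bullet> c - b \<bullet> c) / (k \<bullet> k)) *\<^sub>R b + ((b \<bullet> b - b \<bullet> c) / (k \<bullet> k)) *\<^sub>R c"
  have kk: "k \<bullet> k = (b \<bullet> b) * (c \<bullet> c) - (b \<bullet> c) * (b \<bullet> c)" by (simp add: k_def dot_cross inner_commute)
  have kb: "k \<bullet> b = 0" "k \<bullet> c = 0" by (simp_all add: k_def dot_cross_self cross_dot_trip)
  have mk: "m \<bullet> k = 0" by (simp add: m_def inner_add_left inner_commute[of b k] inner_commute[of c k] kb)
  have "m \<bullet> b = ((c \<bullet> c - b \<bullet> c) * (b \<bullet> b) + (b \<bullet> b - b \<bullet> c) * (b \<bullet> c)) / (k \<bullet> k)"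
    by (simp add: m_def inner_add_left add_divide_distrib inner_commute[of c b])
  also have "(c \<bullet> c - b \<bullet> c) * (b \<bullet> b) + (b \<bullet> b - b \<bullet> c) * (b \<bullet> c) = k \<bullet> k"
    unfolding kk by (simp add: algebra_simps)
  finally have mb: "m \<bullet> b = 1" using k0 by simp
  have "m \<bullet> c = ((c \<bullet> c - b \<bullet> c) * (b \<bullet> c) + (b \<bullet> b - b \<bullet> c) * (c \<bullet> c)) / (k \<bullet> k)"
    by (simp add: m_def inner_add_left add_divide_distrib)
  also have "(c \<bullet> c - b \<bullet> c) * (b \<bullet> c) + (b \<bullet> b - b \<bullet> c) * (c \<bullet> c) = k \<bullet> k"
    unfolding kk by (simp add: algebra_simps)
  finally have mc: "m \<bullet> c = 1" using k0 by simp
  define \<tau> where "\<tau> = (\<lambda>t. (t\<^sup>2 - (norm a)\<^sup>2) / 2)"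
  define r where "r = (\<lambda>t. (\<tau> t)\<^sup>2 * (m \<bullet> m) + 2 * \<tau> t * (a \<bullet> m) - 2 * \<tau> t)"
  \<comment> \<open>A quarter of the discriminant of the quadratic equation for that multiple; at
    \<open>norm a\<close> it is \<open>(a \<bullet> k)^2\<close>, which is positive by
    nondegeneracy.\<close>
  define D where "D = (\<lambda>t. (a \<bullet> k)\<^sup>2 - (k \<bullet> k) * r t)"
  have ak: "a \<bullet> k \<noteq> 0" using tr by (simp add: trip_def k_def)
  have "\<forall>\<^sub>F t in nhds (norm a). D t > 0"
  proof (rule order_tendstoD)
    have "isCont D (norm a)" unfolding D_def r_def \<tau>_def by (intro continuous_intros) auto
    then show "(D \<longlongrightarrow> D (norm a)) (nhds (norm a))" by (simp add: isCont_def tendsto_at_iff_tendsto_nhds)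
    show "0 < D (norm a)" using ak by (simp add: D_def r_def \<tau>_def)
  qed
  moreover have "\<forall>\<^sub>F t in nhds (norm a). t > 0"
    using tr by (intro order_tendstoD(1)[OF filterlim_ident]) auto
  ultimately show ?thesis
  proof eventually_elim
    case (elim t)
    \<comment> \<open>If \<open>a \<bullet> k\<close> is negative, this root gives a point near the
      mirror image of \<open>a\<close>; only the distances matter.\<close>
    define \<sigma> where "\<sigma> = (sqrt (D t) - a \<bullet> k) / (k \<bullet> k)"
    define w where "w = a + \<tau> t *\<^sub>R m + \<sigma> *\<^sub>R k"
    have "(k \<bullet> k) * \<sigma> + a \<bullet> k = sqrt (D t)" using k0 by (simp add: \<sigma>_def)
    then have "((k \<bullet> k) * \<sigma> + a \<bullet> k)\<^sup>2 = D t" using elim by simp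
    then have "(k \<bullet> k) * ((k \<bullet> k) * \<sigma>\<^sup>2 + 2 * \<sigma> * (a \<bullet> k) + r t) = 0"
      by (simp add: D_def power2_eq_square algebra_simps)
    then have quad: "(k \<bullet> k) * \<sigma>\<^sup>2 + 2 * \<sigma> * (a \<bullet> k) + r t = 0" using k0 by simp
    have "w \<bullet> w = a \<bullet> a + 2 * \<tau> t + ((k \<bullet> k) * \<sigma>\<^sup>2 + 2 * \<sigma> * (a \<bullet> k) + r t)"
      unfolding r_def w_def
      by (simp add: inner_add_left inner_add_right mk inner_commute[of k m] inner_commute[of m a] inner_commute[of k a]
          power2_eq_square algebra_simps)
    then have ww: "w \<bullet> w = t\<^sup>2" unfolding quad by (simp add: \<tau>_def power2_norm_eq_inner field_simps)
    have wb: "w \<bullet> b = a \<bullet> b + \<tau> t" "w \<bullet> c = a \<bullet> c + \<tau> t"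
      by (simp_all add: w_def inner_add_left kb mb mc)
    have "norm w = t" using ww elim by (simp add: norm_eq_sqrt_inner)
    moreover have "(w - b) \<bullet> (w - b) = (a - b) \<bullet> (a - b)" "(w - c) \<bullet> (w - c) = (a - c) \<bullet> (a - c)"
      by (simp_all add: inner_diff_left inner_diff_right inner_commute[of b w] inner_commute[of c w]
           inner_commute[of b a] inner_commute[of c a] ww wb \<tau>_def power2_norm_eq_inner field_simps)
    ultimately show ?case using elim by (auto simp: norm_eq_sqrt_inner)
  qed
qed

lemma realizes_lengths_move:
  assumes tr: "trip a b c \<noteq> 0" and S: "{x. x extreme_point_of S} = {p, p + a, p + b, p + c}"
    and w: "norm w = t" "norm (w - b) = norm (a - b)" "norm (w - c) = norm (a - c)"
  shows "realizes_lengths (diameter(closed_segment p (p + a) := t)) S (id(p + a := p + w))"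
  unfolding realizes_lengths_def
proof (intro allI impI)
  fix x y assume xy: "x extreme_point_of S \<and> y extreme_point_of S \<and> x \<noteq> y"
  have ne: "a \<noteq> b" "a \<noteq> c" "b \<noteq> c" "a \<noteq> 0" "b \<noteq> 0" "c \<noteq> 0" using tr by auto
  have "x \<in> {p, p + a, p + b, p + c}" "y \<in> {p, p + a, p + b, p + c}" using xy S by blast+
  then show "dist ((id(p + a := p + w)) x) ((id(p + a := p + w)) y) =
     (diameter(closed_segment p (p + a) := t)) (closed_segment x y)"
    using xy ne w by (auto simp: diameter_closed_segment dist_norm doubleton_eq_iff norm_minus_commute)
qed

section \<open>Angle derivatives in terms of weights\<close>

lemma inner_eq_norms: "x \<bullet> y = (x \<bullet> x + y \<bullet> y - (norm (x - y))\<^sup>2) / 2"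
  by (simp add: power2_norm_eq_inner inner_diff_left inner_diff_right inner_commute)

lemma cross_inner_area_vector:
  "(a \<times> b) \<bullet> area_vector a b c =
    (a \<bullet> a) * (b \<bullet> b) - (a \<bullet> b)\<^sup>2 - (a \<bullet> c) * (b \<bullet> b) - (b \<bullet> c) * (a \<bullet> a) + ((b \<bullet> c) + (a \<bullet> c)) * (a \<bullet> b)"
  by (simp add: area_vector_def inner_add_right dot_cross power2_eq_square inner_commute algebra_simps)

lemma cross_inner_self: "(a \<times> b) \<bullet> (a \<times> b) = (a \<bullet> a) * (b \<bullet> b) - (a \<bullet> b)\<^sup>2"
  by (simp add: dot_cross power2_eq_square inner_commute)

text \<open>With the Gram entries of \<open>a\<close>, \<open>b\<close>, \<open>c\<close> inserted,
  the left side is the quotient of \<open>(a \<times> b) \<bullet> area_vector a b c\<close> by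
  \<open>(a \<times> b) \<bullet> (a \<times> b)\<close>, that is, \<open>wt a b c\<close> times
  \<open>trip a b c\<close>.\<close>

lemma wing_quotient:
  fixes A B g k e :: real
  assumes "A \<noteq> 0" "K \<noteq> 0" and K: "K = A * B - g\<^sup>2"
  shows "(A * B - g\<^sup>2 - k * B - e * A + (e + k) * g) / K = (A - k) / A - (e * A - g * k) * (A - g) / (A * K)"
proof -
  have "(A - k) / A - (e * A - g * k) * (A - g) / (A * K) = ((A - k) * K - (e * A - g * k) * (A - g)) / (A * K)"
    using assms(1,2) by (simp add: field_simps)
  also have "(A - k) * K - (e * A - g * k) * (A - g) = A * (A * B - g\<^sup>2 - k * B - e * A + (e + k) * g)"
    unfolding K by algebra
  finally show ?thesis using assms(1) by simp
qed

text \<open>The bracket of \<open>gram_angle_deriv\<close> when only \<open>norm b\<close> varies: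
  with \<beta> its value, \<open>B\<close> has derivative \<open>2 * \<beta>\<close>, and
  \<open>g\<close> and \<open>e\<close> have derivative \<beta>.\<close>

lemma wing_scalar:
  fixes A B g k e \<beta> :: real
  assumes A: "A \<noteq> 0" and K0: "K \<noteq> 0" and K: "K = A * B - g\<^sup>2"
  shows "(\<beta> - \<beta> * k / A) - (e - g * k / A) * ((2 * \<beta> - 2 * g * \<beta> / A) / (2 * (B - g\<^sup>2 / A)))
    = \<beta> * ((A * B - g\<^sup>2 - k * B - e * A + (e + k) * g) / K)"
proof -
  have "B - g\<^sup>2 / A = K / A" unfolding K using A by (simp add: field_simps)
  then show ?thesis unfolding wing_quotient[OF assms] using A K0 by (simp add: field_simps)
qed

text \<open>The bracket of \<open>gram_angle_deriv\<close> when only \<open>norm a\<close> varies: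
  with \<open>t\<close> its value, \<open>A\<close> has derivative \<open>2 * t\<close>, and
  \<open>g\<close> and \<open>k\<close> have derivative \<open>t\<close>. It splits into one term
  for each facet at the edge.\<close>

lemma own_scalar:
  fixes A B C g k e t :: real
  assumes A: "A \<noteq> 0" and K0: "K \<noteq> 0" "L \<noteq> 0" and K: "K = A * B - g\<^sup>2" and L: "L = A * C - k\<^sup>2"
  shows "(0 - (t * k + g * t) / A + g * k * (2 * t) / A\<^sup>2)
      - (e - g * k / A) * ((0 - 2 * g * t / A + g\<^sup>2 * (2 * t) / A\<^sup>2) / (2 * (B - g\<^sup>2 / A))
        + (0 - 2 * k * t / A + k\<^sup>2 * (2 * t) / A\<^sup>2) / (2 * (C - k\<^sup>2 / A)))
    = - (t / A) * (g * ((A * B - g\<^sup>2 - k * B - e * A + (e + k) * g) / K)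
        + k * ((A * C - k\<^sup>2 - g * C - e * A + (e + g) * k) / L))"
proof -
  have KL: "B - g\<^sup>2 / A = K / A" "C - k\<^sup>2 / A = L / A" unfolding K L using A by (simp_all add: field_simps)
  have quot: "(0 - 2 * g * t / A + g\<^sup>2 * (2 * t) / A\<^sup>2) / (2 * (K / A)) = - (t * g * (A - g) / (A * K))"
    "(0 - 2 * k * t / A + k\<^sup>2 * (2 * t) / A\<^sup>2) / (2 * (L / A)) = - (t * k * (A - k) / (A * L))"
    using A K0 by (simp_all add: field_simps power2_eq_square)
  have lead: "0 - (t * k + g * t) / A + g * k * (2 * t) / A\<^sup>2 = - (t / A) * (g * ((A - k) / A) + k * ((A - g) / A))"
    using A by (simp add: field_simps power2_eq_square)
  have h: "e - g * k / A = (e * A - g * k) / A" using A by (simp add: field_simps)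
  have "- (t / A) * (g * x + k * y) - (r / A) * (- (t * g * u / (A * K)) + - (t * k * v / (A * L)))
    = - (t / A) * (g * (x - r * u / (A * K)) + k * (y - r * v / (A * L)))" for x y r u v
    by (simp add: divide_inverse algebra_simps)
  then show ?thesis
    unfolding KL quot lead h wing_quotient[OF A K0(1) K] wing_quotient[OF A K0(2) L]
    by (simp only: mult.commute[of k g])
qed

context
  fixes p a b c :: "real^3" and S :: "(real^3) set"
  assumes tr: "trip a b c \<noteq> 0" and S: "{x. x extreme_point_of S} = {p, p + a, p + b, p + c}"
begin

lemma distinct_vertices: "distinct [p, p + a, p + b, p + c]"
  using tr by auto

text \<open>Near \<open>norm a\<close> the deformed angle agrees with \<open>?G\<close>, in which
  the inner products with the moving vertex are expressed by the law of cosines.\<close>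

lemma angle_deriv_own:
  "((\<lambda>t. deformed_dihedral_angle (diameter(closed_segment p (p + a) := t)) S (closed_segment p (p + a)))
    has_real_derivative
      ((a \<bullet> b) * ((a \<times> b) \<bullet> area_vector a b c / ((a \<times> b) \<bullet> (a \<times> b)))
       + (a \<bullet> c) * ((a \<times> c) \<bullet> area_vector a c b / ((a \<times> c) \<bullet> (a \<times> c)))) / \<bar>trip a b c\<bar>) (at (norm a))"
    (is "(_ has_real_derivative ?R) _")
proof -
  let ?f = "closed_segment p (p + a)"
  let ?G = "\<lambda>t. gram_angle (t\<^sup>2) (b \<bullet> b) (c \<bullet> c) ((t\<^sup>2 + b \<bullet> b - (norm (a - b))\<^sup>2) / 2)
      ((t\<^sup>2 + c \<bullet> c - (norm (a - c))\<^sup>2) / 2) (b \<bullet> c)"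
  have e: "{x. x extreme_point_of ?f} = {p, p + a}"
    by (auto simp: extreme_point_of_segment)
  have ne: "a \<noteq> b" "a \<noteq> c" "a \<noteq> 0" using tr by auto
  have ev: "\<forall>\<^sub>F t in nhds (norm a). deformed_dihedral_angle (diameter(?f := t)) S ?f = ?G t"
    using eventually_realizable[OF tr]
  proof eventually_elim
    case (elim t)
    then obtain w where w: "norm w = t" "norm (w - b) = norm (a - b)" "norm (w - c) = norm (a - c)" by blast
    let ?\<phi> = "id(p + a := p + w)"
    have "deformed_dihedral_angle (diameter(?f := t)) S ?f
      = dihedral_angle (?\<phi> p) (?\<phi> (p + a)) (?\<phi> (p + b)) (?\<phi> (p + c))"
      by (rule deformed_dihedral_angle_eq[OF realizes_lengths_move[OF tr S w] S e distinct_vertices])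
    also have "\<dots> = dihedral_angle p (p + w) (p + b) (p + c)" using ne by simp
    also have "\<dots> = gram_angle (w \<bullet> w) (b \<bullet> b) (c \<bullet> c) (w \<bullet> b) (w \<bullet> c) (b \<bullet> c)"
      by (simp add: dihedral_angle_gram)
    also have "\<dots> = ?G t"
      using w by (simp only: inner_eq_norms[of w b] inner_eq_norms[of w c] power2_norm_eq_inner[of w, symmetric])
    finally show ?case .
  qed
  have A: "a \<bullet> a \<noteq> 0" using ne by simp
  have K: "(a \<times> b) \<bullet> (a \<times> b) \<noteq> 0" "(a \<times> c) \<bullet> (a \<times> c) \<noteq> 0"
    using trip_neq_0_imp_cross_neq_0[OF tr] by simp_all
  have "(?G has_real_derivative
     - (norm a / \<bar>trip a b c\<bar>) *
      ((0 - (norm a * (a \<bullet> c) + (a \<bullet> b) * norm a) / (a \<bullet> a) + (a \<bullet> b) * (a \<bullet> c) * (2 * norm a) / (a \<bullet> a)\<^sup>2)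
        - (b \<bullet> c - (a \<bullet> b) * (a \<bullet> c) / (a \<bullet> a)) * ((0 - 2 * (a \<bullet> b) * norm a / (a \<bullet> a) + (a \<bullet> b)\<^sup>2 * (2 * norm a) / (a \<bullet> a)\<^sup>2) / (2 * (b \<bullet> b - (a \<bullet> b)\<^sup>2 / (a \<bullet> a)))
             + (0 - 2 * (a \<bullet> c) * norm a / (a \<bullet> a) + (a \<bullet> c)\<^sup>2 * (2 * norm a) / (a \<bullet> a)\<^sup>2) / (2 * (c \<bullet> c - (a \<bullet> c)\<^sup>2 / (a \<bullet> a)))))) (at (norm a))"
    (is "(_ has_real_derivative ?D) _")
  proof (rule gram_angle_deriv[OF tr])
    show "(norm a)\<^sup>2 = a \<bullet> a" by (rule power2_norm_eq_inner)
    show "((norm a)\<^sup>2 + b \<bullet> b - (norm (a - b))\<^sup>2) / 2 = a \<bullet> b" "((norm a)\<^sup>2 + c \<bullet> c - (norm (a - c))\<^sup>2) / 2 = a \<bullet> c"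
      by (simp_all add: power2_norm_eq_inner inner_diff_left inner_diff_right inner_commute)
  qed (auto intro!: derivative_eq_intros)
  also have "?D = - (norm a / \<bar>trip a b c\<bar>) * (- (norm a / (a \<bullet> a)) *
     ((a \<bullet> b) * ((a \<times> b) \<bullet> area_vector a b c / ((a \<times> b) \<bullet> (a \<times> b)))
       + (a \<bullet> c) * ((a \<times> c) \<bullet> area_vector a c b / ((a \<times> c) \<bullet> (a \<times> c)))))"
    by (simp only: own_scalar[OF A K cross_inner_self cross_inner_self, of "norm a" "b \<bullet> c"]
        cross_inner_area_vector inner_commute[of c b])
  also have "\<dots> = ?R"
  proof -
    have "norm a * norm a = a \<bullet> a" by (simp add: power2_norm_eq_inner flip: power2_eq_square)
    moreover have "- (n / T) * (- (n / (a \<bullet> a)) * x) = (n * n) / (a \<bullet> a) * x / T" for n T x :: real by (simp add: mult_ac)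
    ultimately show ?thesis using A by simp
  qed
  finally show ?thesis
    by (subst DERIV_cong_ev[OF refl ev refl])
qed

text \<open>The edge carrying the angle stays fixed and the far end of the wing moves. The
  derivative is invariant under exchanging \<open>a\<close> and \<open>b\<close>; this is the source
  of the symmetry of the matrix.\<close>

lemma angle_deriv_wing:
  "((\<lambda>t. deformed_dihedral_angle (diameter(closed_segment p (p + b) := t)) S (closed_segment p (p + a)))
    has_real_derivative
      - (norm a * norm b * ((a \<times> b) \<bullet> area_vector a b c / ((a \<times> b) \<bullet> (a \<times> b)))) / \<bar>trip a b c\<bar>) (at (norm b))"
    (is "(_ has_real_derivative ?R) _")
proof -
  let ?f = "closed_segment p (p + b)"
  let ?G = "\<lambda>t. gram_angle (a \<bullet> a) (t\<^sup>2) (c \<bullet> c) ((a \<bullet> a + t\<^sup>2 - (norm (a - b))\<^sup>2) / 2) (a \<bullet> c)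
      ((t\<^sup>2 + c \<bullet> c - (norm (b - c))\<^sup>2) / 2)"
  have tr': "trip b a c \<noteq> 0" using tr trip_swap[of b a c] by simp
  have S': "{x. x extreme_point_of S} = {p, p + b, p + a, p + c}" using S by auto
  have e: "{x. x extreme_point_of closed_segment p (p + a)} = {p, p + a}"
    by (auto simp: extreme_point_of_segment)
  have ne: "a \<noteq> b" "b \<noteq> c" "b \<noteq> 0" "a \<noteq> 0" using tr by auto
  have ev: "\<forall>\<^sub>F t in nhds (norm b). deformed_dihedral_angle (diameter(?f := t)) S (closed_segment p (p + a)) = ?G t"
    using eventually_realizable[OF tr']
  proof eventually_elim
    case (elim t)
    then obtain w where w: "norm w = t" "norm (w - a) = norm (b - a)" "norm (w - c) = norm (b - c)" by blast
    have w2: "norm (a - w) = norm (a - b)" using w(2) by (simp add: norm_minus_commute)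
    let ?\<phi> = "id(p + b := p + w)"
    have "deformed_dihedral_angle (diameter(?f := t)) S (closed_segment p (p + a))
      = dihedral_angle (?\<phi> p) (?\<phi> (p + a)) (?\<phi> (p + b)) (?\<phi> (p + c))"
      by (rule deformed_dihedral_angle_eq[OF realizes_lengths_move[OF tr' S' w] S e distinct_vertices])
    also have "\<dots> = dihedral_angle p (p + a) (p + w) (p + c)" using ne by simp
    also have "\<dots> = gram_angle (a \<bullet> a) (w \<bullet> w) (c \<bullet> c) (a \<bullet> w) (a \<bullet> c) (w \<bullet> c)"
      by (simp add: dihedral_angle_gram)
    also have "\<dots> = ?G t"
      using w w2 by (simp only: inner_eq_norms[of a w] inner_eq_norms[of w c] power2_norm_eq_inner[of w, symmetric])
    finally show ?case .
  qed
  have A: "a \<bullet> a \<noteq> 0" using ne by simp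
  have K: "(a \<times> b) \<bullet> (a \<times> b) \<noteq> 0"
    using trip_neq_0_imp_cross_neq_0[OF tr] by simp
  have "(?G has_real_derivative
     - (norm a / \<bar>trip a b c\<bar>) *
      ((norm b - (norm b * (a \<bullet> c) + (a \<bullet> b) * 0) / (a \<bullet> a) + (a \<bullet> b) * (a \<bullet> c) * 0 / (a \<bullet> a)\<^sup>2)
        - (b \<bullet> c - (a \<bullet> b) * (a \<bullet> c) / (a \<bullet> a)) * ((2 * norm b - 2 * (a \<bullet> b) * norm b / (a \<bullet> a) + (a \<bullet> b)\<^sup>2 * 0 / (a \<bullet> a)\<^sup>2) / (2 * (b \<bullet> b - (a \<bullet> b)\<^sup>2 / (a \<bullet> a)))
             + (0 - 2 * (a \<bullet> c) * 0 / (a \<bullet> a) + (a \<bullet> c)\<^sup>2 * 0 / (a \<bullet> a)\<^sup>2) / (2 * (c \<bullet> c - (a \<bullet> c)\<^sup>2 / (a \<bullet> a)))))) (at (norm b))"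
    (is "(_ has_real_derivative ?D) _")
  proof (rule gram_angle_deriv[OF tr])
    show "(norm b)\<^sup>2 = b \<bullet> b" by (rule power2_norm_eq_inner)
    show "(a \<bullet> a + (norm b)\<^sup>2 - (norm (a - b))\<^sup>2) / 2 = a \<bullet> b" "((norm b)\<^sup>2 + c \<bullet> c - (norm (b - c))\<^sup>2) / 2 = b \<bullet> c"
      by (simp_all add: power2_norm_eq_inner inner_diff_left inner_diff_right inner_commute)
  qed (auto intro!: derivative_eq_intros)
  also have "?D = - (norm a / \<bar>trip a b c\<bar>) * (norm b * ((a \<times> b) \<bullet> area_vector a b c / ((a \<times> b) \<bullet> (a \<times> b))))"
    using wing_scalar[OF A K cross_inner_self, of "norm b" "a \<bullet> c" "b \<bullet> c"]
    unfolding cross_inner_area_vector by simp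
  also have "\<dots> = ?R" by (simp add: mult_ac)
  finally show ?thesis
    by (subst DERIV_cong_ev[OF refl ev refl])
qed

end

section \<open>Positive definiteness\<close>

context star_polyhedron
begin

lemma finite_I: "finite I"
  using I_subset_V finite_V by (rule finite_subset)

lemma zero_notin_I: "0 \<notin> I"
  using I_subset_V by (auto simp: V_def)

lemma seg_eq_iff: "seg i = seg j \<longleftrightarrow> i = j"
  by (auto simp: doubleton_eq_iff)

lemma inj_on_seg: "inj_on seg A"
  by (auto simp: inj_on_def seg_eq_iff simp del: closed_segment_eq)

lemma edge_lengths_upd:
  assumes "j \<in> I"
  shows "edge_lengths \<K> \<T> (diameter(seg j := t)) = diameter(seg j := t)"
  using assms by (auto simp: edge_lengths_def I_def fun_eq_iff)

definition Dangle :: "(real^3) set \<Rightarrow> real^3 \<Rightarrow> real^3 \<Rightarrow> real"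
  where "Dangle S i j = deriv (\<lambda>t. deformed_dihedral_angle (diameter(seg j := t)) S (seg i)) (norm j)"

lemma tetra_wt:
  assumes "tetra p S a b c"
  shows "(a \<times> b) \<bullet> area_vector a b c / ((a \<times> b) \<bullet> (a \<times> b)) / \<bar>trip a b c\<bar> = wt a b c"
    "(a \<times> c) \<bullet> area_vector a c b / ((a \<times> c) \<bullet> (a \<times> c)) / \<bar>trip a b c\<bar> = wt c a b"
proof -
  have pos: "trip a b c > 0" using assms by (simp add: tetra_def)
  show "(a \<times> b) \<bullet> area_vector a b c / ((a \<times> b) \<bullet> (a \<times> b)) / \<bar>trip a b c\<bar> = wt a b c"
    using pos by (simp add: wt_def)
  have "wt c a b = - wt a c b" by (rule wt_swap)
  moreover have "trip a c b = - trip a b c" by (rule trip_swap')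
  ultimately show "(a \<times> c) \<bullet> area_vector a c b / ((a \<times> c) \<bullet> (a \<times> c)) / \<bar>trip a b c\<bar> = wt c a b"
    using pos by (simp add: wt_def)
qed

lemma angle_derivs:
  assumes t: "tetra p S a b c"
  shows angle_deriv_same: "((\<lambda>t. deformed_dihedral_angle (diameter(seg a := t)) S (seg a)) has_real_derivative
      (a \<bullet> b) * wt a b c + (a \<bullet> c) * wt c a b) (at (norm a))"
    and angle_deriv_next: "((\<lambda>t. deformed_dihedral_angle (diameter(seg b := t)) S (seg a)) has_real_derivative
      - (norm a * norm b * wt a b c)) (at (norm b))"
    and angle_deriv_prev: "((\<lambda>t. deformed_dihedral_angle (diameter(seg c := t)) S (seg a)) has_real_derivative
      - (norm a * norm c * wt c a b)) (at (norm c))"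
proof -
  note E = tetra_extreme_points[OF t] and T = tetra_trip_neq_0[OF t]
  have E': "{x. x extreme_point_of S} = {p, p + a, p + c, p + b}" unfolding E by (simp add: insert_commute)
  have T': "trip a c b \<noteq> 0" and abs: "\<bar>trip a c b\<bar> = \<bar>trip a b c\<bar>" using T trip_swap'[of a c b] by simp_all
  have q: "(x * y + z * w) / \<bar>trip a b c\<bar> = x * (y / \<bar>trip a b c\<bar>) + z * (w / \<bar>trip a b c\<bar>)"
    "- (x * y) / \<bar>trip a b c\<bar> = - (x * (y / \<bar>trip a b c\<bar>))" for x y z w :: real
    by (simp_all add: add_divide_distrib)
  show "((\<lambda>t. deformed_dihedral_angle (diameter(seg a := t)) S (seg a)) has_real_derivative
      (a \<bullet> b) * wt a b c + (a \<bullet> c) * wt c a b) (at (norm a))"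
    using angle_deriv_own[OF T E] unfolding q tetra_wt[OF t] .
  show "((\<lambda>t. deformed_dihedral_angle (diameter(seg b := t)) S (seg a)) has_real_derivative
      - (norm a * norm b * wt a b c)) (at (norm b))"
    using angle_deriv_wing[OF T E] unfolding q tetra_wt[OF t] .
  show "((\<lambda>t. deformed_dihedral_angle (diameter(seg c := t)) S (seg a)) has_real_derivative
      - (norm a * norm c * wt c a b)) (at (norm c))"
    using angle_deriv_wing[OF T' E'] unfolding abs q tetra_wt[OF t] .
qed

lemma Dangle_tetra:
  assumes t: "tetra p S a b c"
  shows "Dangle S a a = (a \<bullet> b) * wt a b c + (a \<bullet> c) * wt c a b"
    "Dangle S a b = - (norm a * norm b * wt a b c)" "Dangle S a c = - (norm a * norm c * wt c a b)"
  unfolding Dangle_def using angle_derivs[OF t] by (auto intro: DERIV_imp_deriv)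

text \<open>\<open>seg j\<close> is not an edge of \<open>S\<close>, so
  \<open>realizes_lengths\<close> never reads the changed value.\<close>

lemma angle_constant:
  assumes t: "tetra p S a b c" and j: "j \<notin> {a, b, c}" "j \<noteq> 0"
  shows "deformed_dihedral_angle (diameter(seg j := t)) S e = deformed_dihedral_angle diameter S e"
proof -
  have "closed_segment x y \<noteq> seg j" if "x extreme_point_of S" "y extreme_point_of S" for x y
  proof
    assume "closed_segment x y = seg j"
    then have "{x, y} = {p, p + j}" by simp
    moreover have "x \<in> {p, p + a, p + b, p + c}" "y \<in> {p, p + a, p + b, p + c}"
      using that tetra_extreme_points[OF t] by blast+
    ultimately have "p + j \<in> {p, p + a, p + b, p + c}" by (metis insertCI insertE singletonD)
    then show False using j by simp
  qed
  then have "realizes_lengths (diameter(seg j := t)) S = realizes_lengths diameter S"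
    unfolding realizes_lengths_def fun_eq_iff by auto
  then show ?thesis unfolding deformed_dihedral_angle_def by simp
qed

lemma angle_has_deriv:
  assumes S: "S \<in> \<T>" and i: "seg i edge_of S" and j: "j \<noteq> 0"
  shows "((\<lambda>t. deformed_dihedral_angle (diameter(seg j := t)) S (seg i)) has_real_derivative Dangle S i j) (at (norm j))"
proof -
  obtain a b c where t: "tetra p S a b c" using obtain_tetra S by blast
  have "i \<in> {a, b, c}" using i seg_edge_of_tetra[OF t] by blast
  moreover have "tetra p S b c a" using tetra_rotate[OF t] .
  moreover have "tetra p S c a b" using tetra_rotate[OF tetra_rotate[OF t]] .
  ultimately obtain b c where t: "tetra p S i b c" using t by auto
  show ?thesis
  proof (cases "j \<in> {i, b, c}")
    case True
    then show ?thesis using angle_derivs[OF t] Dangle_tetra[OF t] by auto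
  next
    case False
    show ?thesis unfolding Dangle_def angle_constant[OF t False j] by simp
  qed
qed

lemma total_angle_has_deriv:
  assumes i: "i \<in> I" and j: "j \<in> I"
  shows "((\<lambda>t. total_angle \<K> \<T> (seg i) (diameter(seg j := t))) has_real_derivative
    (\<Sum>S | S \<in> \<T> \<and> seg i edge_of S. Dangle S i j)) (at (diameter (seg j)))"
proof -
  have "j \<noteq> 0" using j zero_notin_I by blast
  moreover have "diameter (seg j) = norm j" by (simp add: diameter_closed_segment dist_norm)
  ultimately show ?thesis
    unfolding total_angle_def edge_lengths_upd[OF j] using angle_has_deriv by (auto intro!: DERIV_sum)
qed

lemma Lambda_eq:
  assumes "i \<in> I" "j \<in> I"
  shows "Lambda_matrix \<K> \<T> (seg i) (seg j) = (\<Sum>S | S \<in> \<T> \<and> seg i edge_of S. Dangle S i j)"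
  unfolding Lambda_matrix_def partial_deriv_def by (rule DERIV_imp_deriv[OF total_angle_has_deriv[OF assms]])

lemma Dangle_eq_0:
  assumes "tetra p S a b c" "j \<notin> {a, b, c}" "j \<noteq> 0"
  shows "Dangle S i j = 0"
  unfolding Dangle_def angle_constant[OF assms] by simp

lemma Dangle_commute:
  assumes t: "tetra p S a b c" and "i \<in> {a, b, c}" "j \<in> {a, b, c}"
  shows "Dangle S i j = Dangle S j i"
proof -
  note t' = tetra_rotate[OF t] and t'' = tetra_rotate[OF tetra_rotate[OF t]]
  show ?thesis
    using assms(2,3) Dangle_tetra[OF t] Dangle_tetra[OF t'] Dangle_tetra[OF t''] by (auto simp: mult.commute)
qed

text \<open>Only tetrahedra containing both edges contribute, and each of them contributes
  symmetrically.\<close>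

lemma Lambda_commute:
  assumes i: "i \<in> I" and j: "j \<in> I"
  shows "Lambda_matrix \<K> \<T> (seg i) (seg j) = Lambda_matrix \<K> \<T> (seg j) (seg i)"
proof -
  have ne: "i \<noteq> 0" "j \<noteq> 0" using i j zero_notin_I by blast+
  have "(\<Sum>S | S \<in> \<T> \<and> seg i edge_of S. Dangle S i j) = (\<Sum>S | S \<in> \<T> \<and> seg i edge_of S \<and> seg j edge_of S. Dangle S i j)"
    if "i \<noteq> 0" "j \<noteq> 0" for i j
  proof (rule sum.mono_neutral_right)
    show "\<forall>S\<in>{S \<in> \<T>. seg i edge_of S} - {S \<in> \<T>. seg i edge_of S \<and> seg j edge_of S}. Dangle S i j = 0"
    proof
      fix S assume S: "S \<in> {S \<in> \<T>. seg i edge_of S} - {S \<in> \<T>. seg i edge_of S \<and> seg j edge_of S}"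
      then obtain a b c where t: "tetra p S a b c" using obtain_tetra by blast
      then show "Dangle S i j = 0" using S seg_edge_of_tetra[OF t] Dangle_eq_0[OF t _ that(2)] by blast
    qed
  qed (use finite_T in auto)
  note * = this[OF ne] this[OF ne(2,1)]
  have "(\<Sum>S | S \<in> \<T> \<and> seg i edge_of S \<and> seg j edge_of S. Dangle S i j)
     = (\<Sum>S | S \<in> \<T> \<and> seg j edge_of S \<and> seg i edge_of S. Dangle S j i)"
  proof (rule sum.cong)
    fix S assume S: "S \<in> {S \<in> \<T>. seg j edge_of S \<and> seg i edge_of S}"
    then obtain a b c where t: "tetra p S a b c" using obtain_tetra by blast
    then show "Dangle S i j = Dangle S j i" using S seg_edge_of_tetra[OF t] Dangle_commute[OF t] by blast
  qed auto
  then show ?thesis unfolding Lambda_eq[OF i j] Lambda_eq[OF j i] * .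
qed

section \<open>The quadratic form as a sum over oriented triangles\<close>

definition metric_form :: "(real^3 \<Rightarrow> real) \<Rightarrow> tri \<Rightarrow> real"
  where "metric_form y = (\<lambda>(a, b, c). wt a b c *
    ((a \<bullet> b) / (a \<bullet> a) * (y a)\<^sup>2 + (a \<bullet> b) / (b \<bullet> b) * (y b)\<^sup>2 - 2 * y a * y b))"

text \<open>The substitution absorbs the factors \<open>norm a * norm b\<close> of the mixed
  derivatives; on the diagonal it costs the division by \<open>a \<bullet> a\<close>.\<close>

lemma tetra_form:
  assumes t: "tetra p S a b c" and y: "\<And>i. y i = norm i * X i"
  shows "(\<Sum>i\<in>{a, b, c}. \<Sum>j\<in>{a, b, c}. X i * Dangle S i j * X j)
    = metric_form y (a, b, c) + metric_form y (b, c, a) + metric_form y (c, a, b)"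
proof -
  note t' = tetra_rotate[OF t] and t'' = tetra_rotate[OF tetra_rotate[OF t]]
  have d: "a \<noteq> b" "b \<noteq> c" "a \<noteq> c" and nz: "a \<noteq> 0" "b \<noteq> 0" "c \<noteq> 0" using tetra_distinct[OF t] by auto
  have sq: "g / (v \<bullet> v) * (y v)\<^sup>2 = g * (X v)\<^sup>2" if "v \<noteq> 0" for v and g :: real
    using that by (simp add: y power_mult_distrib power2_norm_eq_inner)
  have "(\<Sum>i\<in>{a, b, c}. \<Sum>j\<in>{a, b, c}. X i * Dangle S i j * X j) =
    X a * Dangle S a a * X a + X a * Dangle S a b * X b + X a * Dangle S a c * X c
    + X b * Dangle S b a * X a + X b * Dangle S b b * X b + X b * Dangle S b c * X c
    + X c * Dangle S c a * X a + X c * Dangle S c b * X b + X c * Dangle S c c * X c"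
    using d by simp
  also have "\<dots> = metric_form y (a, b, c) + metric_form y (b, c, a) + metric_form y (c, a, b)"
    unfolding metric_form_def case_prod_conv sq[OF nz(1)] sq[OF nz(2)] sq[OF nz(3)]
    unfolding Dangle_tetra[OF t] Dangle_tetra[OF t'] Dangle_tetra[OF t''] y inner_commute[of b a] inner_commute[of c b] inner_commute[of a c]
    by (simp add: power2_eq_square algebra_simps)
  finally show ?thesis .
qed

lemma sum_TR:
  fixes F :: "tri \<Rightarrow> real"
  shows "(\<Sum>t\<in>TR. F t) = (\<Sum>S\<in>\<T>. \<Sum>t\<in>{(a, b, c). tetra p S a b c}. F t)"
proof -
  define g where "g = (\<lambda>(a, b, c). convex hull {p, p + a, p + b, p + c})"
  have "g ` TR \<subseteq> \<T>" by (auto simp: g_def TR_def tetra_def)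
  then have "(\<Sum>t\<in>TR. F t) = (\<Sum>S\<in>\<T>. \<Sum>t\<in>{t \<in> TR. g t = S}. F t)"
    using sum.group[OF finite_TR finite_T, of g F] by simp
  also have "\<dots> = (\<Sum>S\<in>\<T>. \<Sum>t\<in>{(a, b, c). tetra p S a b c}. F t)"
  proof (intro sum.cong refl)
    fix S assume "S \<in> \<T>"
    then show "{t \<in> TR. g t = S} = {(a, b, c). tetra p S a b c}" by (auto simp: g_def TR_def tetra_def)
  qed
  finally show ?thesis .
qed

text \<open>Each matrix entry is a sum over tetrahedra; regrouping by tetrahedra leaves three
  rotated triangles for each.\<close>

lemma Lambda_form:
  fixes x :: "(real^3) set \<Rightarrow> real"
  defines "y \<equiv> \<lambda>i. if i \<in> I then norm i * x (seg i) else 0"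
  shows "(\<Sum>e\<in>interior_edges \<K> \<T>. \<Sum>f\<in>interior_edges \<K> \<T>. x e * Lambda_matrix \<K> \<T> e f * x f)
    = (\<Sum>t\<in>TR. metric_form y t)"
proof -
  \<comment> \<open>Extension by zero lets the sums over \<open>I\<close> run over all three edges
    of a tetrahedron at the apex, boundary edges included.\<close>
  define X where "X = (\<lambda>i. if i \<in> I then x (seg i) else 0)"
  have yX: "y i = norm i * X i" for i by (simp add: y_def X_def)
  have "(\<Sum>e\<in>interior_edges \<K> \<T>. \<Sum>f\<in>interior_edges \<K> \<T>. x e * Lambda_matrix \<K> \<T> e f * x f)
     = (\<Sum>i\<in>I. \<Sum>j\<in>I. X i * Lambda_matrix \<K> \<T> (seg i) (seg j) * X j)"
    unfolding interior_edges_eq by (simp add: sum.reindex[OF inj_on_seg] X_def)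
  also have "\<dots> = (\<Sum>i\<in>I. \<Sum>j\<in>I. \<Sum>S\<in>\<T>. if seg i edge_of S then X i * Dangle S i j * X j else 0)"
    by (intro sum.cong refl)
       (simp add: Lambda_eq sum_distrib_left sum_distrib_right sum.inter_filter[OF finite_T, symmetric])
  also have "\<dots> = (\<Sum>i\<in>I. \<Sum>S\<in>\<T>. \<Sum>j\<in>I. if seg i edge_of S then X i * Dangle S i j * X j else 0)"
    by (intro sum.cong refl sum.swap)
  also have "\<dots> = (\<Sum>S\<in>\<T>. \<Sum>i\<in>I. \<Sum>j\<in>I. if seg i edge_of S then X i * Dangle S i j * X j else 0)"
    by (rule sum.swap)
  also have "\<dots> = (\<Sum>S\<in>\<T>. \<Sum>t\<in>{(a, b, c). tetra p S a b c}. metric_form y t)"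
  proof (intro sum.cong refl)
    fix S assume "S \<in> \<T>"
    then obtain a b c where t: "tetra p S a b c" using obtain_tetra by blast
    have d: "distinct [0, a, b, c]" using tetra_distinct[OF t] .
    let ?h = "\<lambda>i j. if seg i edge_of S then X i * Dangle S i j * X j else 0"
    have "(\<Sum>i\<in>I. \<Sum>j\<in>I. ?h i j) = (\<Sum>i\<in>I \<inter> {a, b, c}. \<Sum>j\<in>I. ?h i j)"
      using finite_I seg_edge_of_tetra[OF t] by (intro sum.mono_neutral_right) (auto intro: sum.neutral)
    also have "\<dots> = (\<Sum>i\<in>I \<inter> {a, b, c}. \<Sum>j\<in>I \<inter> {a, b, c}. ?h i j)"
      using finite_I zero_notin_I Dangle_eq_0[OF t] by (intro sum.cong sum.mono_neutral_right refl) auto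
    also have "\<dots> = (\<Sum>i\<in>I \<inter> {a, b, c}. \<Sum>j\<in>I \<inter> {a, b, c}. X i * Dangle S i j * X j)"
      using seg_edge_of_tetra[OF t] by (intro sum.cong refl) auto
    also have "\<dots> = (\<Sum>i\<in>I \<inter> {a, b, c}. \<Sum>j\<in>{a, b, c}. X i * Dangle S i j * X j)"
      by (intro sum.cong[OF refl] sum.mono_neutral_left) (auto simp: X_def)
    also have "\<dots> = (\<Sum>i\<in>{a, b, c}. \<Sum>j\<in>{a, b, c}. X i * Dangle S i j * X j)"
      by (intro sum.mono_neutral_left) (auto simp: X_def)
    also have "\<dots> = metric_form y (a, b, c) + metric_form y (b, c, a) + metric_form y (c, a, b)"
      by (rule tetra_form[OF t yX])
    also have "\<dots> = (\<Sum>t\<in>{(a, b, c), (b, c, a), (c, a, b)}. metric_form y t)"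
      using d by simp
    also have "{(a, b, c), (b, c, a), (c, a, b)} = {(a, b, c). tetra p S a b c}"
      using tetra_unique_up_to_rotation[OF t] t tetra_rotate[OF t] tetra_rotate[OF tetra_rotate[OF t]]
      by blast
    finally show "(\<Sum>i\<in>I. \<Sum>j\<in>I. ?h i j) = (\<Sum>t\<in>{(a, b, c). tetra p S a b c}. metric_form y t)" .
  qed
  also have "\<dots> = (\<Sum>t\<in>TR. metric_form y t)" by (rule sum_TR[symmetric])
  finally show ?thesis .
qed

lemma Lambda_pos:
  fixes x :: "(real^3) set \<Rightarrow> real"
  assumes "e \<in> interior_edges \<K> \<T>" "x e \<noteq> 0"
  shows "(\<Sum>e\<in>interior_edges \<K> \<T>. \<Sum>f\<in>interior_edges \<K> \<T>. x e * Lambda_matrix \<K> \<T> e f * x f) > 0"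
proof -
  define y where "y = (\<lambda>i. if i \<in> I then norm i * x (seg i) else 0)"
  obtain i where i: "i \<in> I" "e = seg i" using assms(1) by (rule interior_edge_contains_apex)
  obtain \<alpha> where \<alpha>: "\<And>v. v \<in> V \<Longrightarrow> \<alpha> \<bullet> v > 0" using V_half_space by blast
  interpret F: closed_fan V I "mset_set TR"
    using finite_V fan_TR I_subset_V by unfold_locales
  have y0: "y v = 0" if "v \<notin> I" for v using that by (simp add: y_def)
  have "y i \<noteq> 0" using i assms(2) zero_notin_I by (auto simp: y_def)
  then have "fan_form ((\<bullet>) \<alpha>) y (mset_set TR) > 0"
    using V_convex_position by (intro fan_form_pos[OF finite_V I_subset_V fan_TR \<alpha>] y0) auto
  also have "fan_form ((\<bullet>) \<alpha>) y (mset_set TR) = (\<Sum>t\<in>TR. metric_form y t)"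
    unfolding metric_form_def sum_unfold_sum_mset by (rule F.fan_form_eq_metric_form[OF \<alpha> y0])
  finally show ?thesis unfolding Lambda_form y_def .
qed

end

theorem theorem1p5:
  fixes P :: "(real^3) set" and \<K> \<T> :: "(real^3) set set" and v\<^sub>0 :: "real^3"
  assumes "triangulated_polyhedron P \<K>"
    and "weakly_convex P \<K>"
    and "v\<^sub>0 \<in> verts \<K>"
    and "star_shaped_wrt P \<K> v\<^sub>0"
    and "star_triangulation P \<K> v\<^sub>0 \<T>"
  shows "(\<forall>e\<in>interior_edges \<K> \<T>. \<forall>f\<in>interior_edges \<K> \<T>.
            has_partial_deriv_at (total_angle \<K> \<T> e) f diameter) \<and>
         positive_definite_on (interior_edges \<K> \<T>) (Lambda_matrix \<K> \<T>)"
proof -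
  interpret star_polyhedron P \<K> \<T> v\<^sub>0 using assms by unfold_locales
  show ?thesis unfolding positive_definite_on_def
  proof (intro conjI ballI allI impI)
    fix e f assume "e \<in> interior_edges \<K> \<T>" "f \<in> interior_edges \<K> \<T>"
    then obtain i j where ij: "i \<in> I" "j \<in> I" and e: "e = seg i" "f = seg j" unfolding interior_edges_eq by blast
    show "has_partial_deriv_at (total_angle \<K> \<T> e) f diameter"
      unfolding has_partial_deriv_at_def e real_differentiable_def using total_angle_has_deriv[OF ij] by blast
    show "Lambda_matrix \<K> \<T> e f = Lambda_matrix \<K> \<T> f e"
      unfolding e by (rule Lambda_commute[OF ij])
  next
    fix x :: "(real^3) set \<Rightarrow> real" assume "\<exists>i\<in>interior_edges \<K> \<T>. x i \<noteq> 0"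
    then show "0 < (\<Sum>i\<in>interior_edges \<K> \<T>. \<Sum>j\<in>interior_edges \<K> \<T>. x i * Lambda_matrix \<K> \<T> i j * x j)"
      using Lambda_pos by blast
  qed
qed

end
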